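(* Let $1<\beta<+\infty$. There exists a bounded linear operator $\mathbf{E}:\mathrm{BV}([-\beta,\beta]\setminus[-1,1])\to L^1(\mathbb{R})$ with the following properties: (i) $\mathbf{E}$ is an extension operator, in the sense that $\mathbf{E}f(x)=f(x)$ for almost every $x\in[-\beta,\beta]\setminus[-1,1]$, for all $f\in\mathrm{BV}([-\beta,\beta]\setminus[-1,1])$. (ii) The range of $\mathbf{E}$ is infinite-dimensional and contained in $\mathcal{M}_\beta^\bot$.
   Context: For $\beta>0$, $$\mathcal{M}_\beta^\bot=\Big\{f\in L^1(\mathbb{R}):\ \int_{\mathbb{R}} f(x)e^{i n\pi x}\,dx=\int_{\mathbb{R}} f(x)e^{i n\pi\beta/x}\,dx=0\ \text{ for all } n\in\mathbb{Z}\Big\}.$$ For a closed bounded interval $I$, $\mathrm{BV}(I)$ is the space of (classes of) complex-valued functions $h\in L^1(I)$ having a representative of bounded variation, with norm $\|h\|_{\mathrm{BV}}=\|h\|_{L^1(I)}+\inf_{\tilde h\sim h}\mathrm{var}_I(\tilde h)$, the infimum being over all representatives $\tilde h$ of $h$ and $\mathrm{var}_I$ being the total variation. $\mathrm{BV}([-\beta,\beta]\setminus[-1,1])$ is the space of complex-valued integrable functions on $[-\beta,-1]\cup[1,\beta]$ whose restrictions to $[-\beta,-1]$ and to $[1,\beta]$ belong to $\mathrm{BV}([-\beta,-1])$ and $\mathrm{BV}([1,\beta])$, respectively (normed by the sum of the two $\mathrm{BV}$-norms). *)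

theory Defs
  imports "HOL-Analysis.Analysis"
begin

text \<open>
  Elements of the function spaces below are represented by total functions of type
  \<open>real \<Rightarrow> complex\<close>. Two such functions stand for the same element iff they agree almost everywhere
  on the set where the space lives; the values outside that set are irrelevant. Everything is taken
  with respect to Lebesgue measure, and linearity is complex linearity.
\<close>

definition L1 :: "(real \<Rightarrow> complex) set"
  where "L1 = {f. integrable lebesgue f}"

definition L1_norm :: "(real \<Rightarrow> complex) \<Rightarrow> real"
  where "L1_norm f = (LINT x|lebesgue. norm (f x))"

definition M_perp :: "real \<Rightarrow> (real \<Rightarrow> complex) set"
  where "M_perp \<beta> = {f \<in> L1. \<forall>n::int.
    (LINT x|lebesgue. f x * exp (\<i> * of_int n * of_real (pi * x))) = 0 \<and>
    (LINT x|lebesgue. f x * exp (\<i> * of_int n * of_real (pi * \<beta> / x))) = 0}"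

definition variation_sums :: "(real \<Rightarrow> complex) \<Rightarrow> real set \<Rightarrow> real set"
  where "variation_sums h I = {(\<Sum>i<n. norm (h (t (Suc i)) - h (t i))) | (n::nat) (t :: nat \<Rightarrow> real).
    (\<forall>i\<le>n. t i \<in> I) \<and> (\<forall>i<n. t i \<le> t (Suc i))}"

definition bounded_variation_on :: "(real \<Rightarrow> complex) \<Rightarrow> real set \<Rightarrow> bool"
  where "bounded_variation_on h I \<longleftrightarrow> bdd_above (variation_sums h I)"

text \<open>A real supremum, hence meaningful only for functions of bounded variation.\<close>

definition total_variation :: "(real \<Rightarrow> complex) \<Rightarrow> real set \<Rightarrow> real"
  where "total_variation h I = Sup (variation_sums h I)"

definition BV_representatives :: "real set \<Rightarrow> (real \<Rightarrow> complex) \<Rightarrow> (real \<Rightarrow> complex) set"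
  where "BV_representatives I h =
    {g. (AE x\<in>I in lebesgue. g x = h x) \<and> bounded_variation_on g I}"

definition BV :: "real set \<Rightarrow> (real \<Rightarrow> complex) set"
  where "BV I = {h. h absolutely_integrable_on I \<and> BV_representatives I h \<noteq> {}}"

text \<open>
  The infimum may be restricted to representatives of bounded variation: all the others have
  infinite variation.
\<close>

definition BV_norm :: "real set \<Rightarrow> (real \<Rightarrow> complex) \<Rightarrow> real"
  where "BV_norm I h = (LINT x:I|lebesgue. norm (h x)) +
    (INF g\<in>BV_representatives I h. total_variation g I)"

text \<open>
  The space of functions of bounded variation on \<open>[-\<beta>,\<beta>]\<close> without \<open>[-1,1]\<close>, which up to null
  sets is \<open>outer \<beta>\<close>. The two components are treated separately, so nothing relates the values
  at \<open>-1\<close> and at \<open>1\<close>.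
\<close>

definition outer :: "real \<Rightarrow> real set"
  where "outer \<beta> = {-\<beta>..-1} \<union> {1..\<beta>}"

definition BV_outer :: "real \<Rightarrow> (real \<Rightarrow> complex) set"
  where "BV_outer \<beta> = {h. h absolutely_integrable_on outer \<beta> \<and> h \<in> BV {-\<beta>..-1} \<and> h \<in> BV {1..\<beta>}}"

definition BV_outer_norm :: "real \<Rightarrow> (real \<Rightarrow> complex) \<Rightarrow> real"
  where "BV_outer_norm \<beta> h = BV_norm {-\<beta>..-1} h + BV_norm {1..\<beta>} h"

text \<open>
  An operator on representatives that descends to a bounded linear operator between the spaces of
  classes; the second conjunct is well-definedness on classes.
\<close>

definition bounded_linear_BV_outer_L1 ::
    "real \<Rightarrow> ((real \<Rightarrow> complex) \<Rightarrow> (real \<Rightarrow> complex)) \<Rightarrow> bool"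
  where "bounded_linear_BV_outer_L1 \<beta> E \<longleftrightarrow>
    (\<forall>f\<in>BV_outer \<beta>. E f \<in> L1) \<and>
    (\<forall>f\<in>BV_outer \<beta>. \<forall>g\<in>BV_outer \<beta>.
      (AE x\<in>outer \<beta> in lebesgue. f x = g x) \<longrightarrow> (AE x in lebesgue. E f x = E g x)) \<and>
    (\<forall>f\<in>BV_outer \<beta>. \<forall>g\<in>BV_outer \<beta>. AE x in lebesgue. E (\<lambda>y. f y + g y) x = E f x + E g x) \<and>
    (\<forall>c. \<forall>f\<in>BV_outer \<beta>. AE x in lebesgue. E (\<lambda>y. c * f y) x = c * E f x) \<and>
    (\<exists>C. \<forall>f\<in>BV_outer \<beta>. L1_norm (E f) \<le> C * BV_outer_norm \<beta> f)"

text \<open>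
  For a set of functions representing a complex linear subspace of \<open>L1\<close>: no finite subset spans
  it modulo null sets.
\<close>

definition infinite_dimensional_ae :: "(real \<Rightarrow> complex) set \<Rightarrow> bool"
  where "infinite_dimensional_ae S \<longleftrightarrow>
    \<not> (\<exists>B. finite B \<and> B \<subseteq> S \<and>
        (\<forall>f\<in>S. \<exists>c. AE x in lebesgue. f x = (\<Sum>b\<in>B. c b * b x)))"

end

theory Submission
  imports Defs
begin

text \<open>
  Membership of \<open>f\<close> in \<open>M_perp \<beta>\<close> means that the sums of \<open>f(x + 2j)\<close> and of \<open>(J f)(x + 2j)\<close> over all
  integers \<open>j\<close> vanish, where \<open>(J f)(x) = \<beta>/x\<^sup>2 f(\<beta>/x)\<close>. Let \<open>S\<close> be the sum over \<open>j \<noteq> 0\<close>, regarded as a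
  function on \<open>[-1,1]\<close>, and \<open>T = S J\<close>, the transfer operator of the Gauss-type map
  \<open>x \<mapsto> \<beta>/x mod 2\<close>. For given \<open>g\<close> on \<open>outer \<beta>\<close>, the function that equals \<open>g\<close> there, \<open>u\<close> on
  \<open>[-1,1]\<close> and \<open>J v\<close> beyond \<open>\<plusminus>\<beta>\<close> is orthogonal iff \<open>u = p - T v\<close> and \<open>v = q - T u\<close> with \<open>p = -S g\<close>
  and \<open>q = -S J g\<close>. This reduces to \<open>(1 - T\<^sup>2) u = p - T q\<close>, whose right-hand side has mean zero
  and bounded variation, so that \<open>u\<close> can be given by a Neumann series once \<open>T\<^sup>n\<close> decays exponentially
  on such functions.

  The decay follows from a Lasota--Yorke inequality together with a Doeblin-type minorization: a
  positive density of controlled variation is large on some interval of a fixed partition, every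
  interval eventually covers \<open>[-1,1]\<close> under the map, and splitting off the resulting multiple of
  \<open>1\<close> contracts a cone of densities.
\<close>

section \<open>The operators\<close>

text \<open>Since \<open>T\<close> preserves integrals, its powers cannot tend to 0 on functions of
  nonzero mean. The series is saved because \<open>J\<close>, and \<open>S\<close> on functions
  vanishing in (-1,1), preserve integrals as well: the mean of \<open>p - T q\<close> is that of
  \<open>J g\<close> minus that of \<open>g\<close>, hence zero. The minorization speaks of positive
  functions only; a function of mean zero is therefore written as a difference of two cone elements
  of equal mass, and the multiples of 1 split off from the two cancel. All operators act on Borel
  functions through pointwise convergent series with supremum bounds, so Neumann series can be
  handled term by term. Null sets return only when a representative is chosen for a class and the
  choice is shown to be harmless. Orthogonality is tested by duality against an arbitrary bounded
  Borel function of period 2; the exponentials are inserted at the end. The range is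
  infinite-dimensional because extension keeps step functions with different jumps
  independent.\<close>

definition fold_sum :: "(real \<Rightarrow> real) \<Rightarrow> real \<Rightarrow> real"
  where "fold_sum g y = (\<Sum>k. g (y + 2 * real k + 2))"

text \<open>The operator \<open>S\<close> of the introduction. \<open>fold_sum\<close> takes the
  positive translates only, whose arguments lie in [1,\<infinity>) for \<open>y\<close> in [-1,1];
  the negative ones enter by reflection, so that every estimate is made on a half line.\<close>

definition periodize :: "(real \<Rightarrow> real) \<Rightarrow> real \<Rightarrow> real"
  where "periodize g y = indicator {-1..1} y * (fold_sum g y + fold_sum (\<lambda>x. g (-x)) (-y))"

text \<open>Makes the folded series converge at every point of [-1,1], not just almost everywhere.
  For \<open>J h\<close> the decay comes from the factor \<open>\<beta> / y\<^sup>2\<close>.\<close>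

definition quad_decay :: "real \<Rightarrow> (real \<Rightarrow> real) \<Rightarrow> bool"
  where "quad_decay B g \<longleftrightarrow> (\<forall>y. 1 \<le> \<bar>y\<bar> \<longrightarrow> \<bar>g y\<bar> \<le> B / y\<^sup>2)"

text \<open>The space on which \<open>T\<close> acts. The bound holds at every point rather than
  almost everywhere, so that series of iterates can be summed pointwise.\<close>

definition ufun :: "real \<Rightarrow> (real \<Rightarrow> real) \<Rightarrow> bool"
  where "ufun B h \<longleftrightarrow> h \<in> borel_measurable borel \<and> (\<forall>x. \<bar>h x\<bar> \<le> B * indicator {-1..1} x)"

definition odd_sq_sum :: real
  where "odd_sq_sum = (\<Sum>k. 1 / (2 * real k + 1)\<^sup>2)"

lemma summable_odd_sq: "summable (\<lambda>k. 1 / (2 * real k + 1)\<^sup>2)"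
proof (rule summable_comparison_test')
  show "summable (\<lambda>k. inverse (real (Suc k) ^ 2))"
    using inverse_power_summable[of 2, where 'a=real] summable_Suc_iff[of "\<lambda>k. inverse (real k ^ 2)"]
    by simp
  show "norm (1 / (2 * real k + 1)\<^sup>2) \<le> inverse (real (Suc k) ^ 2)" for k
    by (auto simp: divide_simps intro!: power_mono)
qed

lemma odd_sq_sum_pos: "0 < odd_sq_sum"
  unfolding odd_sq_sum_def by (intro suminf_pos summable_odd_sq) (auto intro: divide_pos_pos)

lemma quad_decay_reflect: "quad_decay B g \<Longrightarrow> quad_decay B (\<lambda>x. g (-x))"
  unfolding quad_decay_def by (metis abs_minus_cancel power2_minus)

lemma quad_decay_nonneg: assumes "quad_decay B g" shows "0 \<le> B"
proof -
  have "\<bar>g 1\<bar> \<le> B / 1\<^sup>2" using assms unfolding quad_decay_def by (metis abs_one order_refl)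
  then show ?thesis by simp
qed

lemma fold_term_bound:
  assumes "quad_decay B g" "-1 \<le> y"
  shows "\<bar>g (y + 2 * real k + 2)\<bar> \<le> B * (1 / (2 * real k + 1)\<^sup>2)"
proof -
  have "\<bar>g (y + 2 * real k + 2)\<bar> \<le> B / (y + 2 * real k + 2)\<^sup>2"
    using assms unfolding quad_decay_def by auto
  also have "\<dots> \<le> B / (2 * real k + 1)\<^sup>2"
    using assms quad_decay_nonneg[OF assms(1)]
    by (intro divide_left_mono power_mono mult_pos_pos zero_less_power) auto
  finally show ?thesis by simp
qed

lemma fold_summable_abs:
  assumes "quad_decay B g" "-1 \<le> y"
  shows "summable (\<lambda>k. \<bar>g (y + 2 * real k + 2)\<bar>)"
  by (rule summable_comparison_test'[OF summable_mult[OF summable_odd_sq, of B]])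
     (use fold_term_bound[OF assms] in auto)

lemma fold_summable:
  assumes "quad_decay B g" "-1 \<le> y"
  shows "summable (\<lambda>k. g (y + 2 * real k + 2))"
  using fold_summable_abs[OF assms] by (rule summable_rabs_cancel)

lemma fold_sum_bound:
  assumes "quad_decay B g" "-1 \<le> y"
  shows "\<bar>fold_sum g y\<bar> \<le> B * odd_sq_sum"
proof -
  have "\<bar>fold_sum g y\<bar> \<le> (\<Sum>k. \<bar>g (y + 2 * real k + 2)\<bar>)"
    unfolding fold_sum_def by (rule summable_rabs[OF fold_summable_abs[OF assms]])
  also have "\<dots> \<le> (\<Sum>k. B * (1 / (2 * real k + 1)\<^sup>2))"
    by (intro suminf_le fold_term_bound[OF assms] fold_summable_abs[OF assms] summable_mult summable_odd_sq)
  also have "\<dots> = B * odd_sq_sum"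
    unfolding odd_sq_sum_def by (rule suminf_mult[OF summable_odd_sq])
  finally show ?thesis .
qed

lemma fold_sum_measurable [measurable]:
  assumes [measurable]: "g \<in> borel_measurable borel"
  shows "fold_sum g \<in> borel_measurable borel"
  unfolding fold_sum_def by measurable

lemma ufun_periodize:
  assumes [measurable]: "g \<in> borel_measurable borel" and d: "quad_decay B g"
  shows "ufun (2 * B * odd_sq_sum) (periodize g)"
  unfolding ufun_def
proof (intro conjI allI)
  show "periodize g \<in> borel_measurable borel"
    unfolding periodize_def by measurable
  fix x show "\<bar>periodize g x\<bar> \<le> 2 * B * odd_sq_sum * indicator {-1..1} x"
    using fold_sum_bound[OF d, of x] fold_sum_bound[OF quad_decay_reflect[OF d], of "-x"]
    unfolding periodize_def by (auto split: split_indicator)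
qed

lemma fold_sum_linear:
  assumes "quad_decay B g" "quad_decay B' g'" "-1 \<le> y"
  shows "fold_sum (\<lambda>x. a * g x + b * g' x) y = a * fold_sum g y + b * fold_sum g' y"
proof -
  have "(\<lambda>k. a * g (y + 2 * real k + 2) + b * g' (y + 2 * real k + 2)) sums
     (a * fold_sum g y + b * fold_sum g' y)"
    unfolding fold_sum_def
    by (intro sums_add sums_mult summable_sums fold_summable[OF assms(1)] fold_summable[OF assms(2)] assms)
  then show ?thesis unfolding fold_sum_def by (simp add: sums_iff)
qed

lemma periodize_linear:
  assumes "quad_decay B g" "quad_decay B' g'"
  shows "periodize (\<lambda>x. a * g x + b * g' x) y = a * periodize g y + b * periodize g' y"
proof (cases "y \<in> {-1..1}")
  case True
  then show ?thesis
    using fold_sum_linear[OF assms, of y a b]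
      fold_sum_linear[OF assms[THEN quad_decay_reflect], of "-y" a b]
    unfolding periodize_def by (simp add: algebra_simps)
qed (simp add: periodize_def)

lemma fold_sum_mono:
  assumes "quad_decay B g" "quad_decay B' g'" "-1 \<le> y" "\<And>x. g x \<le> g' x"
  shows "fold_sum g y \<le> fold_sum g' y"
  unfolding fold_sum_def
  by (intro suminf_le fold_summable[OF assms(1)] fold_summable[OF assms(2)] assms)

lemma periodize_mono:
  assumes "quad_decay B g" "quad_decay B' g'" "\<And>x. g x \<le> g' x"
  shows "periodize g y \<le> periodize g' y"
  using fold_sum_mono[OF assms(1,2), of y]
    fold_sum_mono[OF assms(1,2)[THEN quad_decay_reflect], of "-y"] assms(3)
  unfolding periodize_def by (auto split: split_indicator intro!: add_mono)

text \<open>The intervals [2k+1,2k+3] tile [1,\<infinity>) up to endpoints, and the period 2 lets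
  \<open>\<phi>\<close> move along with each translate. The quadratic decay makes the integrals of
  the terms summable, so sum and integral commute; the partial sums are integrals over
  [1,2n+1].\<close>

lemma fold_sum_integral:
  assumes [measurable]: "g \<in> borel_measurable borel" "\<phi> \<in> borel_measurable borel"
    and d: "quad_decay B g" and int: "integrable lborel g"
    and \<phi>b: "\<And>x. \<bar>\<phi> x\<bar> \<le> M" and per: "\<And>x. \<phi> (x + 2) = \<phi> x"
  shows "(LINT y|lborel. indicator {-1..1} y * fold_sum g y * \<phi> y) =
    (LINT y|lborel. indicator {1..} y * g y * \<phi> y)"
proof -
  have M: "0 \<le> M" using \<phi>b[of 0] by linarith
  have B: "0 \<le> B" using quad_decay_nonneg[OF d] .
  have per': "\<phi> (x + 2 * real k + 2) = \<phi> x" for x k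
    by (induction k) (auto simp: per algebra_simps, metis per add.assoc add.commute numeral_Bit0)
  define f where "f = (\<lambda>k y. indicator {-1..1} y * g (y + 2 * real k + 2) * \<phi> y)"
  define G where "G = (\<lambda>y. g y * \<phi> y)"
  have [measurable]: "f k \<in> borel_measurable borel" for k unfolding f_def by measurable
  have [measurable]: "G \<in> borel_measurable borel" unfolding G_def by measurable
  have intG: "integrable lborel G"
    unfolding G_def
  proof (rule Bochner_Integration.integrable_bound)
    show "integrable lborel (\<lambda>y. M * g y)" using int by simp
    show "AE y in lborel. norm (g y * \<phi> y) \<le> norm (M * g y)"
      using \<phi>b M by (auto simp: abs_mult mult.commute intro!: mult_right_mono AE_I2)
  qed simp
  have f_eq: "f k y = indicator {2 * real k + 1..2 * real k + 3} (y + (2 * real k + 2)) * G (y + (2 * real k + 2))" for k y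
    unfolding f_def G_def using per'[of y k]
    by (auto simp: algebra_simps split: split_indicator)
  have intI: "integrable lborel (\<lambda>y. indicator A y * G y)" if [measurable]: "A \<in> sets borel" for A
    by (rule Bochner_Integration.integrable_bound[OF intG]) (auto split: split_indicator)
  have f_int: "integrable lborel (f k)" for k
    using lborel_integrable_real_affine[OF intI[of "{2 * real k + 1..2 * real k + 3}"], of 1 "2 * real k + 2"]
    unfolding f_eq[abs_def] by (simp add: add.commute)
  have f_int_eq: "(LINT y|lborel. f k y) = (LINT y|lborel. indicator {2 * real k + 1..2 * real k + 3} y * G y)" for k
    using lborel_integral_real_affine[of 1 "\<lambda>y. indicator {2 * real k + 1..2 * real k + 3} y * G y" "2 * real k + 2"]
    unfolding f_eq[abs_def] by (simp add: add.commute)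
  have f_bd: "norm (f k y) \<le> B * M * (1 / (2 * real k + 1)\<^sup>2) * indicator {-1..1} y" for k y
  proof (cases "y \<in> {-1..1}")
    case True
    have "\<bar>g (y + 2 * real k + 2)\<bar> * \<bar>\<phi> y\<bar> \<le> (B * (1 / (2 * real k + 1)\<^sup>2)) * M"
      using fold_term_bound[OF d, of y k] \<phi>b[of y] True B by (intro mult_mono) auto
    then show ?thesis using True unfolding f_def by (simp add: abs_mult mult_ac)
  qed (simp add: f_def)
  have sumf: "summable (\<lambda>k. norm (f k y))" for y
    by (rule summable_comparison_test'[where g = "\<lambda>k. B * M * (1 / (2 * real k + 1)\<^sup>2) * indicator {-1..1} y"])
      (use f_bd in \<open>simp_all only: summable_mult2 summable_mult summable_odd_sq real_norm_def abs_abs\<close>)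
  have sumi: "summable (\<lambda>k. LINT y|lborel. norm (f k y))"
  proof (rule summable_comparison_test'[where g = "\<lambda>k. B * M * (1 / (2 * real k + 1)\<^sup>2) * 2"])
    show "summable (\<lambda>k. B * M * (1 / (2 * real k + 1)\<^sup>2) * 2)"
      by (intro summable_mult2 summable_mult summable_odd_sq)
    fix k
    have "(LINT y|lborel. norm (f k y)) \<le> (LINT y|lborel. B * M * (1 / (2 * real k + 1)\<^sup>2) * indicator {-1..1::real} y)"
      proof (rule integral_mono)
      show "integrable lborel (\<lambda>y. norm (f k y))" using f_int by simp
      show "integrable lborel (\<lambda>y. B * M * (1 / (2 * real k + 1)\<^sup>2) * indicator {-1..1::real} y)"
        by simp
    qed (use f_bd in simp)
    then show "norm (LINT y|lborel. norm (f k y)) \<le> B * M * (1 / (2 * real k + 1)\<^sup>2) * 2"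
      by simp
  qed
  have "(\<lambda>k. LINT y|lborel. f k y) sums (LINT y|lborel. (\<Sum>k. f k y))"
    using sums_integral[OF f_int _ sumi] sumf by (auto intro: sums_integral)
  moreover have "(\<Sum>k. f k y) = indicator {-1..1} y * fold_sum g y * \<phi> y" for y
  proof (cases "y \<in> {-1..1}")
    case True
    then have "(\<lambda>k. g (y + 2 * real k + 2) * \<phi> y) sums (fold_sum g y * \<phi> y)"
      unfolding fold_sum_def by (intro sums_mult2 summable_sums fold_summable[OF d]) auto
    then show ?thesis using True unfolding f_def by (simp add: sums_iff)
  qed (simp add: f_def)
  ultimately have s1: "(\<lambda>n. \<Sum>k<n. LINT y|lborel. f k y) \<longlonglongrightarrow> (LINT y|lborel. indicator {-1..1} y * fold_sum g y * \<phi> y)"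
    unfolding sums_def by simp
  have part: "(\<Sum>k<n. LINT y|lborel. f k y) = (LINT y|lborel. indicator {1..2 * real n + 1} y * G y)" for n
  proof (induction n)
    case 0
    have "(LINT y|lborel. indicator {1::real..1} y * G y) = 0"
      by (rule integral_eq_zero_AE) (use AE_lborel_singleton[of "1::real"] in eventually_elim, auto split: split_indicator)
    then show ?case by simp
  next
    case (Suc n)
    have "(LINT y|lborel. indicator {1..2 * real (Suc n) + 1} y * G y) =
      (LINT y|lborel. indicator {1..2 * real n + 1} y * G y + indicator {2 * real n + 1..2 * real n + 3} y * G y)"
    proof (rule integral_cong_AE)
      show "AE y in lborel. indicator {1..2 * real (Suc n) + 1} y * G y =
          indicator {1..2 * real n + 1} y * G y + indicator {2 * real n + 1..2 * real n + 3} y * G y"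
        using AE_lborel_singleton[of "2 * real n + 1"] by eventually_elim (auto split: split_indicator)
    qed auto
    also have "\<dots> = (LINT y|lborel. indicator {1..2 * real n + 1} y * G y) +
        (LINT y|lborel. indicator {2 * real n + 1..2 * real n + 3} y * G y)"
      by (intro Bochner_Integration.integral_add intI) auto
    finally show ?case using Suc f_int_eq[of n] by simp
  qed
  have s2: "(\<lambda>n. LINT y|lborel. indicator {1..2 * real n + 1} y * G y) \<longlonglongrightarrow> (LINT y|lborel. indicator {1..} y * G y)"
  proof (rule integral_dominated_convergence[where w = "\<lambda>y. norm (G y)"])
    show "AE y in lborel. (\<lambda>n. indicator {1..2 * real n + 1} y * G y) \<longlonglongrightarrow> indicator {1..} y * G y"
    proof (rule AE_I2)
      fix y
      have "eventually (\<lambda>n. y \<le> 2 * real n + 1) sequentially"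
        using eventually_ge_at_top[of "nat \<lceil>y\<rceil>"] by eventually_elim linarith
      then have "eventually (\<lambda>n. indicator {1..2 * real n + 1} y * G y = indicator {1..} y * G y) sequentially"
        by eventually_elim (auto split: split_indicator)
      then show "(\<lambda>n. indicator {1..2 * real n + 1} y * G y) \<longlonglongrightarrow> indicator {1..} y * G y"
        by (rule tendsto_eventually)
    qed
  qed (use intG in \<open>auto split: split_indicator\<close>)
  have "(LINT y|lborel. indicator {-1..1} y * fold_sum g y * \<phi> y) = (LINT y|lborel. indicator {1..} y * G y)"
    using LIMSEQ_unique[OF s1 s2[folded part]] .
  then show ?thesis by (simp add: G_def mult.assoc)
qed

lemma ufunD:
  assumes "ufun B h"
  shows "h \<in> borel_measurable borel" "\<bar>h x\<bar> \<le> B" "x \<notin> {-1..1} \<Longrightarrow> h x = 0" "0 \<le> B" "integrable lborel h"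
proof -
  show [measurable]: "h \<in> borel_measurable borel" using assms unfolding ufun_def by blast
  have b: "\<bar>h x\<bar> \<le> B * indicator {-1..1} x" for x using assms unfolding ufun_def by blast
  have "\<bar>h 0\<bar> \<le> B" using b[of 0] by simp
  then show B: "0 \<le> B" by linarith
  show "\<bar>h x\<bar> \<le> B" using b[of x] B by (auto split: split_indicator_asm)
  show "x \<notin> {-1..1} \<Longrightarrow> h x = 0" using b[of x] by simp
  show "integrable lborel h"
    by (rule Bochner_Integration.integrable_bound[of _ "\<lambda>x. B * indicator {-1..1} x"]) (use b B in auto)
qed

lemma ufun_L1_le:
  assumes "ufun B h" shows "(LINT x|lborel. \<bar>h x\<bar>) \<le> 2 * B"
proof -
  have "(LINT x|lborel. \<bar>h x\<bar>) \<le> (LINT x|lborel. B * indicator {-1..1::real} x)"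
    by (rule integral_mono) (use assms ufunD(5)[OF assms] in \<open>auto simp: ufun_def\<close>)
  then show ?thesis by simp
qed

lemma integrable_mult_bounded:
  fixes h \<phi> :: "real \<Rightarrow> real"
  assumes "integrable lborel h" "\<phi> \<in> borel_measurable borel" "\<And>x. \<bar>\<phi> x\<bar> \<le> M"
  shows "integrable lborel (\<lambda>x. h x * \<phi> x)"
proof (rule Bochner_Integration.integrable_bound)
  have [measurable]: "h \<in> borel_measurable borel" "\<phi> \<in> borel_measurable borel" using assms by auto
  show "integrable lborel (\<lambda>y. M * h y)" using assms by simp
  have "0 \<le> M" using assms(3)[of 0] by linarith
  then show "AE y in lborel. norm (h y * \<phi> y) \<le> norm (M * h y)"
    using assms(3) by (auto simp: abs_mult mult.commute intro!: mult_right_mono AE_I2)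
  show "(\<lambda>x. h x * \<phi> x) \<in> borel_measurable lborel" by simp
qed

text \<open>The translate by 0 that \<open>periodize\<close> omits would only contribute
  \<open>g\<close> on (-1,1), where \<open>g\<close> vanishes. Hence folding changes neither the
  mean nor any pairing with a 2-periodic function.\<close>

lemma periodize_integral:
  assumes [measurable]: "g \<in> borel_measurable borel" "\<phi> \<in> borel_measurable borel"
    and d: "quad_decay B g" and int: "integrable lborel g" and z: "\<And>x. \<bar>x\<bar> < 1 \<Longrightarrow> g x = 0"
    and \<phi>b: "\<And>x. \<bar>\<phi> x\<bar> \<le> M" and per: "\<And>x. \<phi> (x + 2) = \<phi> x"
  shows "(LINT y|lborel. periodize g y * \<phi> y) = (LINT y|lborel. g y * \<phi> y)"
proof -
  let ?r = "\<lambda>f x. f (-x) :: real"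
  have bg: "ufun (2 * B * odd_sq_sum) (periodize g)" by (rule ufun_periodize[OF assms(1) d])
  have ir: "integrable lborel (?r g)"
    using lborel_integrable_real_affine[OF int, of "-1" 0] by simp
  have intgp: "integrable lborel (\<lambda>x. g x * \<phi> x)"
    by (rule integrable_mult_bounded[OF int]) (use \<phi>b in auto)
  have ii: "integrable lborel (\<lambda>y. indicator {-1..1} y * fold_sum g' y * \<phi> y)"
    if [measurable]: "g' \<in> borel_measurable borel" and d': "quad_decay B g'" and [measurable]: "\<phi> \<in> borel_measurable borel"
      and pb: "\<And>x. \<bar>\<phi> x\<bar> \<le> M" for g' \<phi>
  proof (rule integrable_mult_bounded[where M=M])
    show "integrable lborel (\<lambda>y. indicator {-1..1} y * fold_sum g' y)"
    proof (rule Bochner_Integration.integrable_bound[of _ "\<lambda>x. (B * odd_sq_sum) * indicator {-1..1} x"])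
      show "AE x in lborel. norm (indicat_real {- 1..1} x * fold_sum g' x) \<le> norm (B * odd_sq_sum * indicat_real {- 1..1} x)"
      proof (rule AE_I2)
        fix x show "norm (indicat_real {- 1..1} x * fold_sum g' x) \<le> norm (B * odd_sq_sum * indicat_real {- 1..1} x)"
          using fold_sum_bound[OF d', of x] by (auto split: split_indicator)
      qed
    qed auto
  qed (use pb in auto)
  have perm: "\<phi> (- (x + 2)) = \<phi> (-x)" for x using per[of "-x-2"] by simp
  have e1: "(LINT y|lborel. indicator {-1..1} y * fold_sum (?r g) (-y) * \<phi> y)
      = (LINT y|lborel. indicator {-1..1} y * fold_sum (?r g) y * \<phi> (-y))"
    by (subst lborel_integral_real_affine[of "-1" _ 0]) (auto intro!: Bochner_Integration.integral_cong simp: indicator_def)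
  have i2: "integrable lborel (\<lambda>y. indicator {-1..1} y * fold_sum (?r g) (-y) * \<phi> y)"
    using lborel_integrable_real_affine[OF ii[OF _ quad_decay_reflect[OF d], of "\<lambda>y. \<phi> (-y)"], of "-1" 0] \<phi>b
    by (simp add: indicator_def conj_commute)
  have "(LINT y|lborel. periodize g y * \<phi> y) =
     (LINT y|lborel. indicator {-1..1} y * fold_sum g y * \<phi> y + indicator {-1..1} y * fold_sum (?r g) (-y) * \<phi> y)"
    unfolding periodize_def by (simp add: algebra_simps)
  also have "\<dots> = (LINT y|lborel. indicator {-1..1} y * fold_sum g y * \<phi> y) +
      (LINT y|lborel. indicator {-1..1} y * fold_sum (?r g) (-y) * \<phi> y)"
    by (intro Bochner_Integration.integral_add i2 ii[OF _ d]) (use \<phi>b in auto)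
  also have "\<dots> = (LINT y|lborel. indicator {1..} y * g y * \<phi> y) + (LINT y|lborel. indicator {1..} y * g (-y) * \<phi> (-y))"
    unfolding e1
    using fold_sum_integral[of g \<phi>, OF _ _ d int \<phi>b per]
      fold_sum_integral[of "?r g" "\<lambda>y. \<phi> (-y)", OF _ _ quad_decay_reflect[OF d] ir, of M] \<phi>b perm by simp
  also have "(LINT y|lborel. indicator {1..} y * g (-y) * \<phi> (-y)) = (LINT y|lborel. indicator {..-1} y * g y * \<phi> y)"
    by (subst lborel_integral_real_affine[of "-1" _ 0]) (auto intro!: Bochner_Integration.integral_cong simp: indicator_def)
  also have "(LINT y|lborel. indicator {1..} y * g y * \<phi> y) + (LINT y|lborel. indicator {..-1} y * g y * \<phi> y)
    = (LINT y|lborel. indicator {1..} y * g y * \<phi> y + indicator {..-1} y * g y * \<phi> y)"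
  proof (rule Bochner_Integration.integral_add[symmetric])
    show "integrable lborel (\<lambda>y. indicator {1..} y * g y * \<phi> y)"
      "integrable lborel (\<lambda>y. indicator {..-1} y * g y * \<phi> y)"
      by (rule Bochner_Integration.integrable_bound[OF intgp]; auto split: split_indicator)+
  qed
  also have "\<dots> = (LINT y|lborel. g y * \<phi> y)"
    using z by (intro Bochner_Integration.integral_cong) (auto split: split_indicator)
  finally show ?thesis .
qed

section \<open>The inversion \<open>J\<close> and the transfer operator \<open>T\<close>\<close>

locale gauss_map =
  fixes \<beta> :: real
  assumes beta_gt_1: "1 < \<beta>"
begin

text \<open>The substitution \<open>x \<mapsto> \<beta>/x\<close> acting on densities. It preserves
  integrals, maps functions on \<open>outer \<beta>\<close> to such functions and exchanges [-1,1]
  with the region beyond \<plusminus>\<beta>. At 0 division by zero yields the value 0.\<close>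

definition J :: "(real \<Rightarrow> real) \<Rightarrow> real \<Rightarrow> real"
  where "J g y = \<beta> / y\<^sup>2 * g (\<beta> / y)"

definition T :: "(real \<Rightarrow> real) \<Rightarrow> real \<Rightarrow> real"
  where "T h = periodize (J h)"

lemma beta_pos: "0 < \<beta>" using beta_gt_1 by simp

lemma J_measurable [measurable]:
  assumes [measurable]: "g \<in> borel_measurable borel"
  shows "J g \<in> borel_measurable borel"
  unfolding J_def by measurable

text \<open>Change of variables on the line without 0, where \<open>x \<mapsto> \<beta>/x\<close> is
  a bijection onto itself. The substitution rule speaks of \<open>lebesgue\<close>, hence the
  passage there and back.\<close>

lemma J_integral:
  assumes int: "integrable lborel k"
  shows "integrable lborel (J k)" "(LINT y|lborel. J k y) = (LINT x|lborel. k x)"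
proof -
  have [measurable]: "k \<in> borel_measurable borel" using int by auto
  let ?A = "UNIV - {0::real}"
  have AE: "AE x in lebesgue. x \<in> ?A"
    by (rule AE_I[of _ _ "{0}"]) auto
  have der: "((\<lambda>x. \<beta> / x) has_field_derivative (- \<beta> / x\<^sup>2)) (at x within ?A)" if "x \<in> ?A" for x
    using that beta_pos by (auto intro!: derivative_eq_intros simp: power2_eq_square)
  have inj: "inj_on (\<lambda>x. \<beta> / x) ?A" using beta_pos by (auto simp: inj_on_def)
  have im: "(\<lambda>x. \<beta> / x) ` ?A = ?A"
  proof -
    have "x \<in> (\<lambda>x. \<beta> / x) ` ?A" if "x \<noteq> 0" for x
      using that beta_pos by (intro image_eqI[of _ _ "\<beta> / x"]) auto
    then show ?thesis using beta_pos by auto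
  qed
  have ik: "integrable lebesgue k" using int by (simp add: integrable_completion)
  have ai: "k absolutely_integrable_on ?A"
    unfolding set_integrable_def by (rule integrable_mult_indicator) (use ik in auto)
  have ind: "AE x in lebesgue. indicator ?A x *\<^sub>R f x = f x" for f :: "real \<Rightarrow> real"
    using AE by eventually_elim simp
  have ck: "(LINT x:?A|lebesgue. k x) = (LINT x|lborel. k x)"
  proof -
    have "(LINT x:?A|lebesgue. k x) = (LINT x|lebesgue. k x)"
      unfolding set_lebesgue_integral_def using ik ind
      by (intro integral_cong_AE) (auto simp: measurable_completion)
    then show ?thesis by (simp add: integral_completion)
  qed
  have ch: "(\<lambda>x. \<bar>- \<beta> / x\<^sup>2\<bar> * k (\<beta> / x)) absolutely_integrable_on ?A \<and>
      integral ?A (\<lambda>x. \<bar>- \<beta> / x\<^sup>2\<bar> * k (\<beta> / x)) = integral ?A k"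
    using has_absolute_integral_change_of_variables_1'[OF _ der inj, of k "integral ?A k"] im ai by simp
  have eJ: "(\<lambda>x. \<bar>- \<beta> / x\<^sup>2\<bar> * k (\<beta> / x)) = J k"
    unfolding J_def using beta_pos by (auto simp: abs_div)
  have Ja: "J k absolutely_integrable_on ?A" and Ji: "integral ?A (J k) = integral ?A k"
    using ch unfolding eJ by auto
  have "integrable lebesgue (J k)"
    using Ja ind[of "J k"] unfolding set_integrable_def
    by (subst integrable_cong_AE[symmetric]) (auto simp: measurable_completion)
  then show "integrable lborel (J k)" by (simp add: integrable_completion)
  have "(LINT x|lborel. J k x) = (LINT x:?A|lebesgue. J k x)"
  proof -
    have "(LINT x:?A|lebesgue. J k x) = (LINT x|lebesgue. J k x)"
      unfolding set_lebesgue_integral_def using ind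
      by (intro integral_cong_AE) (auto simp: measurable_completion)
    then show ?thesis by (simp add: integral_completion)
  qed
  also have "\<dots> = (LINT x:?A|lebesgue. k x)"
    using Ji Ja ai by (simp add: set_lebesgue_integral_eq_integral)
  finally show "(LINT y|lborel. J k y) = (LINT x|lborel. k x)" using ck by simp
qed

lemma J_reflect: "J g (-y) = J (\<lambda>x. g (-x)) y"
  unfolding J_def by simp

lemma J_zero: assumes "ufun B h" "\<bar>y\<bar> < \<beta>" shows "J h y = 0"
proof (cases "y = 0")
  case False
  then have "1 < \<bar>\<beta> / y\<bar>" using assms beta_pos by (simp add: abs_div field_simps)
  then have "\<beta> / y \<notin> {-1..1}" by (metis abs_le_iff atLeastAtMost_iff minus_le_iff not_less)
  then have "h (\<beta> / y) = 0" by (rule ufunD(3)[OF assms(1)])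
  then show ?thesis by (simp add: J_def)
qed (simp add: J_def)

lemma quad_decay_J: assumes "ufun B h" shows "quad_decay (\<beta> * B) (J h)"
  unfolding quad_decay_def J_def
proof (intro allI impI)
  fix y :: real
  have "\<bar>\<beta> / y\<^sup>2 * h (\<beta> / y)\<bar> = \<beta> / y\<^sup>2 * \<bar>h (\<beta> / y)\<bar>"
    using beta_pos by (simp add: abs_mult)
  also have "\<dots> \<le> \<beta> / y\<^sup>2 * B"
    using beta_pos ufunD(2)[OF assms] by (intro mult_left_mono) auto
  finally show "\<bar>\<beta> / y\<^sup>2 * h (\<beta> / y)\<bar> \<le> \<beta> * B / y\<^sup>2" by simp
qed

definition T_const where "T_const = 2 * \<beta> * odd_sq_sum"

lemma T_const_pos: "0 < T_const" unfolding T_const_def using beta_pos odd_sq_sum_pos by simp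

lemma ufun_T: assumes "ufun B h" shows "ufun (T_const * B) (T h)"
  using ufun_periodize[OF J_measurable[OF ufunD(1)[OF assms]] quad_decay_J[OF assms]]
  unfolding T_def T_const_def by (simp add: mult_ac)

lemma T_linear:
  assumes "ufun B h" "ufun B' h'"
  shows "T (\<lambda>x. a * h x + b * h' x) = (\<lambda>x. a * T h x + b * T h' x)"
proof
  fix y
  have "J (\<lambda>x. a * h x + b * h' x) = (\<lambda>x. a * J h x + b * J h' x)"
    unfolding J_def by (auto simp: algebra_simps)
  then show "T (\<lambda>x. a * h x + b * h' x) y = a * T h y + b * T h' y"
    unfolding T_def using periodize_linear[OF assms[THEN quad_decay_J]] by simp
qed

lemma ufun_linear:
  assumes "ufun B h" "ufun B' h'"
  shows "ufun (\<bar>a\<bar> * B + \<bar>b\<bar> * B') (\<lambda>x. a * h x + b * h' x)"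
  unfolding ufun_def
proof (intro conjI allI)
  have [measurable]: "h \<in> borel_measurable borel" "h' \<in> borel_measurable borel"
    using assms[THEN ufunD(1)] .
  show "(\<lambda>x. a * h x + b * h' x) \<in> borel_measurable borel" by measurable
  fix x
  have "\<bar>a * h x + b * h' x\<bar> \<le> \<bar>a\<bar> * \<bar>h x\<bar> + \<bar>b\<bar> * \<bar>h' x\<bar>" by (metis abs_mult abs_triangle_ineq)
  also have "\<dots> \<le> \<bar>a\<bar> * (B * indicator {-1..1} x) + \<bar>b\<bar> * (B' * indicator {-1..1} x)"
    using assms unfolding ufun_def by (intro add_mono mult_left_mono) auto
  finally show "\<bar>a * h x + b * h' x\<bar> \<le> (\<bar>a\<bar> * B + \<bar>b\<bar> * B') * indicator {-1..1} x"
    by (simp add: algebra_simps)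
qed

lemma T_mono:
  assumes "ufun B h" "ufun B' h'" "\<And>x. h x \<le> h' x"
  shows "T h y \<le> T h' y"
  unfolding T_def
  by (rule periodize_mono[OF assms(1,2)[THEN quad_decay_J]])
     (use beta_pos in \<open>auto simp: J_def intro!: divide_right_mono mult_left_mono assms\<close>)

text \<open>The duality that makes \<open>T\<close> a transfer operator: folding does not affect the
  pairing with a 2-periodic \<open>\<phi>\<close>, and \<open>J\<close> becomes composition with
  \<open>x \<mapsto> \<beta>/x\<close>. That \<open>J h\<close> vanishes below \<beta> > 1 provides
  the hypothesis on (-1,1).\<close>

lemma T_integral:
  assumes h: "ufun B h" and [measurable]: "\<phi> \<in> borel_measurable borel"
    and \<phi>b: "\<And>x. \<bar>\<phi> x\<bar> \<le> M" and per: "\<And>x. \<phi> (x + 2) = \<phi> x"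
  shows "(LINT y|lborel. T h y * \<phi> y) = (LINT x|lborel. h x * \<phi> (\<beta> / x))"
proof -
  have [measurable]: "h \<in> borel_measurable borel" using ufunD(1)[OF h] .
  have "(LINT y|lborel. T h y * \<phi> y) = (LINT y|lborel. J h y * \<phi> y)"
    unfolding T_def
    by (rule periodize_integral[of _ \<phi>, OF _ _ quad_decay_J[OF h] J_integral(1)[OF ufunD(5)[OF h]] _ \<phi>b per])
       (use J_zero[OF h] beta_gt_1 in auto)
  also have "\<dots> = (LINT y|lborel. J (\<lambda>x. h x * \<phi> (\<beta> / x)) y)"
    by (intro Bochner_Integration.integral_cong refl) (use beta_pos in \<open>simp add: J_def\<close>)
  also have "\<dots> = (LINT x|lborel. h x * \<phi> (\<beta> / x))"
    by (rule J_integral(2)[OF integrable_mult_bounded[OF ufunD(5)[OF h]]]) (use \<phi>b in auto)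
  finally show ?thesis .
qed

lemma T_integral_1: "ufun B h \<Longrightarrow> (LINT y|lborel. T h y) = (LINT x|lborel. h x)"
  using T_integral[of B h "\<lambda>_. 1" 1] by simp

text \<open>Due to the oddness of \<open>x \<mapsto> \<beta>/x\<close>; it lets intervals to the
  left of 0 be handled by reflection.\<close>

lemma T_reflect: "T (\<lambda>x. h (-x)) y = T h (-y)"
proof -
  have "J (\<lambda>x. h (-x)) = (\<lambda>y. J h (-y))" by (simp add: J_reflect)
  then show ?thesis unfolding T_def periodize_def by (auto simp: indicator_def)
qed

end

section \<open>Majorants of the variation and the Lasota--Yorke inequality\<close>

text \<open>\<open>F\<close> stands in for the variation function of \<open>h\<close>: its
  increments are additive and bound the variation on every subinterval. Any such \<open>F\<close> is
  allowed instead of the least one, because majorants can be glued, rescaled and summed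
  explicitly.\<close>

definition maj :: "real set \<Rightarrow> (real \<Rightarrow> real) \<Rightarrow> (real \<Rightarrow> real) \<Rightarrow> bool"
  where "maj A h F \<longleftrightarrow> (\<forall>x\<in>A. \<forall>y\<in>A. x \<le> y \<longrightarrow> \<bar>h y - h x\<bar> \<le> F y - F x)"

text \<open>
  The map \<open>x \<mapsto> \<beta>/x mod 2\<close>, viewed on the circle, breaks only at \<open>\<plusminus>1\<close>, where \<open>T h\<close> receives new jumps of
  size \<open>\<bar>h(\<plusminus>1)\<bar>/\<beta>\<close>. Counting the variation near \<open>\<plusminus>1\<close> twice absorbs them for every \<open>\<beta> > 1\<close>; the plain
  variation would require \<open>\<beta> > 2\<close>.
\<close>

definition wvar :: "real \<Rightarrow> (real \<Rightarrow> real) \<Rightarrow> real"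
  where "wvar \<delta> F = (F 1 - F (-1)) + (F 1 - F (1 - \<delta>)) + (F (-1 + \<delta>) - F (-1))"

definition wvar_le :: "real \<Rightarrow> (real \<Rightarrow> real) \<Rightarrow> real \<Rightarrow> bool"
  where "wvar_le \<delta> h v \<longleftrightarrow> (\<exists>F. maj {-1..1} h F \<and> wvar \<delta> F \<le> v)"

lemma majD: "maj A h F \<Longrightarrow> x \<in> A \<Longrightarrow> y \<in> A \<Longrightarrow> x \<le> y \<Longrightarrow> \<bar>h y - h x\<bar> \<le> F y - F x"
  unfolding maj_def by blast

lemma maj_mono: "maj A h F \<Longrightarrow> x \<in> A \<Longrightarrow> y \<in> A \<Longrightarrow> x \<le> y \<Longrightarrow> F x \<le> F y"
  using majD by fastforce

lemma maj_subset: "maj A h F \<Longrightarrow> B \<subseteq> A \<Longrightarrow> maj B h F"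
  unfolding maj_def by blast

lemma maj_cong: "maj A h F \<Longrightarrow> (\<And>x. x \<in> A \<Longrightarrow> h' x = h x) \<Longrightarrow> maj A h' F"
  unfolding maj_def by auto

lemma maj_linear:
  assumes "maj A h F" "maj A h' F'"
  shows "maj A (\<lambda>x. a * h x + b * h' x) (\<lambda>x. \<bar>a\<bar> * F x + \<bar>b\<bar> * F' x)"
  unfolding maj_def
proof (intro ballI impI)
  fix x y assume xy: "x \<in> A" "y \<in> A" "x \<le> y"
  have "\<bar>(a * h y + b * h' y) - (a * h x + b * h' x)\<bar> = \<bar>a * (h y - h x) + b * (h' y - h' x)\<bar>"
    by (simp add: algebra_simps)
  also have "\<dots> \<le> \<bar>a\<bar> * \<bar>h y - h x\<bar> + \<bar>b\<bar> * \<bar>h' y - h' x\<bar>"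
    by (metis abs_mult abs_triangle_ineq)
  also have "\<dots> \<le> \<bar>a\<bar> * (F y - F x) + \<bar>b\<bar> * (F' y - F' x)"
    using majD[OF assms(1) xy] majD[OF assms(2) xy] by (intro add_mono mult_left_mono) auto
  finally show "\<bar>(a * h y + b * h' y) - (a * h x + b * h' x)\<bar> \<le>
      (\<bar>a\<bar> * F y + \<bar>b\<bar> * F' y) - (\<bar>a\<bar> * F x + \<bar>b\<bar> * F' x)" by (simp add: algebra_simps)
qed

lemma maj_reflect:
  assumes "maj A h F" shows "maj (uminus ` A) (\<lambda>x. h (-x)) (\<lambda>x. - F (-x))"
  unfolding maj_def
proof (intro ballI impI)
  fix x y assume "x \<in> uminus ` A" "y \<in> uminus ` A" "x \<le> y"
  then have "- y \<in> A" "- x \<in> A" "- y \<le> - x" by auto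
  from majD[OF assms this] show "\<bar>h (-y) - h (-x)\<bar> \<le> - F (-y) - - F (-x)" by linarith
qed

lemma wvar_linear: "wvar \<delta> (\<lambda>x. a * F x + b * F' x) = a * wvar \<delta> F + b * wvar \<delta> F'"
  unfolding wvar_def by (simp add: algebra_simps)

lemma wvar_reflect: "wvar \<delta> (\<lambda>x. - F (-x)) = wvar \<delta> F"
  unfolding wvar_def by (simp add: algebra_simps)

lemma wvar_le_mono: "wvar_le \<delta> h v \<Longrightarrow> v \<le> w \<Longrightarrow> wvar_le \<delta> h w"
  unfolding wvar_le_def by (meson order_trans)

lemma wvar_le_linear:
  assumes "wvar_le \<delta> h v" "wvar_le \<delta> h' v'"
  shows "wvar_le \<delta> (\<lambda>x. a * h x + b * h' x) (\<bar>a\<bar> * v + \<bar>b\<bar> * v')"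
proof -
  obtain F F' where F: "maj {-1..1} h F" "wvar \<delta> F \<le> v" "maj {-1..1} h' F'" "wvar \<delta> F' \<le> v'"
    using assms unfolding wvar_le_def by blast
  have "wvar \<delta> (\<lambda>x. \<bar>a\<bar> * F x + \<bar>b\<bar> * F' x) \<le> \<bar>a\<bar> * v + \<bar>b\<bar> * v'"
    unfolding wvar_linear using F by (intro add_mono mult_left_mono) auto
  then show ?thesis unfolding wvar_le_def using maj_linear[OF F(1,3)] by blast
qed

lemma wvar_le_reflect: assumes "wvar_le \<delta> h v" shows "wvar_le \<delta> (\<lambda>x. h (-x)) v"
proof -
  obtain F where F: "maj {-1..1} h F" "wvar \<delta> F \<le> v" using assms unfolding wvar_le_def by blast
  have "uminus ` {-1..1::real} = {-1..1}" by simp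
  then show ?thesis using maj_reflect[OF F(1)] wvar_reflect[of \<delta> F] F(2) unfolding wvar_le_def by metis
qed

lemma wvar_le_cong: "wvar_le \<delta> h v \<Longrightarrow> (\<And>x. x \<in> {-1..1} \<Longrightarrow> h' x = h x) \<Longrightarrow> wvar_le \<delta> h' v"
  unfolding wvar_le_def using maj_cong by blast

lemma wvar_le_const: "(\<And>x. x \<in> {-1..1} \<Longrightarrow> h x = c) \<Longrightarrow> wvar_le \<delta> h 0"
  unfolding wvar_le_def maj_def wvar_def by (intro exI[of _ "\<lambda>_. 0"]) auto

text \<open>The pieces of \<open>G\<close> over the intervals [2k+1,2k+3] are added up on [-1,1];
  their increments telescope to at most \<open>V - G 1\<close>, and the edges counted twice cost at
  most as much again. If \<open>G\<close> is constant on [1,1+\<delta>], the first left edge is free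
  and the edges only begin at 3-\<delta>.\<close>

lemma fold_sum_maj:
  assumes g: "maj {1..} g G" and d: "quad_decay B g" and V: "\<And>y. 1 \<le> y \<Longrightarrow> G y \<le> V"
    and \<delta>: "0 \<le> \<delta>" "\<delta> \<le> 1"
  shows "\<exists>F. maj {-1..1} (fold_sum g) F \<and> wvar \<delta> F \<le> 2 * (V - G 1) \<and>
    (G (1 + \<delta>) = G 1 \<longrightarrow> wvar \<delta> F \<le> (V - G 1) + (V - G (3 - \<delta>)))"
proof -
  have mono: "G x \<le> G y" if "1 \<le> x" "x \<le> y" for x y
    using maj_mono[OF g, of x y] that by auto
  define d where "d = (\<lambda>k. G (2 * real k + 3) - G (2 * real k + 1))"
  \<comment> \<open>The two edges of width \<delta> of the interval number \<open>k\<close>, which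
    \<open>wvar\<close> counts a second time.\<close>
  define e where "e = (\<lambda>k. (G (2 * real k + 3) - G (2 * real k + 3 - \<delta>)) + (G (2 * real k + 1 + \<delta>) - G (2 * real k + 1)))"
  have d0: "0 \<le> d k" for k unfolding d_def using mono[of "2 * real k + 1" "2 * real k + 3"] by simp
  have e0: "0 \<le> e k" for k
    unfolding e_def using mono[of "2 * real k + 3 - \<delta>" "2 * real k + 3"] mono[of "2 * real k + 1" "2 * real k + 1 + \<delta>"] \<delta>
    by simp
  have ed: "e k \<le> d k" for k
    unfolding e_def d_def using mono[of "2 * real k + 1 + \<delta>" "2 * real k + 3 - \<delta>"] \<delta> by simp
  have dsum: "(\<Sum>k<n. d k) = G (2 * real n + 1) - G 1" for n
    by (induction n) (auto simp: d_def algebra_simps)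
  have dsumV: "(\<Sum>k<n. d k) \<le> V - G 1" for n
    unfolding dsum using V[of "2 * real n + 1"] by simp
  have sd: "summable d" by (rule summableI_nonneg_bounded[OF d0 dsumV])
  have se: "summable e" by (rule summable_comparison_test'[OF sd]) (use e0 ed in simp)
  have sumd: "(\<Sum>k. d k) \<le> V - G 1" by (rule suminf_le_const[OF sd dsumV])
  have sume: "(\<Sum>k. e k) \<le> (\<Sum>k. d k)" by (rule suminf_le[OF ed se sd])
  \<comment> \<open>Subtracting \<open>G (2 * real k + 1)\<close> leaves all increments unchanged
    and makes the series over \<open>k\<close> converge.\<close>
  define f where "f = (\<lambda>y k. G (y + 2 * real k + 2) - G (2 * real k + 1))"
  have sf: "summable (f y)" if "y \<in> {-1..1}" for y
  proof (rule summable_comparison_test'[OF sd])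
    fix k show "norm (f y k) \<le> d k"
      unfolding f_def d_def
      using mono[of "2 * real k + 1" "y + 2 * real k + 2"] mono[of "y + 2 * real k + 2" "2 * real k + 3"] that
      by simp
  qed
  define F where "F = (\<lambda>y. \<Sum>k. f y k)"
  have diff: "(\<lambda>k. f b k - f a k) sums (F b - F a)" if "a \<in> {-1..1}" "b \<in> {-1..1}" for a b
    unfolding F_def by (intro sums_diff summable_sums sf that)
  have majF: "maj {-1..1} (fold_sum g) F"
    unfolding maj_def
  proof (intro ballI impI)
    fix x y :: real assume xy: "x \<in> {-1..1}" "y \<in> {-1..1}" "x \<le> y"
    have s1: "(\<lambda>k. g (y + 2 * real k + 2) - g (x + 2 * real k + 2)) sums (fold_sum g y - fold_sum g x)"
      unfolding fold_sum_def using xy by (intro sums_diff summable_sums fold_summable[OF d]) auto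
    have b: "\<bar>g (y + 2 * real k + 2) - g (x + 2 * real k + 2)\<bar> \<le> f y k - f x k" for k
      using majD[OF g, of "x + 2 * real k + 2" "y + 2 * real k + 2"] xy unfolding f_def by auto
    note D = diff[OF xy(1,2)]
    have "fold_sum g y - fold_sum g x \<le> F y - F x"
      by (rule sums_le[OF _ s1 D]) (use b in \<open>simp add: abs_le_iff\<close>)
    moreover have "- (fold_sum g y - fold_sum g x) \<le> F y - F x"
      by (rule sums_le[OF _ sums_minus[OF s1] D]) (use b in \<open>simp add: abs_le_iff\<close>)
    ultimately show "\<bar>fold_sum g y - fold_sum g x\<bar> \<le> F y - F x" by linarith
  qed
  have "(\<lambda>k. (f 1 k - f (-1) k) + (f 1 k - f (1 - \<delta>) k) + (f (-1 + \<delta>) k - f (-1) k)) sums wvar \<delta> F"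
    unfolding wvar_def using \<delta> by (intro sums_add diff) auto
  moreover have "(f 1 k - f (-1) k) + (f 1 k - f (1 - \<delta>) k) + (f (-1 + \<delta>) k - f (-1) k) = d k + e k" for k
    unfolding f_def d_def e_def by (simp add: algebra_simps)
  ultimately have w: "wvar \<delta> F = (\<Sum>k. d k) + (\<Sum>k. e k)"
    using suminf_add[OF sd se] by (simp add: sums_iff)
  have "wvar \<delta> F \<le> (V - G 1) + (V - G (3 - \<delta>))" if "G (1 + \<delta>) = G 1"
  proof -
    \<comment> \<open>For \<open>k = 0\<close> only the right edge [3-\<delta>,3] remains; from the
      next interval on, the edges are estimated by the whole interval.\<close>
    have "(\<Sum>k<Suc n. e k) \<le> G (2 * real (Suc n) + 1) - G (3 - \<delta>)" for n
    proof (induction n)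
      case 0 show ?case using that by (simp add: e_def)
    next
      case (Suc n)
      have "(\<Sum>k<Suc (Suc n). e k) \<le> G (2 * real (Suc n) + 1) - G (3 - \<delta>) + d (Suc n)"
        using Suc ed[of "Suc n"] by simp
      also have "\<dots> = G (2 * real (Suc (Suc n)) + 1) - G (3 - \<delta>)" by (simp add: d_def algebra_simps)
      finally show ?case .
    qed
    moreover have "G (2 * real (Suc n) + 1) \<le> V" for n by (rule V) simp
    ultimately have "(\<Sum>k<Suc n. e k) \<le> V - G (3 - \<delta>)" for n
      by (metis diff_right_mono order_trans)
    moreover have "(\<Sum>k<n. e k) \<le> (\<Sum>k<Suc n. e k)" for n using e0[of n] by simp
    ultimately have "(\<Sum>k. e k) \<le> V - G (3 - \<delta>)" by (intro suminf_le_const[OF se]) (meson order_trans)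
    then show ?thesis using w sumd by simp
  qed
  then show ?thesis using majF w sumd sume by (intro exI[of _ F]) auto
qed

context gauss_map begin

text \<open>At \<open>y = \<beta>/x\<close> the value of \<open>J h\<close> is
  \<open>x\<^sup>2 * h x / \<beta>\<close>, so this controls the variation of \<open>J h\<close>. It
  is a product rule in which the factor \<open>x\<^sup>2\<close> costs only an integral of
  \<bar>h\<bar>; estimating it by a supremum would bring in the variation again and spoil the
  contraction rate.\<close>

lemma square_mult_maj:
  assumes h: "ufun B h" and F: "maj {0..1} h F" and zx: "0 \<le> z" "z \<le> x" "x \<le> 1"
    and I: "\<And>x. I x = (LINT t|lborel. indicator {0..x} t * (2 * t * \<bar>h t\<bar>))"
  shows "\<bar>x\<^sup>2 * h x - z\<^sup>2 * h z\<bar> \<le> x\<^sup>2 * (F x - F z) + (I x - I z)"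
proof -
  have [measurable]: "h \<in> borel_measurable borel" using ufunD(1)[OF h] .
  have ii: "integrable lborel (\<lambda>t. indicator {a..b} t * (2 * t * \<bar>h t\<bar>))" if "0 \<le> a" "b \<le> 1" for a b
  proof (rule Bochner_Integration.integrable_bound[of _ "\<lambda>t. (2 * B) * indicator {0..1::real} t"])
    show "AE x in lborel. norm (indicat_real {a..b} x * (2 * x * \<bar>h x\<bar>)) \<le> norm (2 * B * indicat_real {0..1} x)"
    proof (rule AE_I2)
      fix x :: real
      have "x * \<bar>h x\<bar> \<le> 1 * B" if "0 \<le> x" "x \<le> 1"
        using that ufunD(2,4)[OF h] by (intro mult_mono) auto
      then show "norm (indicat_real {a..b} x * (2 * x * \<bar>h x\<bar>)) \<le> norm (2 * B * indicat_real {0..1} x)"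
        using that ufunD(4)[OF h] by (auto split: split_indicator simp: abs_mult)
    qed
  qed auto
  have "I x = (LINT t|lborel. indicator {0..z} t * (2 * t * \<bar>h t\<bar>) + indicator {z..x} t * (2 * t * \<bar>h t\<bar>))"
    unfolding I
  proof (rule integral_cong_AE)
    show "AE t in lborel. indicat_real {0..x} t * (2 * t * \<bar>h t\<bar>) =
        indicat_real {0..z} t * (2 * t * \<bar>h t\<bar>) + indicat_real {z..x} t * (2 * t * \<bar>h t\<bar>)"
      using AE_lborel_singleton[of z] by eventually_elim (use zx in \<open>auto split: split_indicator\<close>)
  qed auto
  also have "\<dots> = I z + (LINT t|lborel. indicator {z..x} t * (2 * t * \<bar>h t\<bar>))"
    unfolding I using zx by (intro Bochner_Integration.integral_add ii) auto
  finally have Ixz: "I x - I z = (LINT t|lborel. indicator {z..x} t * (2 * t * \<bar>h t\<bar>))" by simp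
  have hb: "has_bochner_integral lborel (\<lambda>t. 2 * t * indicator {z..x} t) (x\<^sup>2 - z\<^sup>2)"
    by (rule has_bochner_integral_FTC_Icc_real[of z x "\<lambda>t. t\<^sup>2" "\<lambda>t. 2 * t"])
       (use zx in \<open>auto intro!: derivative_eq_intros continuous_intros\<close>)
  \<comment> \<open>For all \<open>t\<close> between \<open>z\<close> and \<open>x\<close>, \<bar>h
    t\<bar> is at least \<bar>h x\<bar> minus the increment of \<open>F\<close>. Integrating against
    the weight \<open>2 * t\<close>, of total mass \<open>x\<^sup>2 - z\<^sup>2\<close>, trades the
    point value for an integral.\<close>
  have "(x\<^sup>2 - z\<^sup>2) * (\<bar>h x\<bar> - (F x - F z)) = (LINT t|lborel. (\<bar>h x\<bar> - (F x - F z)) * (2 * t * indicator {z..x} t))"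
    using hb by (simp add: has_bochner_integral_iff mult.commute)
  also have "\<dots> \<le> (LINT t|lborel. indicator {z..x} t * (2 * t * \<bar>h t\<bar>))"
  proof (rule integral_mono)
    show "integrable lborel (\<lambda>t. (\<bar>h x\<bar> - (F x - F z)) * (2 * t * indicat_real {z..x} t))"
      using hb by (simp add: has_bochner_integral_iff)
    show "integrable lborel (\<lambda>t. indicator {z..x} t * (2 * t * \<bar>h t\<bar>))" by (rule ii) (use zx in auto)
    fix t :: real
    show "(\<bar>h x\<bar> - (F x - F z)) * (2 * t * indicator {z..x} t) \<le> indicator {z..x} t * (2 * t * \<bar>h t\<bar>)"
    proof (cases "t \<in> {z..x}")
      case True
      then have "\<bar>h x - h t\<bar> \<le> F x - F t" "F z \<le> F t"
        using majD[OF F, of t x] maj_mono[OF F, of z t] zx by auto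
      then have "\<bar>h x\<bar> - (F x - F z) \<le> \<bar>h t\<bar>" by linarith
      then have "(\<bar>h x\<bar> - (F x - F z)) * (2 * t) \<le> \<bar>h t\<bar> * (2 * t)"
        using True zx by (intro mult_right_mono) auto
      then show ?thesis using True by (simp add: mult_ac)
    qed simp
  qed
  finally have 1: "(x\<^sup>2 - z\<^sup>2) * \<bar>h x\<bar> \<le> (x\<^sup>2 - z\<^sup>2) * (F x - F z) + (I x - I z)"
    unfolding Ixz by (simp add: algebra_simps)
  have "x\<^sup>2 * h x - z\<^sup>2 * h z = (x\<^sup>2 - z\<^sup>2) * h x + z\<^sup>2 * (h x - h z)" by (simp add: algebra_simps)
  then have "\<bar>x\<^sup>2 * h x - z\<^sup>2 * h z\<bar> \<le> \<bar>x\<^sup>2 - z\<^sup>2\<bar> * \<bar>h x\<bar> + z\<^sup>2 * \<bar>h x - h z\<bar>"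
    by (metis abs_triangle_ineq abs_mult abs_power2)
  moreover have "\<bar>x\<^sup>2 - z\<^sup>2\<bar> = x\<^sup>2 - z\<^sup>2" using zx by (simp add: power_mono)
  moreover have "z\<^sup>2 * \<bar>h x - h z\<bar> \<le> z\<^sup>2 * (F x - F z)"
    using majD[OF F, of z x] zx by (intro mult_left_mono) auto
  ultimately show ?thesis using 1 by (simp add: algebra_simps)
qed

text \<open>\<open>J h\<close> jumps at \<beta> from 0 to \<open>h 1 / \<beta>\<close>. Comparing
  \<open>h 1\<close> with the values on [1-\<delta>,1] and averaging turns the jump into variation
  near 1, the part that \<open>wvar\<close> counts twice, plus an L1 term.\<close>

lemma endpoint_bound:
  assumes h: "ufun B h" and F: "maj {0..1} h F" and \<delta>: "0 < \<delta>" "\<delta> \<le> 1"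
  shows "\<bar>h 1\<bar> \<le> (F 1 - F (1 - \<delta>)) + (1 / \<delta>) * (LINT x|lborel. \<bar>h x\<bar>)"
proof -
  have "\<delta> * (\<bar>h 1\<bar> - (F 1 - F (1 - \<delta>))) = (LINT t|lborel. (\<bar>h 1\<bar> - (F 1 - F (1 - \<delta>))) * indicator {1-\<delta>..1} t)"
    using \<delta> by simp
  also have "\<dots> \<le> (LINT x|lborel. \<bar>h x\<bar>)"
  proof (rule integral_mono)
    show "integrable lborel (\<lambda>x. \<bar>h x\<bar>)" using ufunD(5)[OF h] by simp
    fix t show "(\<bar>h 1\<bar> - (F 1 - F (1 - \<delta>))) * indicator {1-\<delta>..1} t \<le> \<bar>h t\<bar>"
      using majD[OF F, of t 1] maj_mono[OF F, of "1-\<delta>" t] \<delta> by (auto split: split_indicator)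
    show "integrable lborel (\<lambda>t. (\<bar>h 1\<bar> - (F 1 - F (1 - \<delta>))) * indicator {1-\<delta>..1} t)"
      using \<delta> by (intro integrable_mult_right integrable_real_indicator) auto
  qed
  finally show ?thesis using \<delta> by (simp add: field_simps)
qed

text \<open>The inversion sends 1 to \<beta> and [0,c] to the half line beyond \<beta>/c. There the
  factor \<open>x\<^sup>2\<close> is at most \<open>c\<^sup>2\<close>, a gain that the last bound
  isolates; \<open>V\<close> plays the role of the value of \<open>G\<close> at infinity.\<close>

lemma J_maj:
  assumes h: "ufun B h" and F: "maj {0..1} h F" and c: "0 < c" "c \<le> 1"
  shows "\<exists>G V. maj {1..} (J h) G \<and> (\<forall>y\<ge>1. G y \<le> V) \<and> (\<forall>y<\<beta>. G y = 0) \<and>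
    V \<le> (c\<^sup>2 * (F c - F 0) + (F 1 - F c) + \<bar>h 1\<bar> + 2 * (LINT x|lborel. \<bar>h x\<bar>)) / \<beta> \<and>
    V - G (\<beta> / c) \<le> (c\<^sup>2 * (F c - F 0) + 2 * (LINT x|lborel. \<bar>h x\<bar>)) / \<beta>"
proof -
  have [measurable]: "h \<in> borel_measurable borel" using ufunD(1)[OF h] .
  define I where "I = (\<lambda>x. LINT t|lborel. indicator {0..x} t * (2 * t * \<bar>h t\<bar>))"
  have I_bound: "I x \<le> 2 * (LINT x|lborel. \<bar>h x\<bar>)" if "x \<le> 1" for x
  proof -
    have "I x \<le> (LINT x|lborel. 2 * \<bar>h x\<bar>)"
      unfolding I_def
    proof (rule integral_mono')
      show "integrable lborel (\<lambda>x. 2 * \<bar>h x\<bar>)" using ufunD(5)[OF h] by simp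
      fix t show "indicator {0..x} t * (2 * t * \<bar>h t\<bar>) \<le> 2 * \<bar>h t\<bar>"
        using that by (auto split: split_indicator intro: mult_left_le_one_le)
    qed simp
    then show ?thesis by simp
  qed
  have I0: "I 0 = 0" unfolding I_def
    by (rule integral_eq_zero_AE) (auto split: split_indicator)
  \<comment> \<open>A majorant of \<open>x\<^sup>2 * h x\<close>: the square is estimated by
    \<open>c\<^sup>2\<close> up to \<open>c\<close> and by 1 above, and \<open>I\<close> is the
    product rule term.\<close>
  define Fa where "Fa = (\<lambda>x. (if x \<le> c then c\<^sup>2 * (F x - F 0) else c\<^sup>2 * (F c - F 0) + (F x - F c)) + I x)"
  have pm: "\<bar>x\<^sup>2 * h x - z\<^sup>2 * h z\<bar> \<le> x\<^sup>2 * (F x - F z) + (I x - I z)" if "0 \<le> z" "z \<le> x" "x \<le> 1" for x z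
    by (rule square_mult_maj[OF h F that]) (simp add: I_def)
  have Fa_maj: "\<bar>x\<^sup>2 * h x - z\<^sup>2 * h z\<bar> \<le> Fa x - Fa z" if zx: "0 \<le> z" "z \<le> x" "x \<le> 1" for x z
  proof -
    have le_c: "x\<^sup>2 * (F x - F z) \<le> c\<^sup>2 * (F x - F z)" if "0 \<le> z" "z \<le> x" "x \<le> c" for x z
      using that c maj_mono[OF F, of z x] by (intro mult_right_mono power_mono) auto
    have le_1: "x\<^sup>2 * (F x - F z) \<le> F x - F z" if "0 \<le> z" "z \<le> x" "x \<le> 1" for x z
      using that maj_mono[OF F, of z x] by (intro mult_left_le_one_le power_le_one) auto
    consider "x \<le> c" | "c \<le> z" "\<not> x \<le> c" | "z < c" "c < x" by linarith
    then show ?thesis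
    proof cases
      case 1
      then show ?thesis using pm[OF zx] le_c[OF zx(1,2) 1] zx unfolding Fa_def by (simp add: algebra_simps)
    next
      case 2
      then have "z = c \<or> \<not> z \<le> c" by linarith
      then show ?thesis using pm[OF zx] le_1[OF zx] 2 unfolding Fa_def by auto
    next
      case 3
      have "\<bar>x\<^sup>2 * h x - z\<^sup>2 * h z\<bar> \<le> \<bar>x\<^sup>2 * h x - c\<^sup>2 * h c\<bar> + \<bar>c\<^sup>2 * h c - z\<^sup>2 * h z\<bar>" by linarith
      then show ?thesis using pm[of c x] pm[of z c] le_1[of c x] le_c[of z c] 3 zx c
        unfolding Fa_def by (simp add: algebra_simps)
    qed
  qed
  have Fa_mono: "Fa z \<le> Fa x" if "0 \<le> z" "z \<le> x" "x \<le> 1" for x z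
    using Fa_maj[OF that] by linarith
  \<comment> \<open>\<open>Fa\<close> read backwards along \<open>x = \<beta>/y\<close>, with an
    added jump at \<beta> that accounts for \<open>h 1\<close>.\<close>
  define G where "G = (\<lambda>y. if y < \<beta> then 0 else (Fa 1 - Fa (\<beta> / y) + \<bar>h 1\<bar>) / \<beta>)"
  define V where "V = (Fa 1 - Fa 0 + \<bar>h 1\<bar>) / \<beta>"
  have frac: "0 \<le> \<beta> / y \<and> \<beta> / y \<le> 1" if "\<beta> \<le> y" for y using that beta_pos by simp
  have J_eq: "J h y = (\<beta> / y)\<^sup>2 * h (\<beta> / y) / \<beta>" if "0 < y" for y
    using beta_pos that unfolding J_def by (simp add: power2_eq_square field_simps)
  have Gmaj: "maj {1..} (J h) G"
    unfolding maj_def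
  proof (intro ballI impI)
    fix x y :: real assume xy: "x \<in> {1..}" "y \<in> {1..}" "x \<le> y"
    consider "y < \<beta>" | "x < \<beta>" "\<beta> \<le> y" | "\<beta> \<le> x" by linarith
    then show "\<bar>J h y - J h x\<bar> \<le> G y - G x"
    proof cases
      case 1
      then have "J h y = 0" "J h x = 0" using xy by (auto intro!: J_zero[OF h])
      then show ?thesis using 1 xy by (simp add: G_def)
    next
      case 2
      then have Jx: "J h x = 0" using xy by (auto intro!: J_zero[OF h])
      have "\<bar>(\<beta> / y)\<^sup>2 * h (\<beta> / y)\<bar> \<le> Fa 1 - Fa (\<beta> / y) + \<bar>h 1\<bar>"
        using Fa_maj[of "\<beta> / y" 1] frac[OF 2(2)] by simp
      then have "\<bar>J h y\<bar> \<le> (Fa 1 - Fa (\<beta> / y) + \<bar>h 1\<bar>) / \<beta>"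
        using xy beta_pos by (subst J_eq) (auto simp: divide_right_mono)
      then show ?thesis using 2 Jx by (simp add: G_def)
    next
      case 3
      have le: "\<beta> / y \<le> \<beta> / x" using 3 xy beta_pos by (intro divide_left_mono) auto
      have "\<bar>(\<beta> / x)\<^sup>2 * h (\<beta> / x) - (\<beta> / y)\<^sup>2 * h (\<beta> / y)\<bar> \<le> Fa (\<beta> / x) - Fa (\<beta> / y)"
        using Fa_maj[OF _ le] frac[of x] frac[of y] 3 xy by auto
      then have "\<bar>(\<beta> / x)\<^sup>2 * h (\<beta> / x) - (\<beta> / y)\<^sup>2 * h (\<beta> / y)\<bar> / \<beta> \<le> (Fa (\<beta> / x) - Fa (\<beta> / y)) / \<beta>"
        using beta_pos by (intro divide_right_mono) auto
      moreover have "J h y - J h x = - (((\<beta> / x)\<^sup>2 * h (\<beta> / x) - (\<beta> / y)\<^sup>2 * h (\<beta> / y)) / \<beta>)"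
        using J_eq[of x] J_eq[of y] xy by (simp add: diff_divide_distrib)
      moreover have "G y - G x = (Fa (\<beta> / x) - Fa (\<beta> / y)) / \<beta>"
        using 3 xy by (simp add: G_def diff_divide_distrib add_divide_distrib)
      ultimately show ?thesis using beta_pos by simp
    qed
  qed
  have Vb: "G y \<le> V" for y
  proof (cases "y < \<beta>")
    case True
    then show ?thesis using Fa_mono[of 0 1] beta_pos by (simp add: G_def V_def)
  next
    case False
    then show ?thesis using Fa_mono[of 0 "\<beta> / y"] frac[of y] beta_pos by (auto simp: G_def V_def intro!: divide_right_mono)
  qed
  have V1: "V \<le> (c\<^sup>2 * (F c - F 0) + (F 1 - F c) + \<bar>h 1\<bar> + 2 * (LINT x|lborel. \<bar>h x\<bar>)) / \<beta>"
    unfolding V_def using I_bound[of 1] beta_pos c I0 by (intro divide_right_mono) (auto simp: Fa_def)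
  have "\<beta> \<le> \<beta> / c" "\<beta> / (\<beta> / c) = c" using c beta_pos by (auto simp: field_simps)
  then have "V - G (\<beta> / c) = (Fa c - Fa 0) / \<beta>"
    unfolding V_def G_def by (simp add: diff_divide_distrib add_divide_distrib)
  also have "\<dots> \<le> (c\<^sup>2 * (F c - F 0) + 2 * (LINT x|lborel. \<bar>h x\<bar>)) / \<beta>"
    using I_bound[of c] beta_pos c I0 by (intro divide_right_mono) (auto simp: Fa_def)
  finally have V2: "V - G (\<beta> / c) \<le> (c\<^sup>2 * (F c - F 0) + 2 * (LINT x|lborel. \<bar>h x\<bar>)) / \<beta>" .
  show ?thesis using Gmaj Vb V1 V2 by (intro exI[of _ G] exI[of _ V]) (auto simp: G_def)
qed

text \<open>
  If \<open>\<beta> < 3\<close>, a point of \<open>[0,1]\<close> that is mapped near \<open>\<plusminus>1\<close> lies below \<open>c = \<beta>/(3 - \<delta>)\<close>, where the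
  contraction \<open>x\<^sup>2/\<beta>\<close> beats the double weight.
\<close>

lemma lasota_yorke_half:
  obtains \<delta> \<theta> C where "0 < \<delta>" "\<delta> \<le> 1" "0 < \<theta>" "\<theta> < 1" "0 \<le> C"
    "\<And>B h F. ufun B h \<Longrightarrow> maj {0..1} h F \<Longrightarrow>
      \<exists>F'. maj {-1..1} (fold_sum (J h)) F' \<and>
        wvar \<delta> F' \<le> \<theta> * ((F 1 - F 0) + (F 1 - F (1 - \<delta>))) + C * (LINT x|lborel. \<bar>h x\<bar>)"
proof (cases "\<beta> < 3")
  case False
  show ?thesis
  \<comment> \<open>Counting everything twice is affordable here because 2/\<beta> < 1; with
    \<delta> = 1 the second increment runs over all of [0,1] and absorbs \<bar>h 1\<bar>.\<close>
  proof (rule that[of 1 "2 / \<beta>" "(2 / \<beta>) * 3"])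
    fix B h F assume h: "ufun B h" and F: "maj {0..1} h F"
    let ?I = "LINT x|lborel. \<bar>h x\<bar>"
    obtain G V where G: "maj {1..} (J h) G" "\<forall>y\<ge>1. G y \<le> V" "\<forall>y<\<beta>. G y = 0"
      "V \<le> (1\<^sup>2 * (F 1 - F 0) + (F 1 - F 1) + \<bar>h 1\<bar> + 2 * ?I) / \<beta>"
      using J_maj[OF h F, of 1] by auto
    obtain F' where F': "maj {-1..1} (fold_sum (J h)) F'" "wvar 1 F' \<le> 2 * (V - G 1)"
      using fold_sum_maj[OF G(1) quad_decay_J[OF h], of V 1] G(2) by auto
    have "G 1 = 0" using G(3) beta_gt_1 by blast
    then have "wvar 1 F' \<le> 2 * V" using F'(2) by simp
    also have "\<dots> \<le> 2 * (((F 1 - F 0) + \<bar>h 1\<bar> + 2 * ?I) / \<beta>)"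
      by (rule mult_left_mono) (use G(4) in simp_all)
    also have "\<dots> \<le> 2 * (((F 1 - F 0) + ((F 1 - F (1 - 1)) + (1 / 1) * ?I) + 2 * ?I) / \<beta>)"
      using endpoint_bound[OF h F, of 1] beta_pos by (intro mult_left_mono divide_right_mono) auto
    also have "\<dots> = 2 / \<beta> * ((F 1 - F 0) + (F 1 - F (1 - 1))) + (2 / \<beta>) * 3 * ?I"
      by (simp add: algebra_simps add_divide_distrib diff_divide_distrib)
    finally show "\<exists>F'. maj {-1..1} (fold_sum (J h)) F' \<and>
        wvar 1 F' \<le> 2 / \<beta> * ((F 1 - F 0) + (F 1 - F (1 - 1))) + (2 / \<beta>) * 3 * ?I" using F'(1) by blast
  qed (use False beta_pos in auto)
next
  case True
  \<comment> \<open>The first bound puts 3-\<delta> above the mean (3+\<beta>)/2; the second keeps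
    1+\<delta> below \<beta>, so that the majorant of \<open>J h\<close> is constant on
    [1,1+\<delta>].\<close>
  define \<delta> where "\<delta> = min ((3 - \<beta>) / 2) ((\<beta> - 1) / 2)"
  have \<delta>: "0 < \<delta>" "\<delta> \<le> 1" "1 + \<delta> < \<beta>" "(3 + \<beta>) / 2 \<le> 3 - \<delta>"
    unfolding \<delta>_def using True beta_gt_1 by (auto simp: min_def field_simps)
  define c where "c = \<beta> / (3 - \<delta>)"
  have c: "0 < c" "c \<le> 1" "\<beta> / c = 3 - \<delta>" unfolding c_def using \<delta> True beta_gt_1 by (auto simp: field_simps)
  \<comment> \<open>The claim amounts to \<open>2 * \<beta> < (3 - \<delta>)\<^sup>2\<close>, and
    the arithmetic-geometric mean inequality makes the right-hand side at least 3\<beta>.\<close>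
  have c2: "2 * c\<^sup>2 / \<beta> < 1"
  proof -
    have "((3 + \<beta>) / 2)\<^sup>2 \<le> (3 - \<delta>)\<^sup>2" using \<delta> beta_pos by (intro power_mono) auto
    moreover have "((3 + \<beta>) / 2)\<^sup>2 = 3 * \<beta> + ((3 - \<beta>) / 2)\<^sup>2" by (simp add: power2_eq_square field_simps)
    moreover have "0 \<le> ((3 - \<beta>) / 2)\<^sup>2" by simp
    ultimately have "2 * \<beta> < (3 - \<delta>)\<^sup>2" using beta_pos by linarith
    then have "2 * \<beta> / (3 - \<delta>)\<^sup>2 < 1" using \<delta> by (simp add: divide_less_eq)
    moreover have "2 * c\<^sup>2 / \<beta> = 2 * \<beta> / (3 - \<delta>)\<^sup>2"
      unfolding c_def power_divide using beta_pos by (simp add: power2_eq_square[of \<beta>])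
    ultimately show ?thesis by simp
  qed
  \<comment> \<open>1/\<beta> is the rate on [c,1], which is counted once, and the other entry the
    rate on [0,c], which is counted twice.\<close>
  define \<theta> where "\<theta> = max (1 / \<beta>) (2 * c\<^sup>2 / \<beta>)"
  have \<theta>: "0 < \<theta>" "\<theta> < 1" "1 / \<beta> \<le> \<theta>" "2 * c\<^sup>2 / \<beta> \<le> \<theta>"
    unfolding \<theta>_def using c2 beta_gt_1 by (auto simp: less_max_iff_disj)
  show ?thesis
  proof (rule that[of \<delta> \<theta> "(1 / \<beta>) * (4 + 1 / \<delta>)"])
    fix B h F assume h: "ufun B h" and F: "maj {0..1} h F"
    let ?I = "LINT x|lborel. \<bar>h x\<bar>"
    obtain G V where G: "maj {1..} (J h) G" "\<forall>y\<ge>1. G y \<le> V" "\<forall>y<\<beta>. G y = 0"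
      "V \<le> (c\<^sup>2 * (F c - F 0) + (F 1 - F c) + \<bar>h 1\<bar> + 2 * ?I) / \<beta>"
      "V - G (3 - \<delta>) \<le> (c\<^sup>2 * (F c - F 0) + 2 * ?I) / \<beta>"
      using J_maj[OF h F c(1,2)] c(3) by auto
    have G1: "G 1 = 0" "G (1 + \<delta>) = G 1" using G(3) beta_gt_1 \<delta> by auto
    obtain F' where F': "maj {-1..1} (fold_sum (J h)) F'" "wvar \<delta> F' \<le> (V - G 1) + (V - G (3 - \<delta>))"
      using fold_sum_maj[OF G(1) quad_decay_J[OF h], of V \<delta>] G(2) G1 \<delta> by auto
    have "wvar \<delta> F' \<le> (c\<^sup>2 * (F c - F 0) + (F 1 - F c) + \<bar>h 1\<bar> + 2 * ?I) / \<beta> + (c\<^sup>2 * (F c - F 0) + 2 * ?I) / \<beta>"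
      using F'(2) G G1 by linarith
    also have "\<dots> = (2 * c\<^sup>2 / \<beta>) * (F c - F 0) + (1 / \<beta>) * (F 1 - F c) + (1 / \<beta>) * \<bar>h 1\<bar> + (1 / \<beta>) * (4 * ?I)"
      by (simp add: algebra_simps add_divide_distrib diff_divide_distrib)
    also have "\<dots> \<le> \<theta> * (F c - F 0) + \<theta> * (F 1 - F c) +
        (1 / \<beta>) * ((F 1 - F (1 - \<delta>)) + (1 / \<delta>) * ?I) + (1 / \<beta>) * (4 * ?I)"
      using endpoint_bound[OF h F \<delta>(1,2)] \<theta> maj_mono[OF F, of 0 c] maj_mono[OF F, of c 1] c beta_pos
      by (intro add_mono mult_right_mono mult_left_mono) auto
    also have "\<dots> = \<theta> * (F 1 - F 0) + (1 / \<beta>) * (F 1 - F (1 - \<delta>)) + (1 / \<beta>) * (4 + 1 / \<delta>) * ?I"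
      by (simp add: algebra_simps add_divide_distrib diff_divide_distrib)
    also have "\<dots> \<le> \<theta> * (F 1 - F 0) + \<theta> * (F 1 - F (1 - \<delta>)) + (1 / \<beta>) * (4 + 1 / \<delta>) * ?I"
      using \<theta> maj_mono[OF F, of "1 - \<delta>" 1] maj_mono[OF F, of 0 1] \<delta> by (intro add_mono mult_right_mono) auto
    also have "\<dots> = \<theta> * ((F 1 - F 0) + (F 1 - F (1 - \<delta>))) + (1 / \<beta>) * (4 + 1 / \<delta>) * ?I"
      by (simp add: algebra_simps)
    finally show "\<exists>F'. maj {-1..1} (fold_sum (J h)) F' \<and>
        wvar \<delta> F' \<le> \<theta> * ((F 1 - F 0) + (F 1 - F (1 - \<delta>))) + (1 / \<beta>) * (4 + 1 / \<delta>) * ?I" using F'(1) by blast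
  qed (use \<delta> \<theta> beta_pos in auto)
qed

lemma periodize_maj:
  assumes "maj {-1..1} (fold_sum g) F1" "maj {-1..1} (fold_sum (\<lambda>x. g (-x))) F2"
    "wvar \<delta> F1 \<le> v" "wvar \<delta> F2 \<le> w"
  shows "wvar_le \<delta> (periodize g) (v + w)"
proof -
  have 1: "wvar_le \<delta> (fold_sum g) v" "wvar_le \<delta> (fold_sum (\<lambda>x. g (-x))) w"
    using assms unfolding wvar_le_def by auto
  show ?thesis
    by (rule wvar_le_cong[OF wvar_le_linear[OF 1(1) wvar_le_reflect[OF 1(2)], of 1 1, simplified]])
      (simp add: periodize_def)
qed

lemma ufun_reflect: "ufun B h \<Longrightarrow> ufun B (\<lambda>x. h (-x))"
  unfolding ufun_def
proof (intro conjI allI)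
  assume h: "h \<in> borel_measurable borel \<and> (\<forall>x. \<bar>h x\<bar> \<le> B * indicator {-1..1} x)"
  then show "(\<lambda>x. h (-x)) \<in> borel_measurable borel" by auto
  fix x
  have "\<bar>h (-x)\<bar> \<le> B * indicator {-1..1} (-x)" using h by blast
  then show "\<bar>h (-x)\<bar> \<le> B * indicator {-1..1} x" by (simp add: indicator_def conj_commute minus_le_iff)
qed

text \<open>The half-line estimate is applied to \<open>h\<close> and to its reflection. Each takes
  the edge weight of its own side, and together they give exactly
  \<open>\<theta> * wvar \<delta> F\<close>, at the price of doubling the constant.\<close>

lemma lasota_yorke:
  "\<exists>\<delta> \<theta> C. 0 < \<delta> \<and> \<delta> \<le> 1 \<and> 0 < \<theta> \<and> \<theta> < 1 \<and> 0 \<le> C \<and>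
    (\<forall>B h v. ufun B h \<longrightarrow> wvar_le \<delta> h v \<longrightarrow> wvar_le \<delta> (T h) (\<theta> * v + C * (LINT x|lborel. \<bar>h x\<bar>)))"
proof -
  obtain \<delta> \<theta> C where c: "0 < \<delta>" "\<delta> \<le> 1" "0 < \<theta>" "\<theta> < 1" "0 \<le> C"
    and LY: "\<And>B h F. ufun B h \<Longrightarrow> maj {0..1} h F \<Longrightarrow>
      \<exists>F'. maj {-1..1} (fold_sum (J h)) F' \<and>
        wvar \<delta> F' \<le> \<theta> * ((F 1 - F 0) + (F 1 - F (1 - \<delta>))) + C * (LINT x|lborel. \<bar>h x\<bar>)"
    using lasota_yorke_half by blast
  show ?thesis
  proof (rule exI[of _ \<delta>], rule exI[of _ \<theta>], rule exI[of _ "2 * C"], intro conjI allI impI)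
    fix B h v assume h: "ufun B h" and "wvar_le \<delta> h v"
    then obtain F where F: "maj {-1..1} h F" "wvar \<delta> F \<le> v" unfolding wvar_le_def by blast
    let ?r = "\<lambda>x. h (-x)" and ?I = "LINT x|lborel. \<bar>h x\<bar>"
    have Fp: "maj {0..1} h F" by (rule maj_subset[OF F(1)]) auto
    have "maj (uminus ` {-1..1}) ?r (\<lambda>x. - F (-x))" by (rule maj_reflect[OF F(1)])
    then have Fm: "maj {0..1} ?r (\<lambda>x. - F (-x))" by (rule maj_subset) auto
    obtain F1 where F1: "maj {-1..1} (fold_sum (J h)) F1"
      "wvar \<delta> F1 \<le> \<theta> * ((F 1 - F 0) + (F 1 - F (1 - \<delta>))) + C * ?I"
      using LY[OF h Fp] by blast
    have Ir: "(LINT x|lborel. \<bar>?r x\<bar>) = ?I"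
      using lborel_integral_real_affine[of "-1" "\<lambda>x. \<bar>h x\<bar>" 0] by simp
    obtain F2 where F2: "maj {-1..1} (fold_sum (J ?r)) F2"
      "wvar \<delta> F2 \<le> \<theta> * ((- F (-1) - - F (-0)) + (- F (-1) - - F (-(1 - \<delta>)))) + C * ?I"
      using LY[OF ufun_reflect[OF h] Fm] Ir by auto
    have "J ?r = (\<lambda>x. J h (-x))" by (simp add: J_reflect)
    then have "wvar_le \<delta> (T h) ((\<theta> * ((F 1 - F 0) + (F 1 - F (1 - \<delta>))) + C * ?I) +
       (\<theta> * ((- F (-1) - - F (-0)) + (- F (-1) - - F (-(1 - \<delta>)))) + C * ?I))"
      unfolding T_def using F1 F2 by (intro periodize_maj) auto
    moreover have "((\<theta> * ((F 1 - F 0) + (F 1 - F (1 - \<delta>))) + C * ?I) +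
       (\<theta> * ((- F (-1) - - F (-0)) + (- F (-1) - - F (-(1 - \<delta>)))) + C * ?I)) = \<theta> * wvar \<delta> F + 2 * C * ?I"
      unfolding wvar_def by (simp add: algebra_simps)
    moreover have "\<theta> * wvar \<delta> F \<le> \<theta> * v" using F(2) c by simp
    ultimately show "wvar_le \<delta> (T h) (\<theta> * v + 2 * C * ?I)"
      using wvar_le_mono by (metis add_le_cancel_right)
  qed (use c in auto)
qed

end

section \<open>Exactness\<close>

lemma ufun_indicator: "-1 \<le> a \<Longrightarrow> b \<le> 1 \<Longrightarrow> ufun 1 (indicator {a..b})"
  unfolding ufun_def by (auto split: split_indicator)

context gauss_map begin

lemma ufun_pow: "ufun B h \<Longrightarrow> ufun (T_const ^ n * B) ((T ^^ n) h)"
  by (induction n) (auto dest: ufun_T simp: mult_ac)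

lemma T_pow_linear:
  assumes "ufun B h" "ufun B' h'"
  shows "(T ^^ n) (\<lambda>x. a * h x + b * h' x) = (\<lambda>x. a * (T ^^ n) h x + b * (T ^^ n) h' x)"
proof (induction n)
  case (Suc n)
  then show ?case using T_linear[OF ufun_pow[OF assms(1)] ufun_pow[OF assms(2)], where a=a and b=b] by simp
qed simp

lemma T_pow_mono:
  assumes "ufun B h" "ufun B' h'" "\<And>x. h x \<le> h' x"
  shows "(T ^^ n) h y \<le> (T ^^ n) h' y"
proof (induction n arbitrary: y)
  case (Suc n)
  show ?case using T_mono[OF ufun_pow[OF assms(1)] ufun_pow[OF assms(2)] Suc] by simp
qed (use assms in simp)

lemma T_pow_integral: "ufun B h \<Longrightarrow> (LINT y|lborel. (T ^^ n) h y) = (LINT x|lborel. h x)"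
  by (induction n) (auto simp: T_integral_1[OF ufun_pow])

lemma T_pow_reflect: "(T ^^ n) (\<lambda>x. h (-x)) = (\<lambda>y. (T ^^ n) h (-y))"
proof (induction n)
  case (Suc n)
  show ?case by (simp add: Suc T_reflect fun_eq_iff)
qed simp

lemma ufun_zero: "ufun 0 (\<lambda>_. 0)" unfolding ufun_def by simp

lemma T_zero: "T (\<lambda>_. 0) = (\<lambda>_. 0)"
  using T_linear[OF ufun_zero ufun_zero, of 0 0] by simp

lemma T_pow_nonneg:
  assumes "ufun B h" "\<And>x. 0 \<le> h x" shows "0 \<le> (T ^^ n) h y"
proof -
  have "(T ^^ n) (\<lambda>_. 0) = (\<lambda>_. 0)" by (induction n) (auto simp: T_zero)
  then show ?thesis using T_pow_mono[OF ufun_zero assms, of n y] by simp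
qed

lemma T_ge_term:
  assumes h: "ufun B h" "\<And>x. 0 \<le> h x" and y: "y \<in> {-1..1}"
  shows "J h (y + 2 * real k + 2) \<le> T h y"
proof -
  have nn: "0 \<le> J h z" for z unfolding J_def using beta_pos h(2) by simp
  have "(\<Sum>k\<in>{k}. J h (y + 2 * real k + 2)) \<le> (\<Sum>k. J h (y + 2 * real k + 2))"
    using y by (intro sum_le_suminf fold_summable[OF quad_decay_J[OF h(1)]] nn) auto
  moreover have "0 \<le> fold_sum (\<lambda>x. J h (-x)) (-y)"
    unfolding fold_sum_def
    using y by (intro suminf_nonneg fold_summable[OF quad_decay_reflect[OF quad_decay_J[OF h(1)]]] nn) auto
  ultimately show ?thesis using y unfolding T_def periodize_def by (simp add: fold_sum_def)
qed

text \<open>Covering of [-1,1] by some iterated image of \<open>{a..b}\<close>, expressed through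
  the transfer operator so that it comes with a lower bound for the image density.\<close>

definition spreads :: "real \<Rightarrow> real \<Rightarrow> bool"
  where "spreads a b \<longleftrightarrow> -1 \<le> a \<and> a < b \<and> b \<le> 1 \<and>
    (\<exists>n \<epsilon>. 0 < \<epsilon> \<and> (\<forall>y\<in>{-1..1}. \<epsilon> \<le> (T ^^ n) (indicator {a..b}) y))"

lemma spreads_reflect: assumes "spreads a b" shows "spreads (-b) (-a)"
proof -
  have "indicator {-b..-a} = (\<lambda>x. indicator {a..b} (-x) :: real)"
    by (auto simp: indicator_def fun_eq_iff)
  then have "(T ^^ n) (indicator {-b..-a}) y = (T ^^ n) (indicator {a..b}) (-y)" for n y
    by (simp add: T_pow_reflect)
  moreover have "-y \<in> {-1..1}" if "y \<in> {-1..1::real}" for y using that by auto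
  ultimately have "0 < \<epsilon> \<and> (\<forall>y\<in>{-1..1}. \<epsilon> \<le> (T ^^ n) (indicator {a..b}) y) \<Longrightarrow>
      0 < \<epsilon> \<and> (\<forall>y\<in>{-1..1}. \<epsilon> \<le> (T ^^ n) (indicator {-b..-a}) y)" for n \<epsilon> by metis
  moreover have "-1 \<le> -b" "-b < -a" "-a \<le> 1" using assms unfolding spreads_def by auto
  ultimately show ?thesis using assms unfolding spreads_def by blast
qed

text \<open>By positivity and linearity of \<open>T\<close>, a multiple of an indicator below
  \<open>T (indicator {a..b})\<close> can be pushed forward in its place; the lower bounds
  multiply.\<close>

lemma spreads_step:
  assumes "-1 \<le> a" "a < b" "b \<le> 1" "0 < c" "\<And>y. y \<in> {a'..b'} \<Longrightarrow> c \<le> T (indicator {a..b}) y"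
    and B: "spreads a' b'"
  shows "spreads a b"
proof -
  obtain n \<epsilon> where n: "0 < \<epsilon>" "\<And>y. y \<in> {-1..1} \<Longrightarrow> \<epsilon> \<le> (T ^^ n) (indicator {a'..b'}) y"
    and ab': "-1 \<le> a'" "b' \<le> 1" using B unfolding spreads_def by blast
  have bA: "ufun 1 (indicator {a..b})" and bB: "ufun 1 (indicator {a'..b'})"
    using assms ab' by (auto intro: ufun_indicator)
  have "c * \<epsilon> \<le> (T ^^ Suc n) (indicator {a..b}) y" if y: "y \<in> {-1..1}" for y
  proof -
    have "c * \<epsilon> \<le> c * (T ^^ n) (indicator {a'..b'}) y" using n(2)[OF y] assms(4) by simp
    also have "\<dots> = (T ^^ n) (\<lambda>x. c * indicator {a'..b'} x) y"
      using T_pow_linear[OF bB ufun_zero, of n c 0] by simp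
    also have "\<dots> \<le> (T ^^ n) (T (indicator {a..b})) y"
    proof (rule T_pow_mono)
      show "ufun (\<bar>c\<bar> * 1 + \<bar>0\<bar> * 0) (\<lambda>x. c * indicator {a'..b'} x)"
        using ufun_linear[OF bB ufun_zero, of c 0] by simp
      show "ufun (T_const * 1) (T (indicator {a..b}))" by (rule ufun_T[OF bA])
      fix x
      have "0 \<le> (T ^^ 1) (indicator {a..b}) x" by (rule T_pow_nonneg[OF bA]) simp
      then show "c * indicator {a'..b'} x \<le> T (indicator {a..b}) x"
        using assms(5)[of x] by (auto split: split_indicator)
    qed
    finally show ?thesis by (simp add: funpow_swap1)
  qed
  moreover have "0 < c * \<epsilon>" using n(1) assms(4) by simp
  ultimately show ?thesis unfolding spreads_def using assms(1-3) by blast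
qed

text \<open>A single inverse branch already gives the bound: its density
  \<open>\<beta> / z\<^sup>2\<close> is smallest at the far end
  \<open>z = \<beta> / a\<close>.\<close>

lemma T_indicator_ge:
  assumes "0 < a" "a \<le> b" "b \<le> 1" "y \<in> {-1..1}" "\<beta> / b \<le> y + 2 * real k + 2" "y + 2 * real k + 2 \<le> \<beta> / a"
  shows "a\<^sup>2 / \<beta> \<le> T (indicator {a..b}) y"
proof -
  let ?z = "y + 2 * real k + 2"
  have z: "0 < ?z" using assms by auto
  have "a \<le> \<beta> / ?z" "\<beta> / ?z \<le> b" using assms z by (auto simp: field_simps)
  then have "J (indicator {a..b}) ?z = \<beta> / ?z\<^sup>2" by (simp add: J_def)
  moreover have "\<beta> / (\<beta> / a)\<^sup>2 \<le> \<beta> / ?z\<^sup>2"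
    using z assms beta_pos by (intro divide_left_mono power_mono mult_pos_pos zero_less_power) auto
  moreover have "\<beta> / (\<beta> / a)\<^sup>2 = a\<^sup>2 / \<beta>" using assms beta_pos by (simp add: power2_eq_square field_simps)
  moreover have "J (indicator {a..b}) ?z \<le> T (indicator {a..b}) y"
    by (rule T_ge_term[of 1]) (use assms in \<open>auto intro!: ufun_indicator\<close>)
  ultimately show ?thesis by simp
qed

lemma exists_odd_ge: "\<exists>k. x \<le> 2 * real k + 1"
  by (rule exI[of _ "nat \<lceil>x\<rceil>"]) linarith

text \<open>The branches accumulate at 0, so the interval contains a whole one,
  [\<beta>/(2k+3), \<beta>/(2k+1)], and this is mapped onto [-1,1] in a single step.\<close>

lemma spreads_zero:
  assumes "-1 \<le> a" "a \<le> 0" "0 < b" "b \<le> 1" shows "spreads a b"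
proof -
  obtain k where k: "max \<beta> (\<beta> / b) \<le> 2 * real k + 1" using exists_odd_ge by blast
  define p where "p = \<beta> / (2 * real k + 3)"
  define q where "q = \<beta> / (2 * real k + 1)"
  from k have k1: "\<beta> \<le> 2 * real k + 1" and k2: "\<beta> / b \<le> 2 * real k + 1" by auto
  have q: "q \<le> 1" "0 < p" "p \<le> q"
    using k1 beta_pos unfolding p_def q_def by (auto simp: field_simps)
  moreover have "q \<le> b" using k2 assms unfolding q_def by (simp add: field_simps)
  ultimately have q: "q \<le> 1" "q \<le> b" "0 < p" "p \<le> q" by auto
  have "p\<^sup>2 / \<beta> \<le> (T ^^ 1) (indicator {a..b}) y" if y: "y \<in> {-1..1}" for y
  proof -
    have "p\<^sup>2 / \<beta> \<le> T (indicator {p..q}) y"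
      by (rule T_indicator_ge[of _ _ _ k]) (use q y beta_pos in \<open>auto simp: p_def q_def\<close>)
    also have "\<dots> \<le> T (indicator {a..b}) y"
      by (rule T_mono[OF ufun_indicator ufun_indicator]) (use q assms in \<open>auto split: split_indicator\<close>)
    finally show ?thesis by simp
  qed
  moreover have "0 < p\<^sup>2 / \<beta>" using q beta_pos by simp
  ultimately show ?thesis unfolding spreads_def using assms by (intro conjI exI[of _ 1] exI[of _ "p\<^sup>2 / \<beta>"]) auto
qed

lemma spreads_zero':
  assumes "-1 \<le> a" "a < 0" "0 \<le> b" "b \<le> 1" shows "spreads a b"
  using spreads_reflect[OF spreads_zero[of "-b" "-a"]] assms by simp

text \<open>
  The image of \<open>{a..b}\<close> under \<open>x \<mapsto> \<beta>/x\<close> is longer by the factor \<open>\<beta>/(ab)\<close>. Reduction modulo 2 may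
  cut it at an odd number; unless a piece reaches \<open>0\<close>, the cut happens above \<open>3\<close>, where the
  expansion more than compensates for passing to the longer piece.
\<close>

lemma interval_grows:
  assumes a: "0 < a" "a < b" "b \<le> 1"
  shows "spreads a b \<or> (\<exists>a' b' c. -1 \<le> a' \<and> a' < b' \<and> b' \<le> 1 \<and> min \<beta> (3/2) * (b - a) \<le> b' - a' \<and>
     0 < c \<and> (\<forall>y\<in>{a'..b'}. c \<le> T (indicator {a..b}) y))"
proof -
  define s where "s = \<beta> / b"
  define t where "t = \<beta> / a"
  have s: "\<beta> \<le> s" "s < t" using a beta_pos unfolding s_def t_def by (auto simp: field_simps)
  have st: "t - s = s * t / \<beta> * (b - a)"
    using a beta_pos unfolding s_def t_def by (simp add: field_simps)
  have c: "0 < a\<^sup>2 / \<beta>" using a beta_pos by simp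
  have ge: "a\<^sup>2 / \<beta> \<le> T (indicator {a..b}) y" if "-1 \<le> a'" "b' \<le> 1" "s \<le> a' + 2 * real k + 2" "b' + 2 * real k + 2 \<le> t" "y \<in> {a'..b'}"
    for a' b' y k
    by (rule T_indicator_ge[of _ _ _ k]) (use that a in \<open>auto simp: s_def t_def\<close>)
  \<comment> \<open>Selects the branch of the lower end \<open>s\<close>: it lies in [2k+1,2k+3),
    whose midpoint 2k+2 is folded to 0.\<close>
  define k where "k = nat \<lfloor>(s - 1) / 2\<rfloor>"
  have k: "2 * real k + 1 \<le> s" "s < 2 * real k + 3"
  proof -
    have "0 \<le> \<lfloor>(s - 1) / 2\<rfloor>" using s beta_gt_1 by simp
    then have "real k = of_int \<lfloor>(s - 1) / 2\<rfloor>" unfolding k_def by simp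
    then show "2 * real k + 1 \<le> s" "s < 2 * real k + 3"
      using floor_correct[of "(s - 1) / 2"] by (simp_all add: field_simps)
  qed
  show ?thesis
  proof (cases "t \<le> 2 * real k + 3")
    case True
    have "\<beta> * (b - a) \<le> s * t / \<beta> * (b - a)"
    proof (rule mult_right_mono)
      have "\<beta> * \<beta> \<le> s * t" using s beta_pos by (intro mult_mono) auto
      then show "\<beta> \<le> s * t / \<beta>" using beta_pos by (simp add: field_simps)
    qed (use a in simp)
    moreover have "min \<beta> (3/2) * (b - a) \<le> \<beta> * (b - a)" using a by (intro mult_right_mono) auto
    ultimately have "min \<beta> (3/2) * (b - a) \<le> t - s" using st by linarith
    then show ?thesis using ge[of "s - 2 * real k - 2" "t - 2 * real k - 2" k] True k s c
      by (intro disjI2 exI[of _ "s - 2 * real k - 2"] exI[of _ "t - 2 * real k - 2"] exI[of _ "a\<^sup>2 / \<beta>"]) auto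
  next
    case False
    have right: "\<forall>y\<in>{s - 2 * real k - 2..1}. a\<^sup>2 / \<beta> \<le> T (indicator {a..b}) y"
      using ge[of "s - 2 * real k - 2" 1 k] k False by auto
    have left: "\<forall>y\<in>{-1..r}. a\<^sup>2 / \<beta> \<le> T (indicator {a..b}) y" if "r \<le> 1" "r \<le> t - 2 * real k - 4" for r
      using ge[of "-1" r "Suc k"] k that by auto
    \<comment> \<open>The cut is at 2k+3. The piece below it reaches 0 after folding if
      \<open>s\<close> is at most 2k+2, the piece above it if \<open>t\<close> is at least 2k+4.
      Otherwise the longer piece is kept.\<close>
    consider "s \<le> 2 * real k + 2" | "2 * real k + 4 \<le> t" | "2 * real k + 2 < s" "t < 2 * real k + 4" by linarith
    then show ?thesis
    proof cases
      case 1
      have "spreads (s - 2 * real k - 2) 1" using 1 k by (intro spreads_zero) auto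
      then have "spreads a b" using right c a by (intro spreads_step[of a b "a\<^sup>2 / \<beta>" "s - 2 * real k - 2" 1]) auto
      then show ?thesis by blast
    next
      case 2
      have "spreads (-1) 0" by (rule spreads_zero') auto
      then have "spreads a b" using left[of 0] 2 c a by (intro spreads_step[of a b "a\<^sup>2 / \<beta>" "-1" 0]) auto
      then show ?thesis by blast
    next
      case 3
      have "3 < t" using False by simp
      then have "\<beta> * 3 \<le> s * t" using s beta_pos by (intro mult_mono) auto
      then have "3 / 2 \<le> s * t / \<beta> / 2" using beta_pos by (simp add: field_simps)
      then have "3 / 2 * (b - a) \<le> s * t / \<beta> / 2 * (b - a)" using a by (intro mult_right_mono) auto
      moreover have "min \<beta> (3/2) * (b - a) \<le> 3/2 * (b - a)" using a by (intro mult_right_mono) auto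
      moreover have "s * t / \<beta> / 2 * (b - a) = (t - s) / 2" unfolding st by simp
      ultimately have len: "min \<beta> (3/2) * (b - a) \<le> (t - s) / 2" by (metis order_trans)
      show ?thesis
      proof (cases "(t - s) / 2 \<le> 2 * real k + 3 - s")
        case True
        then show ?thesis using right len 3 k c
          by (intro disjI2 exI[of _ "s - 2 * real k - 2"] exI[of _ 1] exI[of _ "a\<^sup>2 / \<beta>"]) auto
      next
        case f: False
        have "min \<beta> (3/2) * (b - a) \<le> (t - 2 * real k - 4) - (-1)" using f len by argo
        then show ?thesis using left[of "t - 2 * real k - 4"] 3 k c False
          by (intro disjI2 exI[of _ "-1"] exI[of _ "t - 2 * real k - 4"] exI[of _ "a\<^sup>2 / \<beta>"]) auto
      qed
    qed
  qed
qed

text \<open>No subinterval of [-1,1] is longer than 2, so growth by the factor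
  \<open>min \<beta> (3/2)\<close> must stop, and it stops only at an interval that spreads.
  \<open>n\<close> bounds the number of steps left; for \<open>n = 0\<close> the hypothesis is
  contradictory.\<close>

lemma spreads_interval_aux:
  assumes "-1 \<le> a" "a < b" "b \<le> 1" "2 < (b - a) * min \<beta> (3/2) ^ n"
  shows "spreads a b"
  using assms
proof (induction n arbitrary: a b)
  case (Suc n)
  have pos: "spreads a b" if ab: "0 < a" "a < b" "b \<le> 1" "2 < (b - a) * min \<beta> (3/2) ^ Suc n" for a b
  proof -
    consider "spreads a b" | a' b' c where "-1 \<le> a'" "a' < b'" "b' \<le> 1" "min \<beta> (3/2) * (b - a) \<le> b' - a'"
      "0 < c" "\<forall>y\<in>{a'..b'}. c \<le> T (indicator {a..b}) y"
      using interval_grows[OF ab(1-3)] by blast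
    then show ?thesis
    proof cases
      case 2
      have "2 < (min \<beta> (3/2) * (b - a)) * min \<beta> (3/2) ^ n" using ab(4) by (simp add: mult_ac)
      also have "\<dots> \<le> (b' - a') * min \<beta> (3/2) ^ n"
        using 2(4) beta_pos by (intro mult_right_mono) auto
      finally have "spreads a' b'" using 2 by (intro Suc.IH) auto
      then show ?thesis using 2 ab by (intro spreads_step[of a b c a' b']) auto
    qed
  qed
  consider "0 < a" | "a \<le> 0" "0 < b" | "a < 0" "b = 0" | "b < 0" using Suc.prems by linarith
  then show ?case
  proof cases
    case 1 then show ?thesis using pos Suc.prems by blast
  next
    case 2 then show ?thesis using spreads_zero Suc.prems by blast
  next
    case 3 then show ?thesis using spreads_zero'[of a b] Suc.prems by simp
  next
    case 4
    have "spreads (-b) (-a)" by (rule pos) (use 4 Suc.prems in auto)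
    then show ?thesis using spreads_reflect[of "-b" "-a"] by simp
  qed
qed auto

lemma spreads_interval:
  assumes "-1 \<le> a" "a < b" "b \<le> 1"
  shows "spreads a b"
proof -
  have "1 < min \<beta> (3/2)" using beta_gt_1 by simp
  then obtain n where "2 / (b - a) < min \<beta> (3/2) ^ n" using real_arch_pow by blast
  then show ?thesis using assms by (intro spreads_interval_aux[of a b n]) (auto simp: field_simps)
qed

text \<open>Positive lower bounds persist under \<open>T\<close>. This is what gives finitely many
  intervals a common exponent in \<open>spreads_uniform\<close>.\<close>

lemma T_lower_step:
  "\<exists>c>0. \<forall>B h \<epsilon>. ufun B h \<longrightarrow> 0 < \<epsilon> \<longrightarrow> (\<forall>y\<in>{-1..1}. \<epsilon> \<le> h y) \<longrightarrow>
      (\<forall>y\<in>{-1..1}. c * \<epsilon> \<le> T h y)"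
proof -
  obtain k where k: "\<beta> \<le> 2 * real k + 1" using exists_odd_ge by blast
  define p where "p = \<beta> / (2 * real k + 3)"
  have p: "0 < p" "p \<le> 1" using k beta_pos unfolding p_def by (auto simp: field_simps)
  have one: "p\<^sup>2 / \<beta> \<le> T (indicator {-1..1}) y" if y: "y \<in> {-1..1}" for y
  proof -
    have "p\<^sup>2 / \<beta> \<le> T (indicator {p..1}) y"
      by (rule T_indicator_ge[of _ _ _ k]) (use p k y beta_pos in \<open>auto simp: p_def\<close>)
    also have "\<dots> \<le> T (indicator {-1..1}) y"
      by (rule T_mono[OF ufun_indicator ufun_indicator]) (use p in \<open>auto split: split_indicator\<close>)
    finally show ?thesis .
  qed
  show ?thesis
  proof (intro exI[of _ "p\<^sup>2 / \<beta>"] conjI allI impI ballI)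
    fix B h \<epsilon> and y :: real
    assume h: "ufun B h" and e: "0 < \<epsilon>" "\<forall>y\<in>{-1..1}. \<epsilon> \<le> h y" and y: "y \<in> {-1..1::real}"
    have "p\<^sup>2 / \<beta> * \<epsilon> \<le> \<epsilon> * T (indicator {-1..1}) y" using mult_left_mono[OF one[OF y], of \<epsilon>] e(1) by (simp add: mult.commute)
    also have "\<dots> = T (\<lambda>x. \<epsilon> * indicator {-1..1} x) y"
      using T_linear[OF ufun_indicator[of "-1" 1] ufun_zero, of \<epsilon> 0] by simp
    also have "\<dots> \<le> T h y"
    proof (rule T_mono[OF _ h])
      show "ufun \<bar>\<epsilon>\<bar> (\<lambda>x. \<epsilon> * indicator {-1..1} x)"
        using ufun_linear[OF ufun_indicator[of "-1" 1] ufun_zero, of \<epsilon> 0] by simp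
      fix x show "\<epsilon> * indicator {-1..1} x \<le> h x"
        using e(2) ufunD(3)[OF h, of x] by (cases "x \<in> {-1..1}") auto
    qed
    finally show "p\<^sup>2 / \<beta> * \<epsilon> \<le> T h y" .
  qed (use p beta_pos in auto)
qed

lemma spreads_later:
  assumes "spreads a b"
  shows "\<exists>n0. \<forall>n\<ge>n0. \<exists>\<epsilon>>0. \<forall>y\<in>{-1..1}. \<epsilon> \<le> (T ^^ n) (indicator {a..b}) y"
proof -
  obtain n0 \<epsilon>0 where ab: "-1 \<le> a" "b \<le> 1" and n0: "0 < \<epsilon>0" "\<forall>y\<in>{-1..1}. \<epsilon>0 \<le> (T ^^ n0) (indicator {a..b}) y"
    using assms unfolding spreads_def by blast
  obtain c where c: "0 < c" "\<forall>B h \<epsilon>. ufun B h \<longrightarrow> 0 < \<epsilon> \<longrightarrow> (\<forall>y\<in>{-1..1}. \<epsilon> \<le> h y) \<longrightarrow>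
      (\<forall>y\<in>{-1..1}. c * \<epsilon> \<le> T h y)" using T_lower_step by blast
  have "\<exists>\<epsilon>>0. \<forall>y\<in>{-1..1}. \<epsilon> \<le> (T ^^ n) (indicator {a..b}) y" if "n0 \<le> n" for n
    using that
  proof (induction n rule: dec_induct)
    case base show ?case using n0 by blast
  next
    case (step n)
    then obtain \<epsilon> where e: "0 < \<epsilon>" "\<forall>y\<in>{-1..1}. \<epsilon> \<le> (T ^^ n) (indicator {a..b}) y" by blast
    have "c * \<epsilon> \<le> (T ^^ Suc n) (indicator {a..b}) y" if "y \<in> {-1..1}" for y
      using c(2)[rule_format, OF ufun_pow[OF ufun_indicator[OF ab]] e(1) _ that, of n] e(2) by auto
    moreover have "0 < c * \<epsilon>" using c e by simp
    ultimately show ?case by blast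
  qed
  then show ?thesis by blast
qed

lemma spreads_uniform:
  fixes l r :: "nat \<Rightarrow> real"
  assumes "\<And>i. i < N \<Longrightarrow> spreads (l i) (r i)"
  shows "\<exists>n0. \<forall>n\<ge>n0. \<exists>\<epsilon>>0. \<forall>i<N. \<forall>y\<in>{-1..1}. \<epsilon> \<le> (T ^^ n) (indicator {l i..r i}) y"
  using assms
proof (induction N)
  case 0 then show ?case by (intro exI[of _ 0] allI impI exI[of _ "1::real"]) auto
next
  case (Suc N)
  obtain n1 where n1: "\<forall>n\<ge>n1. \<exists>\<epsilon>>0. \<forall>i<N. \<forall>y\<in>{-1..1}. \<epsilon> \<le> (T ^^ n) (indicator {l i..r i}) y"
    using Suc.IH Suc.prems less_SucI by metis
  obtain n2 where n2: "\<forall>n\<ge>n2. \<exists>\<epsilon>>0. \<forall>y\<in>{-1..1}. \<epsilon> \<le> (T ^^ n) (indicator {l N..r N}) y"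
    using spreads_later[OF Suc.prems[OF lessI]] by blast
  have "\<exists>\<epsilon>>0. \<forall>i<Suc N. \<forall>y\<in>{-1..1}. \<epsilon> \<le> (T ^^ n) (indicator {l i..r i}) y" if "max n1 n2 \<le> n" for n
  proof -
    obtain e1 e2 where e: "0 < e1" "\<forall>i<N. \<forall>y\<in>{-1..1}. e1 \<le> (T ^^ n) (indicator {l i..r i}) y"
      "0 < e2" "\<forall>y\<in>{-1..1}. e2 \<le> (T ^^ n) (indicator {l N..r N}) y"
      using n1[rule_format, of n] n2[rule_format, of n] \<open>max n1 n2 \<le> n\<close> by auto
    have "min e1 e2 \<le> (T ^^ n) (indicator {l i..r i}) y" if "i < Suc N" "y \<in> {-1..1}" for i y
    proof (cases "i = N")
      case True
      then show ?thesis using e(4) that by (simp add: min.coboundedI2)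
    next
      case False
      then show ?thesis using e(2) that by (simp add: min.coboundedI1)
    qed
    moreover have "0 < min e1 e2" using e by simp
    ultimately show ?thesis by blast
  qed
  then show ?case by blast
qed

end

section \<open>Exponential decay on functions of mean zero\<close>

lemma wvar_ge:
  assumes "maj {-1..1} h F" "0 \<le> \<delta>" "\<delta> \<le> 1"
  shows "F 1 - F (-1) \<le> wvar \<delta> F"
  using maj_mono[OF assms(1), of "1 - \<delta>" 1] maj_mono[OF assms(1), of "-1" "-1 + \<delta>"] assms
  unfolding wvar_def by auto

lemma wvar_le_osc:
  assumes "wvar_le \<delta> h v" "0 \<le> \<delta>" "\<delta> \<le> 1" "x \<in> {-1..1}" "y \<in> {-1..1}"
  shows "\<bar>h x - h y\<bar> \<le> v"
proof -
  obtain F where F: "maj {-1..1} h F" "wvar \<delta> F \<le> v" using assms unfolding wvar_le_def by blast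
  have "\<bar>h b - h a\<bar> \<le> v" if "a \<in> {-1..1}" "b \<in> {-1..1}" "a \<le> b" for a b
  proof -
    have "\<bar>h b - h a\<bar> \<le> F b - F a" by (rule majD[OF F(1) that])
    moreover have "F b \<le> F 1" "F (-1) \<le> F a" using that by (auto intro!: maj_mono[OF F(1)])
    ultimately show ?thesis using wvar_ge[OF F(1) assms(2,3)] F(2) by linarith
  qed
  from this[of x y] this[of y x] show ?thesis using assms(4,5) by (cases "x \<le> y") (auto simp: abs_minus_commute)
qed

lemma wvar_le_nonneg: "wvar_le \<delta> h v \<Longrightarrow> 0 \<le> \<delta> \<Longrightarrow> \<delta> \<le> 1 \<Longrightarrow> 0 \<le> v"
  using wvar_le_osc[of \<delta> h v 0 0] by simp

text \<open>Averaging \<open>h x - v \<le> h y\<close> over \<open>y\<close> in [-1,1], an interval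
  of length 2.\<close>

lemma wvar_le_le_mean:
  assumes h: "ufun B h" and v: "wvar_le \<delta> h v" "0 \<le> \<delta>" "\<delta> \<le> 1" and x: "x \<in> {-1..1}"
  shows "h x \<le> (LINT x|lborel. h x) / 2 + v"
proof -
  have "(LINT y|lborel. (h x - v) * indicator {-1..1::real} y) \<le> (LINT y|lborel. h y)"
  proof (rule integral_mono)
    show "integrable lborel (\<lambda>y. (h x - v) * indicator {-1..1::real} y)"
      by (intro integrable_mult_right integrable_real_indicator) auto
    show "integrable lborel h" by (rule ufunD(5)[OF h])
    fix y :: real show "(h x - v) * indicator {-1..1} y \<le> h y"
      using wvar_le_osc[OF v x, of y] ufunD(3)[OF h, of y] by (cases "y \<in> {-1..1}") auto
  qed
  then show ?thesis by simp
qed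

context gauss_map begin

lemma T_pow_abs_bound:
  assumes "h \<in> borel_measurable borel" "\<And>x. \<bar>h x\<bar> \<le> B * indicator {-1..1} x"
  shows "\<bar>(T ^^ n) h y\<bar> \<le> T_const ^ n * B"
  using ufunD(2)[OF ufun_pow, of B h n y] assms unfolding ufun_def by blast

text \<open>The mass of a nonnegative function stays constant along the iteration, so the L1 terms
  of the Lasota--Yorke inequality form a geometric series with the stated sum.\<close>

lemma wvar_le_pow:
  assumes LY: "\<forall>B h v. ufun B h \<longrightarrow> wvar_le \<delta> h v \<longrightarrow> wvar_le \<delta> (T h) (\<theta> * v + C * (LINT x|lborel. \<bar>h x\<bar>))"
    and \<theta>: "\<theta> < 1"
    and h: "ufun B h" "\<And>x. 0 \<le> h x" "wvar_le \<delta> h v"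
  shows "wvar_le \<delta> ((T ^^ n) h) (\<theta> ^ n * v + C / (1 - \<theta>) * (LINT x|lborel. h x) * (1 - \<theta> ^ n))"
proof (induction n)
  case 0
  then show ?case using h by simp
next
  case (Suc n)
  let ?m = "LINT x|lborel. h x"
  have "(LINT x|lborel. \<bar>(T ^^ n) h x\<bar>) = (LINT x|lborel. (T ^^ n) h x)"
    using T_pow_nonneg[OF h(1,2), of n] by simp
  then have e: "(LINT x|lborel. \<bar>(T ^^ n) h x\<bar>) = ?m" using T_pow_integral[OF h(1), of n] by simp
  have "wvar_le \<delta> (T ((T ^^ n) h)) (\<theta> * (\<theta> ^ n * v + C / (1 - \<theta>) * ?m * (1 - \<theta> ^ n)) + C * ?m)"
    using LY[rule_format, OF ufun_pow[OF h(1)] Suc] unfolding e .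
  moreover have "\<theta> * (\<theta> ^ n * v + C / (1 - \<theta>) * ?m * (1 - \<theta> ^ n)) + C * ?m =
      \<theta> ^ Suc n * v + C / (1 - \<theta>) * ?m * (1 - \<theta> ^ Suc n)"
  proof -
    define D where "D = C / (1 - \<theta>)"
    have C: "C = D * (1 - \<theta>)" unfolding D_def using \<theta> by simp
    show ?thesis unfolding D_def[symmetric] unfolding C by (simp add: algebra_simps)
  qed
  ultimately show ?case by simp
qed

text \<open>The mass \<open>m\<close> is kept as a parameter because it is what shrinks
  geometrically, and the variation is measured relative to it.\<close>

definition in_cone :: "real \<Rightarrow> real \<Rightarrow> real \<Rightarrow> (real \<Rightarrow> real) \<Rightarrow> bool"
  where "in_cone \<delta> a m h \<longleftrightarrow> (\<exists>B. ufun B h) \<and> (\<forall>x. 0 \<le> h x) \<and> (LINT x|lborel. h x) = m \<and> wvar_le \<delta> h (a * m)"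

text \<open>Otherwise each cell contains a point with value below m/4, so \<open>h\<close> is at
  most m/4 plus the increment of \<open>F\<close> there. As the cells have length 2/N and
  \<open>N\<close> is at least \<open>8 * a\<close>, the mass would be at most m/2 + m/4.\<close>

lemma cone_large_on_interval:
  assumes h: "ufun B h" and v: "wvar_le \<delta> h (a * m)" "0 \<le> \<delta>" "\<delta> \<le> 1" and m: "(LINT x|lborel. h x) = m" "0 < m"
    and N: "8 * a \<le> real N" "0 < N"
  shows "\<exists>i<N. \<forall>x\<in>{-1 + 2 * real i / real N..-1 + 2 * real (Suc i) / real N}. m / 4 \<le> h x"
proof (rule ccontr)
  define p where "p = (\<lambda>i. -1 + 2 * real i / real N)"
  assume "\<not> ?thesis"
  then have "\<forall>i<N. \<exists>x\<in>{p i..p (Suc i)}. h x < m / 4" unfolding p_def by (meson not_le)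
  then obtain \<xi> where \<xi>: "\<And>i. i < N \<Longrightarrow> \<xi> i \<in> {p i..p (Suc i)} \<and> h (\<xi> i) < m / 4" by metis
  obtain F where F: "maj {-1..1} h F" "wvar \<delta> F \<le> a * m" using v unfolding wvar_le_def by blast
  have pr: "p i \<in> {-1..1}" if "i \<le> N" for i using that N unfolding p_def by (auto simp: field_simps)
  have pd: "p (Suc i) - p i = 2 / real N" for i unfolding p_def by (simp add: algebra_simps add_divide_distrib)
  define g where "g = (\<lambda>i x. (m / 4 + (F (p (Suc i)) - F (p i))) * indicator {p i..p (Suc i)} x)"
  have p_le: "p i \<le> p (Suc i)" for i
  proof -
    have "0 \<le> 2 / real N" by simp
    then show ?thesis using pd[of i] by linarith
  qed
  have Fp: "F (p i) \<le> F (p (Suc i))" if "i < N" for i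
    using pr[of i] pr[of "Suc i"] that p_le[of i] by (intro maj_mono[OF F(1)]) auto
  have g0: "0 \<le> g i x" if "i < N" for i x unfolding g_def using Fp[OF that] m by simp
  have hg: "h x \<le> (\<Sum>i<N. g i x)" for x
  proof (cases "x \<in> {-1..1}")
    case False
    then show ?thesis using ufunD(3)[OF h False] g0 by (auto intro!: sum_nonneg)
  next
    case True
    have "\<exists>i<N. x \<in> {p i..p (Suc i)}"
    proof (cases "x = 1")
      case True
      then show ?thesis using N by (intro exI[of _ "N - 1"]) (auto simp: p_def field_simps)
    next
      case f: False
      define z where "z = (x + 1) * real N / 2"
      have "0 \<le> (x + 1) / 2" "(x + 1) / 2 < 1" using True f by auto
      then have z: "0 \<le> z" "z < real N"
        using N mult_strict_right_mono[of "(x + 1) / 2" 1 "real N"] unfolding z_def by auto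
      have x: "x = -1 + 2 * z / real N" using N unfolding z_def by simp
      have "real (nat \<lfloor>z\<rfloor>) \<le> z" "z \<le> real (Suc (nat \<lfloor>z\<rfloor>))" "nat \<lfloor>z\<rfloor> < N" using z by linarith+
      then show ?thesis using N unfolding x p_def
        by (intro exI[of _ "nat \<lfloor>z\<rfloor>"]) (auto intro!: divide_right_mono)
    qed
    then obtain i where i: "i < N" "x \<in> {p i..p (Suc i)}" by blast
    have "\<bar>h x - h (\<xi> i)\<bar> \<le> F (p (Suc i)) - F (p i)"
    proof -
      have r: "-1 \<le> p i" "p (Suc i) \<le> 1" using pr[of i] pr[of "Suc i"] i by auto
      have *: "\<bar>h t - h s\<bar> \<le> F (p (Suc i)) - F (p i)" if "s \<in> {p i..p (Suc i)}" "t \<in> {p i..p (Suc i)}" "s \<le> t" for s t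
        using majD[OF F(1), of s t] maj_mono[OF F(1), of "p i" s] maj_mono[OF F(1), of t "p (Suc i)"] that r by auto
      show ?thesis using *[of x "\<xi> i"] *[of "\<xi> i" x] i \<xi>[OF i(1)] by (cases "x \<le> \<xi> i") (auto simp: abs_minus_commute)
    qed
    then have "h x \<le> g i x" using \<xi>[OF i(1)] i unfolding g_def by auto
    also have "\<dots> \<le> (\<Sum>i<N. g i x)" using i g0 by (intro member_le_sum) auto
    finally show ?thesis .
  qed
  have gi: "has_bochner_integral lborel (g i) ((m / 4 + (F (p (Suc i)) - F (p i))) * (2 / real N))" for i
  proof -
    note le = p_le[of i]
    have "has_bochner_integral lborel (indicator {p i..p (Suc i)}) (measure lborel {p i..p (Suc i)})"
      by (rule has_bochner_integral_real_indicator) (use le in auto)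
    then have "has_bochner_integral lborel (indicator {p i..p (Suc i)}) (2 / real N)" using le pd[of i] by simp
    then show ?thesis unfolding g_def by (rule has_bochner_integral_mult_right)
  qed
  have sg: "has_bochner_integral lborel (\<lambda>x. \<Sum>i<N. g i x) (\<Sum>i<N. (m / 4 + (F (p (Suc i)) - F (p i))) * (2 / real N))"
    by (rule has_bochner_integral_sum) (rule gi)
  have "m \<le> (LINT x|lborel. (\<Sum>i<N. g i x))"
    unfolding m(1)[symmetric]
    by (rule integral_mono) (use sg ufunD(5)[OF h] hg in \<open>auto simp: has_bochner_integral_iff\<close>)
  also have "\<dots> = (\<Sum>i<N. (m / 4 + (F (p (Suc i)) - F (p i))) * (2 / real N))"
    using sg by (simp add: has_bochner_integral_iff)
  also have "\<dots> = (real N * (m / 4) + (\<Sum>i<N. F (p (Suc i)) - F (p i))) * (2 / real N)"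
    by (simp only: sum_distrib_right[symmetric] sum.distrib sum_constant card_lessThan)
  also have "(\<Sum>i<N. F (p (Suc i)) - F (p i)) = F (p N) - F (p 0)" by (rule sum_lessThan_telescope)
  also have "\<dots> = F 1 - F (-1)" using N by (simp add: p_def)
  also have "(real N * (m / 4) + (F 1 - F (-1))) * (2 / real N) \<le> (real N * (m / 4) + (real N / 8) * m) * (2 / real N)"
  proof (intro mult_right_mono add_left_mono)
    have "F 1 - F (-1) \<le> a * m" using wvar_ge[OF F(1) v(2,3)] F(2) by linarith
    also have "\<dots> \<le> (real N / 8) * m" using N m by (intro mult_right_mono) auto
    finally show "F 1 - F (-1) \<le> (real N / 8) * m" .
  qed simp
  also have "\<dots> = 3 / 4 * m" using N by (simp add: field_simps)
  finally show False using m by simp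
qed

text \<open>
  Subtracting a constant lowers the mass without changing the variation; the Lasota--Yorke
  inequality provides the slack for this in the cone condition.
\<close>

lemma cone_contraction:
  assumes \<delta>: "0 < \<delta>" "\<delta> \<le> 1" and \<theta>: "0 < \<theta>" "\<theta> < 1" and C: "0 \<le> C"
    and LY: "\<forall>B h v. ufun B h \<longrightarrow> wvar_le \<delta> h v \<longrightarrow> wvar_le \<delta> (T h) (\<theta> * v + C * (LINT x|lborel. \<bar>h x\<bar>))"
  shows "\<exists>a n \<epsilon>. 1 \<le> a \<and> 0 < n \<and> 0 < \<epsilon> \<and> \<epsilon> \<le> 1 / 8 \<and>
    (\<forall>m h. 0 \<le> m \<longrightarrow> in_cone \<delta> a m h \<longrightarrow>
      in_cone \<delta> a ((1 - 2 * \<epsilon>) * m) (\<lambda>x. (T ^^ n) h x - \<epsilon> * m * indicator {-1..1} x))"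
proof -
  define C' where "C' = C / (1 - \<theta>)"
  have C': "0 \<le> C'" unfolding C'_def using C \<theta> by simp
  \<comment> \<open>With this choice \<open>C' * m\<close> is at most a quarter of
    \<open>a * m\<close>; as \<open>\<theta> ^ n\<close> will be at most 1/2, the variation after
    \<open>n\<close> steps is at most three quarters of \<open>a * m\<close>.\<close>
  define a where "a = 4 * C' + 1"
  have a: "1 \<le> a" unfolding a_def using C' by simp
  obtain N where N: "8 * a \<le> real N" using real_arch_simple by blast
  then have N0: "0 < N" using a by (cases N) auto
  define l where "l = (\<lambda>i. -1 + 2 * real i / real N)"
  define r where "r = (\<lambda>i. -1 + 2 * real (Suc i) / real N)"
  have lr: "-1 \<le> l i" "l i < r i" "r i \<le> 1" if "i < N" for i
    using that N0 unfolding l_def r_def by (auto simp: field_simps)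
  obtain n0 where n0: "\<forall>n\<ge>n0. \<exists>\<epsilon>>0. \<forall>i<N. \<forall>y\<in>{-1..1}. \<epsilon> \<le> (T ^^ n) (indicator {l i..r i}) y"
    using spreads_uniform[of N l r] spreads_interval lr by blast
  obtain n1 where n1: "\<theta> ^ n1 < 1 / 2" using real_arch_pow_inv[of "1/2" \<theta>] \<theta> by auto
  define n where "n = Suc (max n0 n1)"
  have n: "0 < n" "n0 \<le> n" "n1 \<le> n" unfolding n_def by auto
  have \<theta>n: "\<theta> ^ n \<le> 1 / 2" using n1 power_decreasing[OF n(3), of \<theta>] \<theta> by linarith
  obtain \<epsilon>0 where \<epsilon>0: "0 < \<epsilon>0" "\<forall>i<N. \<forall>y\<in>{-1..1}. \<epsilon>0 \<le> (T ^^ n) (indicator {l i..r i}) y"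
    using n0 n(2) by blast
  \<comment> \<open>The quarter is that of \<open>cone_large_on_interval\<close>. The bound 1/8
    keeps \<open>1 - 2 * \<epsilon>\<close> above the three quarters needed for the variation; the
    factor 2 is the length of [-1,1].\<close>
  define \<epsilon> where "\<epsilon> = min (\<epsilon>0 / 4) (1 / 8)"
  have \<epsilon>: "0 < \<epsilon>" "\<epsilon> \<le> 1 / 8" "\<epsilon> \<le> \<epsilon>0 / 4" unfolding \<epsilon>_def using \<epsilon>0 by auto
  have "in_cone \<delta> a ((1 - 2 * \<epsilon>) * m) (\<lambda>x. (T ^^ n) h x - \<epsilon> * m * indicator {-1..1} x)"
    if m0: "0 \<le> m" and cone: "in_cone \<delta> a m h" for m h
  proof -
    obtain B where h: "ufun B h" "\<And>x. 0 \<le> h x" "(LINT x|lborel. h x) = m" "wvar_le \<delta> h (a * m)"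
      using cone unfolding in_cone_def by blast
    have b1: "ufun 1 (indicator {-1..1})" by (rule ufun_indicator) auto
    have eq: "(\<lambda>x. (T ^^ n) h x - \<epsilon> * m * indicator {-1..1} x) = (\<lambda>x. 1 * (T ^^ n) h x + (- \<epsilon> * m) * indicator {-1..1} x)"
      by auto
    have bf: "\<exists>B. ufun B (\<lambda>x. (T ^^ n) h x - \<epsilon> * m * indicator {-1..1} x)"
      unfolding eq using ufun_linear[OF ufun_pow[OF h(1)] b1] by blast
    have lower: "\<epsilon> * m \<le> (T ^^ n) h y" if y: "y \<in> {-1..1}" for y
    proof (cases "m = 0")
      case True
      then show ?thesis using T_pow_nonneg[OF h(1,2)] by simp
    next
      case False
      then have m: "0 < m" using m0 by simp
      obtain i where i: "i < N" "\<forall>x\<in>{l i..r i}. m / 4 \<le> h x"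
        using cone_large_on_interval[OF h(1,4) _ \<delta>(2) h(3) m N N0] \<delta>(1) unfolding l_def r_def by auto
      have bi: "ufun 1 (indicator {l i..r i})" using lr[OF i(1)] by (auto intro: ufun_indicator)
      have "\<epsilon> * m \<le> m / 4 * \<epsilon>0" using mult_right_mono[OF \<epsilon>(3) m0] by (simp add: mult.commute)
      also have "\<dots> \<le> m / 4 * (T ^^ n) (indicator {l i..r i}) y"
        using \<epsilon>0(2) i(1) y m by (intro mult_left_mono) auto
      also have "\<dots> = (T ^^ n) (\<lambda>x. m / 4 * indicator {l i..r i} x) y"
        using T_pow_linear[OF bi ufun_zero, of n "m / 4" 0] by simp
      also have "\<dots> \<le> (T ^^ n) h y"
      proof (rule T_pow_mono[OF _ h(1)])
        show "ufun (\<bar>m / 4\<bar> * 1 + \<bar>0\<bar> * 0) (\<lambda>x. m / 4 * indicator {l i..r i} x)"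
          using ufun_linear[OF bi ufun_zero, of "m / 4" 0] by simp
        fix x show "m / 4 * indicator {l i..r i} x \<le> h x"
          using i(2) h(2)[of x] by (auto split: split_indicator)
      qed
      finally show ?thesis .
    qed
    have nonneg: "0 \<le> (T ^^ n) h x - \<epsilon> * m * indicator {-1..1} x" for x
      using lower[of x] ufunD(3)[OF ufun_pow[OF h(1)], of x n] by (cases "x \<in> {-1..1}") auto
    have int: "(LINT x|lborel. (T ^^ n) h x - \<epsilon> * m * indicator {-1..1} x) = (1 - 2 * \<epsilon>) * m"
    proof -
      have "(LINT x|lborel. (T ^^ n) h x - \<epsilon> * m * indicator {-1..1} x) =
         (LINT x|lborel. (T ^^ n) h x) - (LINT x|lborel. \<epsilon> * m * indicator {-1..1::real} x)"
        by (intro Bochner_Integration.integral_diff ufunD(5)[OF ufun_pow[OF h(1)]] integrable_mult_right ufunD(5)[OF b1])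
      then show ?thesis using T_pow_integral[OF h(1)] h(3) by (simp add: algebra_simps)
    qed
    have "wvar_le \<delta> ((T ^^ n) h) (\<theta> ^ n * (a * m) + C' * m * (1 - \<theta> ^ n))"
      using wvar_le_pow[OF LY \<theta>(2) h(1,2,4), where n=n] h(3) unfolding C'_def by simp
    moreover have "\<theta> ^ n * (a * m) + C' * m * (1 - \<theta> ^ n) \<le> a * ((1 - 2 * \<epsilon>) * m)"
    proof -
      have "\<theta> ^ n * (a * m) \<le> 1 / 2 * (a * m)" using \<theta>n a m0 by (intro mult_right_mono) auto
      moreover have "C' * m * (1 - \<theta> ^ n) \<le> C' * m * 1" using C' m0 \<theta> by (intro mult_left_mono) auto
      moreover have "C' * m \<le> 1 / 4 * (a * m)" unfolding a_def using m0 by (simp add: algebra_simps)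
      moreover have "3 / 4 * (a * m) \<le> (1 - 2 * \<epsilon>) * (a * m)" using \<epsilon> a m0 by (intro mult_right_mono) auto
      ultimately show ?thesis by (simp add: algebra_simps)
    qed
    ultimately have "wvar_le \<delta> ((T ^^ n) h) (a * ((1 - 2 * \<epsilon>) * m))" by (rule wvar_le_mono)
    moreover have "wvar_le \<delta> (indicator {-1..1}) 0" by (rule wvar_le_const[of _ 1]) simp
    ultimately have "wvar_le \<delta> (\<lambda>x. (T ^^ n) h x - \<epsilon> * m * indicator {-1..1} x) (a * ((1 - 2 * \<epsilon>) * m))"
      unfolding eq using wvar_le_linear[of \<delta> _ _ "indicator {-1..1}" 0 1 "- \<epsilon> * m"] by simp
    then show ?thesis unfolding in_cone_def using bf nonneg int by blast
  qed
  then show ?thesis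
    by (intro exI[of _ a], intro exI[of _ n], intro exI[of _ \<epsilon>]) (use a n(1) \<epsilon>(1,2) in blast)
qed

text \<open>On [-1,1], \<open>h\<close> is the difference of \<open>h + v\<close> and the constant
  \<open>v\<close>. Mean zero and oscillation at most \<open>v\<close> make both nonnegative, and
  both lie in the cone with mass \<open>2 * v\<close>. Every block of \<open>n\<close> steps removes
  the same multiple of 1 from each, so the difference is that of two cone elements of geometrically
  small mass. The second conjunct is a crude variation bound, needed for the source term.\<close>

lemma decay:
  "\<exists>\<delta> M \<sigma>. 0 < \<delta> \<and> \<delta> \<le> 1 \<and> 0 \<le> M \<and> 0 < \<sigma> \<and> \<sigma> < 1 \<and>
    (\<forall>B h v i y. ufun B h \<longrightarrow> wvar_le \<delta> h v \<longrightarrow> (LINT x|lborel. h x) = 0 \<longrightarrow> \<bar>(T ^^ i) h y\<bar> \<le> M * \<sigma> ^ i * v) \<and>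
    (\<forall>B h v. ufun B h \<longrightarrow> wvar_le \<delta> h v \<longrightarrow> (\<exists>w. wvar_le \<delta> (T h) w \<and> w \<le> M * (v + B)))"
proof -
  from lasota_yorke obtain \<delta> \<theta> C where c: "0 < \<delta> \<and> \<delta> \<le> 1 \<and> 0 < \<theta> \<and> \<theta> < 1 \<and> 0 \<le> C \<and>
      (\<forall>B h v. ufun B h \<longrightarrow> wvar_le \<delta> h v \<longrightarrow> wvar_le \<delta> (T h) (\<theta> * v + C * (LINT x|lborel. \<bar>h x\<bar>)))"
    by (elim exE)
  then have \<delta>: "0 < \<delta>" "\<delta> \<le> 1" and \<theta>: "0 < \<theta>" "\<theta> < 1" and C: "0 \<le> C" by simp_all
  from c have LY: "\<forall>B h v. ufun B h \<longrightarrow> wvar_le \<delta> h v \<longrightarrow> wvar_le \<delta> (T h) (\<theta> * v + C * (LINT x|lborel. \<bar>h x\<bar>))"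
    by simp
  from cone_contraction[OF \<delta> \<theta> C LY] obtain a n \<epsilon> where
    c: "1 \<le> a \<and> 0 < n \<and> 0 < \<epsilon> \<and> \<epsilon> \<le> 1 / 8 \<and> (\<forall>m h. 0 \<le> m \<longrightarrow> in_cone \<delta> a m h \<longrightarrow>
      in_cone \<delta> a ((1 - 2 * \<epsilon>) * m) (\<lambda>x. (T ^^ n) h x - \<epsilon> * m * indicator {-1..1} x))"
    by (elim exE)
  then have a: "1 \<le> a" "0 < n" "0 < \<epsilon>" "\<epsilon> \<le> 1 / 8" by simp_all
  from c have step: "\<And>m h. 0 \<le> m \<Longrightarrow> in_cone \<delta> a m h \<Longrightarrow>
      in_cone \<delta> a ((1 - 2 * \<epsilon>) * m) (\<lambda>x. (T ^^ n) h x - \<epsilon> * m * indicator {-1..1} x)"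
    by blast
  define \<rho> where "\<rho> = 1 - 2 * \<epsilon>"
  have \<rho>: "0 < \<rho>" "\<rho> < 1" unfolding \<rho>_def using a by auto
  \<comment> \<open>The rate per single step, as the cone contracts once in \<open>n\<close>
    steps.\<close>
  define \<sigma> where "\<sigma> = root n \<rho>"
  have \<sigma>: "0 < \<sigma>" "\<sigma> < 1" "\<sigma> ^ n = \<rho>" unfolding \<sigma>_def using \<rho> a(2) by (auto simp: real_root_pow_pos)
  \<comment> \<open>At least 1, so that the fewer than \<open>n\<close> steps left over cost at most
    \<open>T_const' ^ n\<close>.\<close>
  define T_const' where "T_const' = max 1 T_const"
  have T_const': "1 \<le> T_const'" "T_const \<le> T_const'" unfolding T_const'_def by auto
  have b1: "ufun 1 (indicator {-1..1})" by (rule ufun_indicator) auto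
  have iter: "\<exists>g1 g2. in_cone \<delta> a (\<rho> ^ k * m) g1 \<and> in_cone \<delta> a (\<rho> ^ k * m) g2 \<and>
      (\<forall>x. (T ^^ (k * n)) h1 x - (T ^^ (k * n)) h2 x = g1 x - g2 x)"
    if m: "0 \<le> m" and h: "in_cone \<delta> a m h1" "in_cone \<delta> a m h2" for m h1 h2 k
  proof (induction k)
    case 0
    then show ?case using h by auto
  next
    case (Suc k)
    let ?m = "\<rho> ^ k * m"
    obtain g1 g2 where g: "in_cone \<delta> a ?m g1" "in_cone \<delta> a ?m g2"
      and eq: "\<And>x. (T ^^ (k * n)) h1 x - (T ^^ (k * n)) h2 x = g1 x - g2 x" using Suc by blast
    have m': "0 \<le> ?m" using m \<rho> by simp
    obtain B1 B2 G1 G2 where b: "ufun B1 h1" "ufun B2 h2" "ufun G1 g1" "ufun G2 g2"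
      using h g unfolding in_cone_def by blast
    let ?f = "\<lambda>g x. (T ^^ n) g x - \<epsilon> * ?m * indicator {-1..1} x"
    have c: "in_cone \<delta> a (\<rho> ^ Suc k * m) (?f g1)" "in_cone \<delta> a (\<rho> ^ Suc k * m) (?f g2)"
      using step[OF m' g(1)] step[OF m' g(2)] unfolding \<rho>_def[symmetric] by (auto simp: mult.assoc)
    have "(T ^^ (Suc k * n)) h1 x - (T ^^ (Suc k * n)) h2 x = ?f g1 x - ?f g2 x" for x
    proof -
      have "(T ^^ (Suc k * n)) h1 x - (T ^^ (Suc k * n)) h2 x =
          (T ^^ n) ((T ^^ (k * n)) h1) x - (T ^^ n) ((T ^^ (k * n)) h2) x"
        by (simp add: funpow_add)
      also have "\<dots> = (T ^^ n) (\<lambda>x. 1 * (T ^^ (k * n)) h1 x + (-1) * (T ^^ (k * n)) h2 x) x"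
        by (subst T_pow_linear[OF ufun_pow[OF b(1)] ufun_pow[OF b(2)]]) simp
      also have "(\<lambda>x. 1 * (T ^^ (k * n)) h1 x + (-1) * (T ^^ (k * n)) h2 x) = (\<lambda>x. 1 * g1 x + (-1) * g2 x)"
        using eq by (auto simp: fun_eq_iff)
      also have "(T ^^ n) \<dots> x = (T ^^ n) g1 x - (T ^^ n) g2 x"
        by (subst T_pow_linear[OF b(3,4)]) simp
      finally show ?thesis by simp
    qed
    then show ?case using c by blast
  qed
  define M0 where "M0 = T_const' ^ n * (2 * a + 1) / \<rho>"
  have M0: "0 \<le> M0" unfolding M0_def using T_const' a \<rho> by simp
  have dec: "\<bar>(T ^^ i) h y\<bar> \<le> M0 * \<sigma> ^ i * v"
    if h: "ufun B h" and v: "wvar_le \<delta> h v" and mean: "(LINT x|lborel. h x) = 0" for B h v i y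
  proof -
    have v0: "0 \<le> v" using wvar_le_nonneg[OF v] \<delta> by simp
    let ?one = "\<lambda>x. v * indicator {-1..1} x :: real"
    let ?h = "\<lambda>x. h x + v * indicator {-1..1} x"
    have bone: "ufun v ?one" using ufun_linear[OF b1 ufun_zero, of v 0] v0 by simp
    have bh: "ufun (B + v) ?h" using ufun_linear[OF h bone, of 1 1] by simp
    have neg: "wvar_le \<delta> (\<lambda>x. - h x) v" using wvar_le_linear[OF v v, of "-1" 0] by simp
    have bneg: "ufun B (\<lambda>x. - h x)" using ufun_linear[OF h h, of "-1" 0] by simp
    have nn: "0 \<le> ?h x" for x
      using wvar_le_le_mean[OF bneg neg, of x] mean \<delta> ufunD(3)[OF h, of x] by (cases "x \<in> {-1..1}") auto
    have vone: "wvar_le \<delta> ?one 0" by (rule wvar_le_const[of _ v]) simp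
    have av: "v \<le> a * (2 * v)" "0 \<le> a * (2 * v)" using a v0 mult_right_mono[of 1 a "2 * v"] by auto
    have c1: "in_cone \<delta> a (2 * v) ?h"
      unfolding in_cone_def
    proof (intro conjI allI nn)
      show "\<exists>B. ufun B ?h" using bh by blast
      show "(LINT x|lborel. ?h x) = 2 * v" using ufunD(5)[OF h] ufunD(5)[OF bone] mean by simp
      have "wvar_le \<delta> ?h v" using wvar_le_linear[OF v vone, of 1 1] by simp
      then show "wvar_le \<delta> ?h (a * (2 * v))" using av(1) by (rule wvar_le_mono)
    qed
    have c2: "in_cone \<delta> a (2 * v) ?one"
      unfolding in_cone_def using bone v0 vone av by (auto intro: wvar_le_mono)
    define k where "k = i div n"
    define r where "r = i mod n"
    have i: "i = r + k * n" "r < n" unfolding k_def r_def using a(2) by auto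
    obtain g1 g2 where g: "in_cone \<delta> a (\<rho> ^ k * (2 * v)) g1" "in_cone \<delta> a (\<rho> ^ k * (2 * v)) g2"
      and eq: "\<And>x. (T ^^ (k * n)) ?h x - (T ^^ (k * n)) ?one x = g1 x - g2 x"
      using iter[OF _ c1 c2, of k] v0 by auto
    have hk: "(T ^^ (k * n)) h x = g1 x - g2 x" for x
      using T_pow_linear[OF h bone, of "k * n" 1 1] eq[of x] by simp
    define D where "D = \<rho> ^ k * (2 * v) * (1 / 2 + a)"
    have D0: "0 \<le> D" unfolding D_def using \<rho> v0 a by simp
    have gb: "0 \<le> g x \<and> g x \<le> D" if cg: "in_cone \<delta> a (\<rho> ^ k * (2 * v)) g" and x: "x \<in> {-1..1}" for g x
    proof -
      obtain G where G: "ufun G g" "0 \<le> g x" "(LINT x|lborel. g x) = \<rho> ^ k * (2 * v)" "wvar_le \<delta> g (a * (\<rho> ^ k * (2 * v)))"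
        using cg unfolding in_cone_def by blast
      have "g x \<le> (\<rho> ^ k * (2 * v)) / 2 + a * (\<rho> ^ k * (2 * v))"
        using wvar_le_le_mean[OF G(1,4) _ \<delta>(2) x] \<delta>(1) unfolding G(3) by simp
      also have "\<dots> = D" unfolding D_def by (simp add: algebra_simps)
      finally show ?thesis using G(2) by simp
    qed
    have "\<bar>(T ^^ r) ((T ^^ (k * n)) h) y\<bar> \<le> T_const ^ r * D"
    proof (rule T_pow_abs_bound)
      show "(T ^^ (k * n)) h \<in> borel_measurable borel" by (rule ufunD(1)[OF ufun_pow[OF h]])
      fix x show "\<bar>(T ^^ (k * n)) h x\<bar> \<le> D * indicator {-1..1} x"
        using gb[OF g(1), of x] gb[OF g(2), of x] ufunD(3)[OF ufun_pow[OF h], of x "k * n"] hk[of x]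
        by (cases "x \<in> {-1..1}") auto
    qed
    also have "T_const ^ r * D \<le> T_const' ^ n * D"
    proof (rule mult_right_mono[OF _ D0])
      have "T_const ^ r \<le> T_const' ^ r" using T_const' T_const_pos by (intro power_mono) auto
      also have "\<dots> \<le> T_const' ^ n" using T_const' i(2) by (intro power_increasing) auto
      finally show "T_const ^ r \<le> T_const' ^ n" .
    qed
    also have "\<dots> \<le> T_const' ^ n * ((\<sigma> ^ i / \<rho>) * (2 * v) * (1 / 2 + a))"
    proof -
      \<comment> \<open>Since \<open>i\<close> is below \<open>(k + 1) * n\<close>, ignoring the
        incomplete block costs only a factor \<open>1 / \<rho>\<close>.\<close>
      have "\<rho> ^ k * \<rho> = \<sigma> ^ (k * n + n)"
        unfolding \<sigma>(3)[symmetric] by (simp add: power_add power_mult[symmetric] mult.commute)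
      also have "\<dots> \<le> \<sigma> ^ i" using i \<sigma> by (intro power_decreasing) auto
      finally have "\<rho> ^ k \<le> \<sigma> ^ i / \<rho>" using \<rho> by (simp add: field_simps)
      then show ?thesis unfolding D_def using v0 a T_const' by (intro mult_left_mono mult_right_mono) auto
    qed
    also have "\<dots> = M0 * \<sigma> ^ i * v" unfolding M0_def by (simp add: algebra_simps add_divide_distrib)
    finally show ?thesis unfolding i(1) by (simp add: funpow_add)
  qed
  define M where "M = max M0 (max 1 (2 * C))"
  have M: "0 \<le> M" "M0 \<le> M" "1 \<le> M" "2 * C \<le> M" unfolding M_def by auto
  have "\<bar>(T ^^ i) h y\<bar> \<le> M * \<sigma> ^ i * v"
    if h: "ufun B h" "wvar_le \<delta> h v" "(LINT x|lborel. h x) = 0" for B h v i y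
  proof -
    have "M0 * (\<sigma> ^ i * v) \<le> M * (\<sigma> ^ i * v)"
      using M wvar_le_nonneg[OF h(2)] \<delta> \<sigma> by (intro mult_right_mono) auto
    then show ?thesis using dec[OF h, of i y] by (simp add: mult.assoc)
  qed
  moreover have "\<exists>w. wvar_le \<delta> (T h) w \<and> w \<le> M * (v + B)" if h: "ufun B h" "wvar_le \<delta> h v" for B h v
  proof (intro exI conjI)
    show "wvar_le \<delta> (T h) (\<theta> * v + C * (LINT x|lborel. \<bar>h x\<bar>))" by (rule LY[rule_format, OF h])
    have "C * (LINT x|lborel. \<bar>h x\<bar>) \<le> C * (2 * B)" by (rule mult_left_mono[OF ufun_L1_le[OF h(1)] C])
    moreover have "2 * C * B \<le> M * B" using M ufunD(4)[OF h(1)] by (intro mult_right_mono) auto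
    moreover have "\<theta> * v \<le> M * v" using M \<theta> wvar_le_nonneg[OF h(2)] \<delta> by (intro mult_right_mono) auto
    ultimately show "\<theta> * v + C * (LINT x|lborel. \<bar>h x\<bar>) \<le> M * (v + B)" by (simp add: algebra_simps)
  qed
  ultimately have "0 < \<delta> \<and> \<delta> \<le> 1 \<and> 0 \<le> M \<and> 0 < \<sigma> \<and> \<sigma> < 1 \<and>
    (\<forall>B h v i y. ufun B h \<longrightarrow> wvar_le \<delta> h v \<longrightarrow> (LINT x|lborel. h x) = 0 \<longrightarrow> \<bar>(T ^^ i) h y\<bar> \<le> M * \<sigma> ^ i * v) \<and>
    (\<forall>B h v. ufun B h \<longrightarrow> wvar_le \<delta> h v \<longrightarrow> (\<exists>w. wvar_le \<delta> (T h) w \<and> w \<le> M * (v + B)))"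
    using \<delta> \<sigma> M(1) by simp
  then show ?thesis by (intro exI)
qed

end

section \<open>The extension operator on real functions\<close>

lemma periodize_abs_le:
  assumes "quad_decay B g"
  shows "\<bar>periodize g y\<bar> \<le> periodize (\<lambda>x. \<bar>g x\<bar>) y"
proof -
  have q: "quad_decay B (\<lambda>x. \<bar>g x\<bar>)" using assms unfolding quad_decay_def by simp
  have "periodize g y \<le> periodize (\<lambda>x. \<bar>g x\<bar>) y"
    by (rule periodize_mono[OF assms q]) simp
  moreover have "periodize (\<lambda>x. -1 * g x + 0 * g x) y \<le> periodize (\<lambda>x. \<bar>g x\<bar>) y"
    by (rule periodize_mono[OF _ q]) (use assms in \<open>auto simp: quad_decay_def\<close>)
  ultimately show ?thesis using periodize_linear[OF assms assms, of "-1" 0 y] by simp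
qed

text \<open>Positivity and conservation of mass: the folded \<bar>g\<bar> is nonnegative with
  integral equal to that of \<bar>g\<bar>, hence zero, and it dominates the folded
  \<open>g\<close>.\<close>

lemma periodize_AE_zero:
  assumes m: "g \<in> borel_measurable borel" and q: "quad_decay B g" and i: "integrable lborel g"
    and z: "\<And>x. \<bar>x\<bar> < 1 \<Longrightarrow> g x = 0" and 0: "AE x in lborel. g x = 0"
  shows "AE x in lborel. periodize g x = 0"
proof -
  have q': "quad_decay B (\<lambda>x. \<bar>g x\<bar>)" using q unfolding quad_decay_def by simp
  have [measurable]: "(\<lambda>x. \<bar>g x\<bar>) \<in> borel_measurable borel" using m by simp
  have b: "ufun (2 * B * odd_sq_sum) (periodize (\<lambda>x. \<bar>g x\<bar>))" by (rule ufun_periodize[OF _ q']) simp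
  have "(LINT x|lborel. periodize (\<lambda>x. \<bar>g x\<bar>) x * 1) = (LINT x|lborel. \<bar>g x\<bar> * 1)"
    by (rule periodize_integral[where \<phi> = "\<lambda>_. 1", OF _ _ q', of 1]) (use i z in auto)
  also have "\<dots> = 0"
    by (rule integral_eq_zero_AE) (use 0 in auto)
  finally have "(LINT x|lborel. periodize (\<lambda>x. \<bar>g x\<bar>) x) = 0" by simp
  moreover have "0 \<le> periodize (\<lambda>x. \<bar>g x\<bar>) x" for x
    using periodize_abs_le[OF q, of x] by linarith
  ultimately have "AE x in lborel. periodize (\<lambda>x. \<bar>g x\<bar>) x = 0"
    by (subst (asm) integral_nonneg_eq_0_iff_AE[OF ufunD(5)[OF b]]) auto
  then show ?thesis
    by eventually_elim (use periodize_abs_le[OF q] in \<open>metis abs_le_zero_iff\<close>)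
qed

context gauss_map begin

section \<open>Data of bounded variation on \<open>outer \<beta>\<close>\<close>

text \<open>One constant bounds the supremum and the variation on either side, so that all later
  estimates are linear in \<open>V\<close>. The left interval is described by reflection.\<close>

definition outer_bv :: "real \<Rightarrow> (real \<Rightarrow> real) \<Rightarrow> bool"
  where "outer_bv V g \<longleftrightarrow> g \<in> borel_measurable borel \<and> (\<forall>x. x \<notin> outer \<beta> \<longrightarrow> g x = 0) \<and> (\<forall>x. \<bar>g x\<bar> \<le> V) \<and>
    (\<exists>F. maj {1..\<beta>} g F \<and> F \<beta> - F 1 \<le> V) \<and> (\<exists>F. maj {1..\<beta>} (\<lambda>x. g (-x)) F \<and> F \<beta> - F 1 \<le> V)"

lemma outer_iff: "x \<in> outer \<beta> \<longleftrightarrow> 1 \<le> \<bar>x\<bar> \<and> \<bar>x\<bar> \<le> \<beta>"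
  using beta_gt_1 unfolding outer_def by auto

lemma outer_bvD:
  assumes "outer_bv V g"
  shows "g \<in> borel_measurable borel" "x \<notin> outer \<beta> \<Longrightarrow> g x = 0" "\<bar>g x\<bar> \<le> V" "0 \<le> V" "integrable lborel g"
    "\<bar>x\<bar> < 1 \<Longrightarrow> g x = 0" "\<beta> < \<bar>x\<bar> \<Longrightarrow> g x = 0"
proof -
  show [measurable]: "g \<in> borel_measurable borel" using assms unfolding outer_bv_def by blast
  show z: "x \<notin> outer \<beta> \<Longrightarrow> g x = 0" for x using assms unfolding outer_bv_def by blast
  show b: "\<bar>g x\<bar> \<le> V" for x using assms unfolding outer_bv_def by blast
  show V: "0 \<le> V" using b[of 0] by linarith
  show "\<bar>x\<bar> < 1 \<Longrightarrow> g x = 0" "\<beta> < \<bar>x\<bar> \<Longrightarrow> g x = 0" using z[of x] outer_iff[of x] by auto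
  show "integrable lborel g"
  proof (rule Bochner_Integration.integrable_bound[of _ "\<lambda>x. V * indicator {-\<beta>..\<beta>} x"])
    show "integrable lborel (\<lambda>x. V * indicator {-\<beta>..\<beta>} x)"
      using beta_pos by (intro integrable_mult_right integrable_real_indicator) auto
    show "AE x in lborel. norm (g x) \<le> norm (V * indicat_real {-\<beta>..\<beta>} x)"
    proof (rule AE_I2)
      fix x show "norm (g x) \<le> norm (V * indicat_real {-\<beta>..\<beta>} x)"
        using b[of x] V z[of x] outer_iff[of x] by (cases "x \<in> {-\<beta>..\<beta>}") auto
    qed
  qed simp
qed

lemma outer_bv_decay: assumes "outer_bv V g" shows "quad_decay (\<beta>\<^sup>2 * V) g"
  unfolding quad_decay_def
proof (intro allI impI)
  fix y :: real assume y: "1 \<le> \<bar>y\<bar>"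
  show "\<bar>g y\<bar> \<le> \<beta>\<^sup>2 * V / y\<^sup>2"
  proof (cases "\<bar>y\<bar> \<le> \<beta>")
    case True
    have "y\<^sup>2 \<le> \<beta>\<^sup>2" using True beta_pos by (simp add: abs_le_square_iff[symmetric])
    then have "1 * V \<le> \<beta>\<^sup>2 / y\<^sup>2 * V" using y outer_bvD(4)[OF assms] by (intro mult_right_mono) auto
    then show ?thesis using outer_bvD(3)[OF assms, of y] by simp
  next
    case False
    then show ?thesis using outer_bvD(7)[OF assms, of y] outer_bvD(4)[OF assms] by simp
  qed
qed

lemma outer_bv_reflect: "outer_bv V g \<Longrightarrow> outer_bv V (\<lambda>x. g (-x))"
  unfolding outer_bv_def by (auto simp: outer_iff)

lemma outer_bv_linear:
  assumes "outer_bv V g" "outer_bv V' g'"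
  shows "outer_bv (\<bar>a\<bar> * V + \<bar>b\<bar> * V') (\<lambda>x. a * g x + b * g' x)"
proof -
  have lin: "\<exists>F. maj {1..\<beta>} (\<lambda>x. a * g x + b * g' x) F \<and> F \<beta> - F 1 \<le> \<bar>a\<bar> * V + \<bar>b\<bar> * V'"
    if "outer_bv V g" "outer_bv V' g'" for g g'
  proof -
    obtain F F' where F: "maj {1..\<beta>} g F" "F \<beta> - F 1 \<le> V" "maj {1..\<beta>} g' F'" "F' \<beta> - F' 1 \<le> V'"
      using \<open>outer_bv V g\<close> \<open>outer_bv V' g'\<close> unfolding outer_bv_def by blast
    have "\<bar>a\<bar> * (F \<beta> - F 1) + \<bar>b\<bar> * (F' \<beta> - F' 1) \<le> \<bar>a\<bar> * V + \<bar>b\<bar> * V'"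
      using F by (intro add_mono mult_left_mono) auto
    then show ?thesis using maj_linear[OF F(1,3), of a b]
      by (intro exI[of _ "\<lambda>x. \<bar>a\<bar> * F x + \<bar>b\<bar> * F' x"]) (auto simp: algebra_simps)
  qed
  have [measurable]: "g \<in> borel_measurable borel" "g' \<in> borel_measurable borel"
    using outer_bvD(1) assms by auto
  have "\<bar>a * g x + b * g' x\<bar> \<le> \<bar>a\<bar> * V + \<bar>b\<bar> * V'" for x
  proof -
    have "\<bar>a * g x + b * g' x\<bar> \<le> \<bar>a\<bar> * \<bar>g x\<bar> + \<bar>b\<bar> * \<bar>g' x\<bar>" by (metis abs_mult abs_triangle_ineq)
    also have "\<dots> \<le> \<bar>a\<bar> * V + \<bar>b\<bar> * V'"
      using outer_bvD(3)[OF assms(1)] outer_bvD(3)[OF assms(2)] by (intro add_mono mult_left_mono) auto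
    finally show ?thesis .
  qed
  then show ?thesis
    unfolding outer_bv_def
    using lin[OF assms] lin[OF assms[THEN outer_bv_reflect]] outer_bvD(2)[OF assms(1)] outer_bvD(2)[OF assms(2)] by auto
qed

lemma maj_J_outer:
  assumes g: "outer_bv V g" and F: "maj {1..\<beta>} g F" "F \<beta> - F 1 \<le> V"
  shows "\<exists>F. maj {1..\<beta>} (J g) F \<and> F \<beta> - F 1 \<le> 2 * \<beta> * V"
proof -
  have V: "0 \<le> V" by (rule outer_bvD(4)[OF g])
  \<comment> \<open>The product rule for \<open>x\<^sup>2 * g x\<close> on [1,\<beta>], where the
    square is at most \<open>\<beta>\<^sup>2\<close> and \<bar>g\<bar> at most \<open>V\<close>. The
    sign in \<open>F'\<close> compensates for the reversal of order by the inversion.\<close>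
  define H where "H = (\<lambda>x. \<beta>\<^sup>2 * F x + V * x\<^sup>2)"
  define F' where "F' = (\<lambda>y. - (H (\<beta> / y) / \<beta>))"
  have "maj {1..\<beta>} (J g) F'"
    unfolding maj_def
  proof (intro ballI impI)
    fix y z assume yz: "y \<in> {1..\<beta>}" "z \<in> {1..\<beta>}" "y \<le> z"
    define a where "a = \<beta> / z"
    define b where "b = \<beta> / y"
    have ab: "1 \<le> a" "a \<le> b" "b \<le> \<beta>"
      unfolding a_def b_def using yz beta_pos by (auto simp: field_simps)
    have sq: "a\<^sup>2 \<le> b\<^sup>2" "b\<^sup>2 \<le> \<beta>\<^sup>2" using ab by (auto intro!: power_mono)
    have J: "J g y = b\<^sup>2 * g b / \<beta>" "J g z = a\<^sup>2 * g a / \<beta>"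
      unfolding J_def a_def b_def using yz beta_pos by (auto simp: power2_eq_square field_simps)
    have "b\<^sup>2 * g b - a\<^sup>2 * g a = b\<^sup>2 * (g b - g a) + (b\<^sup>2 - a\<^sup>2) * g a" by (simp add: algebra_simps)
    then have "\<bar>b\<^sup>2 * g b - a\<^sup>2 * g a\<bar> \<le> b\<^sup>2 * \<bar>g b - g a\<bar> + \<bar>b\<^sup>2 - a\<^sup>2\<bar> * \<bar>g a\<bar>"
      by (metis abs_triangle_ineq abs_mult abs_power2)
    also have "\<dots> \<le> \<beta>\<^sup>2 * (F b - F a) + (b\<^sup>2 - a\<^sup>2) * V"
      using sq majD[OF F(1), of a b] ab outer_bvD(3)[OF g, of a] by (intro add_mono mult_mono) auto
    also have "\<dots> = H b - H a" unfolding H_def by (simp add: algebra_simps)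
    finally have "\<bar>b\<^sup>2 * g b - a\<^sup>2 * g a\<bar> / \<beta> \<le> (H b - H a) / \<beta>"
      using beta_pos by (intro divide_right_mono) auto
    moreover have "\<bar>J g z - J g y\<bar> = \<bar>b\<^sup>2 * g b - a\<^sup>2 * g a\<bar> / \<beta>"
      unfolding J using beta_pos by (simp add: diff_divide_distrib[symmetric] abs_minus_commute)
    ultimately show "\<bar>J g z - J g y\<bar> \<le> F' z - F' y"
      unfolding F'_def a_def b_def by (simp add: diff_divide_distrib)
  qed
  moreover have "F' \<beta> - F' 1 \<le> 2 * \<beta> * V"
  proof -
    have "F' \<beta> - F' 1 = (H \<beta> - H 1) / \<beta>" unfolding F'_def using beta_pos by (simp add: diff_divide_distrib)
    also have "\<dots> \<le> (\<beta>\<^sup>2 * V + V * \<beta>\<^sup>2) / \<beta>"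
    proof (rule divide_right_mono)
      have "\<beta>\<^sup>2 * (F \<beta> - F 1) \<le> \<beta>\<^sup>2 * V" using F(2) by (intro mult_left_mono) auto
      then show "H \<beta> - H 1 \<le> \<beta>\<^sup>2 * V + V * \<beta>\<^sup>2" unfolding H_def using V by (simp add: algebra_simps)
    qed (use beta_pos in simp)
    also have "\<dots> = 2 * \<beta> * V" using beta_pos by (simp add: power2_eq_square field_simps)
    finally show ?thesis .
  qed
  ultimately show ?thesis by blast
qed

lemma outer_bv_J: assumes g: "outer_bv V g" shows "outer_bv (2 * \<beta> * V) (J g)"
proof -
  have V: "0 \<le> V" by (rule outer_bvD(4)[OF g])
  have zero: "J g x = 0" if "x \<notin> outer \<beta>" for x
  proof (cases "x = 0")
    case False
    then have "\<bar>\<beta> / x\<bar> < 1 \<or> \<beta> < \<bar>\<beta> / x\<bar>"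
      using that beta_pos by (auto simp: outer_iff abs_div field_simps)
    then show ?thesis using outer_bvD(6,7)[OF g, of "\<beta> / x"] unfolding J_def by auto
  qed (simp add: J_def)
  have bd: "\<bar>J g x\<bar> \<le> 2 * \<beta> * V" for x
  proof (cases "x \<in> outer \<beta>")
    case False
    then show ?thesis using zero V beta_pos by simp
  next
    case True
    then have "1 \<le> x\<^sup>2" by (simp add: outer_iff abs_le_square_iff[of 1 x, simplified])
    then have "\<beta> / x\<^sup>2 \<le> \<beta>" using divide_left_mono[of 1 "x\<^sup>2" \<beta>] beta_pos by (cases "x = 0") auto
    then have "\<beta> / x\<^sup>2 * \<bar>g (\<beta> / x)\<bar> \<le> \<beta> * V"
      using beta_pos outer_bvD(3)[OF g, of "\<beta> / x"] by (intro mult_mono) auto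
    also have "\<dots> \<le> 2 * \<beta> * V" using beta_pos V by simp
    finally show ?thesis unfolding J_def using beta_pos by (simp add: abs_mult)
  qed
  have "\<exists>F. maj {1..\<beta>} (J g) F \<and> F \<beta> - F 1 \<le> 2 * \<beta> * V" if "outer_bv V g" for g
    using maj_J_outer[OF that] that unfolding outer_bv_def by blast
  from this[OF g] this[OF outer_bv_reflect[OF g]]
  show ?thesis
    using J_measurable[OF outer_bvD(1)[OF g]] zero bd
    unfolding outer_bv_def J_reflect by blast
qed

lemma outer_bv_fold:
  assumes g: "outer_bv V g" and \<delta>: "0 \<le> \<delta>" "\<delta> \<le> 1"
  shows "\<exists>F. maj {-1..1} (fold_sum g) F \<and> wvar \<delta> F \<le> 4 * V"
proof -
  have V: "0 \<le> V" by (rule outer_bvD(4)[OF g])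
  obtain F where F: "maj {1..\<beta>} g F" "F \<beta> - F 1 \<le> V" using g unfolding outer_bv_def by blast
  \<comment> \<open>Beyond \<beta> the function is 0, so the majorant needs a jump there, at most
    \<open>V\<close> in size. The total becomes \<open>2 * V\<close>, and
    \<open>fold_sum_maj\<close> doubles it.\<close>
  define G where "G = (\<lambda>y. if y \<le> \<beta> then F y - F 1 else F \<beta> - F 1 + V)"
  have "maj {1..} g G"
    unfolding maj_def
  proof (intro ballI impI)
    fix x y :: real assume xy: "x \<in> {1..}" "y \<in> {1..}" "x \<le> y"
    consider "y \<le> \<beta>" | "x \<le> \<beta>" "\<beta> < y" | "\<beta> < x" by linarith
    then show "\<bar>g y - g x\<bar> \<le> G y - G x"
    proof cases
      case 1
      then show ?thesis using majD[OF F(1), of x y] xy by (simp add: G_def)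
    next
      case 2
      then show ?thesis using outer_bvD(7)[OF g, of y] outer_bvD(3)[OF g, of x] maj_mono[OF F(1), of x \<beta>] xy by (simp add: G_def)
    next
      case 3
      then show ?thesis using outer_bvD(7)[OF g, of y] outer_bvD(7)[OF g, of x] xy by (simp add: G_def)
    qed
  qed
  moreover have "G y \<le> 2 * V" if "1 \<le> y" for y
    using F(2) V maj_mono[OF F(1), of y \<beta>] that unfolding G_def by auto
  moreover have "G 1 = 0" using beta_gt_1 by (simp add: G_def)
  ultimately show ?thesis using fold_sum_maj[OF _ outer_bv_decay[OF g], of G "2 * V" \<delta>] \<delta> by auto
qed

definition fold_const where "fold_const = 2 * \<beta>\<^sup>2 * odd_sq_sum"

lemma fold_const_nonneg: "0 \<le> fold_const" unfolding fold_const_def using odd_sq_sum_pos by simp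

lemma outer_bv_periodize:
  assumes g: "outer_bv V g" and \<delta>: "0 \<le> \<delta>" "\<delta> \<le> 1"
  shows "ufun (fold_const * V) (periodize g)" "wvar_le \<delta> (periodize g) (8 * V)"
proof -
  show "ufun (fold_const * V) (periodize g)"
    using ufun_periodize[OF outer_bvD(1)[OF g] outer_bv_decay[OF g]] by (simp add: fold_const_def mult_ac)
  obtain F1 F2 where "maj {-1..1} (fold_sum g) F1" "wvar \<delta> F1 \<le> 4 * V"
    "maj {-1..1} (fold_sum (\<lambda>x. g (-x))) F2" "wvar \<delta> F2 \<le> 4 * V"
    using outer_bv_fold[OF g \<delta>] outer_bv_fold[OF outer_bv_reflect[OF g] \<delta>] by blast
  then show "wvar_le \<delta> (periodize g) (8 * V)" using periodize_maj[of g F1 F2 \<delta> "4 * V" "4 * V"] by simp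
qed

lemma periodize_integral':
  assumes g: "outer_bv V g" and "\<phi> \<in> borel_measurable borel" "\<And>x. \<bar>\<phi> x\<bar> \<le> M" "\<And>x. \<phi> (x + 2) = \<phi> x"
  shows "(LINT y|lborel. periodize g y * \<phi> y) = (LINT y|lborel. g y * \<phi> y)"
  by (rule periodize_integral[OF outer_bvD(1)[OF g] assms(2) outer_bv_decay[OF g] outer_bvD(5)[OF g] outer_bvD(6)[OF g] assms(3,4)])

section \<open>The Neumann series and the extension operator\<close>

definition src :: "(real \<Rightarrow> real) \<Rightarrow> real \<Rightarrow> real"
  where "src g x = T (periodize (J g)) x - periodize g x"

text \<open>
  In the notation of the introduction, \<open>src g\<close> is \<open>p - T q\<close>, \<open>mid_part g\<close> is \<open>u\<close>, and \<open>far_part g\<close> is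
  \<open>v\<close>. The latter must be defined as \<open>q - T u\<close>: the series for \<open>(1 - T\<^sup>2) v = q - T p\<close> converges as
  well, but differs from it by a multiple of the invariant density.
\<close>

definition mid_part :: "(real \<Rightarrow> real) \<Rightarrow> real \<Rightarrow> real"
  where "mid_part g x = (\<Sum>k. (T ^^ (2 * k)) (src g) x)"

definition far_part :: "(real \<Rightarrow> real) \<Rightarrow> real \<Rightarrow> real"
  where "far_part g x = - periodize (J g) x - T (mid_part g) x"

definition ext_op :: "(real \<Rightarrow> real) \<Rightarrow> real \<Rightarrow> real"
  where "ext_op g x = g x + mid_part g x + J (far_part g) x"

text \<open>The source has mean zero: \<open>T\<close>, \<open>periodize\<close> and
  \<open>J\<close> preserve the integrals involved, so what remains is the integral of
  \<open>J g\<close> minus that of \<open>g\<close>. Then \<open>decay\<close> applies.\<close>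

lemma src_decay:
  "\<exists>M \<sigma>. 0 \<le> M \<and> 0 < \<sigma> \<and> \<sigma> < 1 \<and>
    (\<forall>V g. outer_bv V g \<longrightarrow> (\<exists>B. ufun B (src g)) \<and> (\<forall>i y. \<bar>(T ^^ i) (src g) y\<bar> \<le> M * V * \<sigma> ^ i))"
proof -
  from decay obtain \<delta> M \<sigma> where c: "0 < \<delta> \<and> \<delta> \<le> 1 \<and> 0 \<le> M \<and> 0 < \<sigma> \<and> \<sigma> < 1 \<and>
    (\<forall>B h v i y. ufun B h \<longrightarrow> wvar_le \<delta> h v \<longrightarrow> (LINT x|lborel. h x) = 0 \<longrightarrow> \<bar>(T ^^ i) h y\<bar> \<le> M * \<sigma> ^ i * v) \<and>
    (\<forall>B h v. ufun B h \<longrightarrow> wvar_le \<delta> h v \<longrightarrow> (\<exists>w. wvar_le \<delta> (T h) w \<and> w \<le> M * (v + B)))" by (elim exE)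
  then have \<delta>: "0 \<le> \<delta>" "\<delta> \<le> 1" and M: "0 \<le> M" and \<sigma>: "0 < \<sigma>" "\<sigma> < 1" by simp_all
  from c have dec: "\<And>B h v i y. ufun B h \<Longrightarrow> wvar_le \<delta> h v \<Longrightarrow> (LINT x|lborel. h x) = 0 \<Longrightarrow> \<bar>(T ^^ i) h y\<bar> \<le> M * \<sigma> ^ i * v"
    by simp
  from c have TN: "\<And>B h v. ufun B h \<Longrightarrow> wvar_le \<delta> h v \<Longrightarrow> wvar_le \<delta> (T h) (M * (v + B))"
    by (meson wvar_le_mono)
  \<comment> \<open>Variation of \<open>src g\<close> per unit of \<open>V\<close>: \<open>M\<close>
    times the variation and supremum bounds of \<open>periodize (J g)\<close>, where
    \<open>2 * \<beta>\<close> is the cost of \<open>J\<close>, and 8 for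
    \<open>periodize g\<close>.\<close>
  define c where "c = M * (8 * (2 * \<beta>) + fold_const * (2 * \<beta>)) + 8"
  have c0: "0 \<le> c" unfolding c_def using M fold_const_nonneg beta_pos by simp
  have "(\<exists>B. ufun B (src g)) \<and> (\<forall>i y. \<bar>(T ^^ i) (src g) y\<bar> \<le> (M * c) * V * \<sigma> ^ i)" if g: "outer_bv V g" for V g
  proof -
    note p = outer_bv_periodize[OF g \<delta>] and q = outer_bv_periodize[OF outer_bv_J[OF g] \<delta>]
    have eq: "src g = (\<lambda>x. 1 * T (periodize (J g)) x + (-1) * periodize g x)"
      by (auto simp: src_def)
    obtain B where B: "ufun B (src g)"
      unfolding eq using ufun_linear[OF ufun_T[OF q(1)] p(1)] by blast
    have N: "wvar_le \<delta> (src g) (c * V)"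
      unfolding eq using wvar_le_linear[OF TN[OF q] p(2), of 1 "-1"] by (simp add: c_def algebra_simps)
    have "(LINT x|lborel. src g x) = (LINT x|lborel. T (periodize (J g)) x) - (LINT x|lborel. periodize g x)"
      unfolding src_def by (intro Bochner_Integration.integral_diff ufunD(5)[OF ufun_T[OF q(1)]] ufunD(5)[OF p(1)])
    also have "\<dots> = (LINT x|lborel. J g x) - (LINT x|lborel. g x)"
      using periodize_integral'[OF g, of "\<lambda>_. 1" 1] periodize_integral'[OF outer_bv_J[OF g], of "\<lambda>_. 1" 1] T_integral_1[OF q(1)]
      by simp
    also have "\<dots> = 0" using J_integral(2)[OF outer_bvD(5)[OF g]] by simp
    finally show ?thesis using B dec[OF B N] by (auto simp: mult_ac)
  qed
  then have "0 \<le> M * c \<and> 0 < \<sigma> \<and> \<sigma> < 1 \<and>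
    (\<forall>V g. outer_bv V g \<longrightarrow> (\<exists>B. ufun B (src g)) \<and> (\<forall>i y. \<bar>(T ^^ i) (src g) y\<bar> \<le> (M * c) * V * \<sigma> ^ i))"
    using M c0 \<sigma> by simp
  then show ?thesis by (intro exI)
qed

lemma ufunI_sup: "ufun B' h \<Longrightarrow> (\<And>x. \<bar>h x\<bar> \<le> B) \<Longrightarrow> ufun B h"
  unfolding ufun_def
proof (intro conjI allI)
  fix x assume a: "h \<in> borel_measurable borel \<and> (\<forall>x. \<bar>h x\<bar> \<le> B' * indicator {-1..1} x)" and b: "\<And>x. \<bar>h x\<bar> \<le> B"
  show "\<bar>h x\<bar> \<le> B * indicator {-1..1} x"
  proof (cases "x \<in> {-1..1}")
    case False
    have "\<bar>h x\<bar> \<le> B' * indicator {-1..1} x" using a by blast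
    then show ?thesis using False by simp
  qed (use b[of x] in simp)
qed simp

lemma ufun_suminf:
  assumes u: "\<And>k. ufun (b k) (u k)" and b: "summable b"
  shows "ufun (\<Sum>k. b k) (\<lambda>x. \<Sum>k. u k x)"
  unfolding ufun_def
proof (intro conjI allI)
  have [measurable]: "u k \<in> borel_measurable borel" for k by (rule ufunD(1)[OF u])
  show "(\<lambda>x. \<Sum>k. u k x) \<in> borel_measurable borel" by measurable
  fix x
  have s: "summable (\<lambda>k. \<bar>u k x\<bar>)" by (rule summable_comparison_test'[OF b]) (use ufunD(2)[OF u] in auto)
  show "\<bar>\<Sum>k. u k x\<bar> \<le> (\<Sum>k. b k) * indicator {-1..1} x"
  proof (cases "x \<in> {-1..1}")
    case True
    have "\<bar>\<Sum>k. u k x\<bar> \<le> (\<Sum>k. \<bar>u k x\<bar>)" by (rule summable_rabs[OF s])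
    also have "\<dots> \<le> (\<Sum>k. b k)" by (intro suminf_le s b ufunD(2)[OF u])
    finally show ?thesis using True by simp
  next
    case False
    then show ?thesis using ufunD(3)[OF u False] by simp
  qed
qed

text \<open>Continuity of \<open>T\<close> under uniform convergence: the remainder of the series is
  bounded by the tail of \<open>b\<close>, and \<open>T\<close> enlarges this bound at most by
  \<open>T_const\<close>.\<close>

lemma T_suminf:
  assumes u: "\<And>k. ufun (b k) (u k)" and b: "summable b"
  shows "T (\<lambda>x. \<Sum>k. u k x) y = (\<Sum>k. T (u k) y)"
proof -
  let ?f = "\<lambda>x. \<Sum>k. u k x"
  have bf: "ufun (\<Sum>k. b k) ?f" by (rule ufun_suminf[OF u b])
  have fin: "ufun (\<Sum>k<n. b k) (\<lambda>x. \<Sum>k<n. u k x) \<and> T (\<lambda>x. \<Sum>k<n. u k x) = (\<lambda>y. \<Sum>k<n. T (u k) y)" for n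
  proof (induction n)
    case 0
    then show ?case by (simp add: ufun_zero T_zero)
  next
    case (Suc n)
    then show ?case
      using ufun_linear[of "\<Sum>k<n. b k" "\<lambda>x. \<Sum>k<n. u k x" "b n" "u n" 1 1] u[of n]
        T_linear[of "\<Sum>k<n. b k" "\<lambda>x. \<Sum>k<n. u k x" "b n" "u n" 1 1] by (simp add: fun_eq_iff)
  qed
  have su: "summable (\<lambda>k. u k x)" for x
    by (rule summable_comparison_test'[OF b]) (use ufunD(2)[OF u] in auto)
  have diff: "\<bar>T ?f y - (\<Sum>k<n. T (u k) y)\<bar> \<le> T_const * ((\<Sum>k. b k) - (\<Sum>k<n. b k))" for n
  proof -
    have "ufun (\<Sum>k. b (k + n)) (\<lambda>x. \<Sum>k. u (k + n) x)"
      by (rule ufun_suminf[OF u]) (use b in \<open>simp add: summable_iff_shift\<close>)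
    moreover have "(\<lambda>x. \<Sum>k. u (k + n) x) = (\<lambda>x. 1 * ?f x + (-1) * (\<Sum>k<n. u k x))"
      by (rule ext) (simp add: suminf_minus_initial_segment[OF su])
    moreover have "(\<Sum>k. b (k + n)) = (\<Sum>k. b k) - (\<Sum>k<n. b k)"
      by (rule suminf_minus_initial_segment[OF b])
    ultimately have "ufun ((\<Sum>k. b k) - (\<Sum>k<n. b k)) (\<lambda>x. 1 * ?f x + (-1) * (\<Sum>k<n. u k x))" by simp
    from ufunD(2)[OF ufun_T[OF this], of y]
    show ?thesis using T_linear[OF bf, of "\<Sum>k<n. b k" "\<lambda>x. \<Sum>k<n. u k x" 1 "-1"] fin[of n] by simp
  qed
  have "(\<lambda>n. T_const * ((\<Sum>k. b k) - (\<Sum>k<n. b k))) \<longlonglongrightarrow> T_const * ((\<Sum>k. b k) - (\<Sum>k. b k))"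
    by (intro tendsto_intros summable_LIMSEQ[OF b])
  then have z: "(\<lambda>n. T_const * ((\<Sum>k. b k) - (\<Sum>k<n. b k))) \<longlonglongrightarrow> 0" by simp
  have "(\<lambda>n. T ?f y - (\<Sum>k<n. T (u k) y)) \<longlonglongrightarrow> 0"
    by (rule Lim_null_comparison[OF _ z]) (use diff in simp)
  from tendsto_diff[OF tendsto_const[of "T ?f y"] this]
  have "(\<lambda>n. \<Sum>k<n. T (u k) y) \<longlonglongrightarrow> T ?f y" by simp
  then show ?thesis by (simp add: sums_def[symmetric] sums_iff)
qed

text \<open>Splitting off the first term of the series yields the fixed point equation for
  \<open>mid_part\<close>, on which orthogonality rests.\<close>

lemma ext_op_structure:
  "\<exists>C. 0 \<le> C \<and> (\<forall>V g. outer_bv V g \<longrightarrow> ufun (C * V) (mid_part g) \<and> ufun (C * V) (far_part g) \<and>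
      mid_part g = (\<lambda>x. src g x + T (T (mid_part g)) x) \<and> (\<forall>x. summable (\<lambda>k. (T ^^ (2 * k)) (src g) x)))"
proof -
  from src_decay obtain M \<sigma> where c: "0 \<le> M \<and> 0 < \<sigma> \<and> \<sigma> < 1 \<and>
    (\<forall>V g. outer_bv V g \<longrightarrow> (\<exists>B. ufun B (src g)) \<and> (\<forall>i y. \<bar>(T ^^ i) (src g) y\<bar> \<le> M * V * \<sigma> ^ i))"
    by (elim exE)
  then have M: "0 \<le> M" and \<sigma>: "0 < \<sigma>" "\<sigma> < 1" by simp_all
  define S where "S = (\<Sum>k. \<sigma> ^ (2 * k))"
  have sS: "summable (\<lambda>k. \<sigma> ^ (2 * k))"
    unfolding power_mult using \<sigma> by (intro summable_geometric) (simp add: power_less_one_iff)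
  have S0: "0 \<le> S" unfolding S_def using \<sigma> by (intro suminf_nonneg sS) auto
  define C where "C = M * S + (fold_const * (2 * \<beta>) + T_const * (M * S))"
  have p: "0 \<le> M * S" "0 \<le> fold_const * (2 * \<beta>) + T_const * (M * S)" using M S0 fold_const_nonneg beta_pos T_const_pos by auto
  have C: "0 \<le> C" "M * S \<le> C" "fold_const * (2 * \<beta>) + T_const * (M * S) \<le> C" unfolding C_def using p by auto
  have "ufun (C * V) (mid_part g) \<and> ufun (C * V) (far_part g) \<and>
      mid_part g = (\<lambda>x. src g x + T (T (mid_part g)) x) \<and> (\<forall>x. summable (\<lambda>k. (T ^^ (2 * k)) (src g) x))"
    if g: "outer_bv V g" for V g
  proof -
    have V: "0 \<le> V" by (rule outer_bvD(4)[OF g])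
    obtain B where B: "ufun B (src g)" and d: "\<And>i y. \<bar>(T ^^ i) (src g) y\<bar> \<le> M * V * \<sigma> ^ i"
      using c g by blast
    \<comment> \<open>\<open>i = 0\<close> serves the series itself and \<open>i = 1\<close> its
      image under \<open>T\<close>.\<close>
    define b where "b = (\<lambda>i k. M * V * \<sigma> ^ i * \<sigma> ^ (2 * k))"
    have bu: "ufun (b i k) ((T ^^ (2 * k + i)) (src g))" for i k
      by (rule ufunI_sup[OF ufun_pow[OF B]]) (use d[of "2 * k + i"] in \<open>simp add: b_def power_add mult_ac\<close>)
    have sb: "summable (b i)" for i unfolding b_def by (intro summable_mult sS)
    have sumb: "(\<Sum>k. b 0 k) = M * S * V" unfolding b_def S_def using suminf_mult[OF sS, of "M * V"] by (simp add: mult_ac)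
    have bi: "ufun (M * S * V) (mid_part g)"
      using ufun_suminf[OF bu[of 0] sb] sumb unfolding mid_part_def[abs_def] by simp
    have T1: "T (mid_part g) = (\<lambda>x. \<Sum>k. (T ^^ (2 * k + 1)) (src g) x)"
      using T_suminf[OF bu[of 0] sb] unfolding mid_part_def[abs_def] by (simp add: fun_eq_iff)
    have T2: "T (T (mid_part g)) = (\<lambda>x. \<Sum>k. (T ^^ (2 * Suc k)) (src g) x)"
      using T_suminf[OF bu[of 1] sb] unfolding T1 by (simp add: fun_eq_iff)
    have sm: "summable (\<lambda>k. (T ^^ (2 * k)) (src g) x)" for x
      by (rule summable_comparison_test'[OF sb[of 0]]) (use ufunD(2)[OF bu[of 0]] in auto)
    have eq: "mid_part g x = src g x + T (T (mid_part g)) x" for x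
      unfolding T2 using suminf_split_head[OF sm, of x] by (simp add: mid_part_def)
    have q: "ufun (fold_const * (2 * \<beta> * V)) (periodize (J g))"
      by (rule outer_bv_periodize(1)[OF outer_bv_J[OF g], of 0]) auto
    have bt: "ufun (fold_const * (2 * \<beta> * V) + T_const * (M * S * V)) (far_part g)"
      using ufun_linear[OF q ufun_T[OF bi], of "-1" "-1"] unfolding far_part_def[abs_def] by simp
    have le: "M * S * V \<le> C * V" "fold_const * (2 * \<beta> * V) + T_const * (M * S * V) \<le> C * V"
      using mult_right_mono[OF C(2) V] mult_right_mono[OF C(3) V] by (auto simp: algebra_simps)
    have "ufun (C * V) (mid_part g)" "ufun (C * V) (far_part g)"
      using ufunI_sup[OF bi, of "C * V"] ufunI_sup[OF bt, of "C * V"] ufunD(2)[OF bi] ufunD(2)[OF bt] le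
      by (meson order_trans)+
    then show ?thesis using eq sm by auto
  qed
  then show ?thesis using C(1) by blast
qed

lemma ext_op_bound:
  "\<exists>C. 0 \<le> C \<and> (\<forall>V g. outer_bv V g \<longrightarrow> integrable lborel (ext_op g) \<and> (LINT x|lborel. \<bar>ext_op g x\<bar>) \<le> C * V)"
proof -
  from ext_op_structure obtain C where "0 \<le> C \<and> (\<forall>V g. outer_bv V g \<longrightarrow> ufun (C * V) (mid_part g) \<and> ufun (C * V) (far_part g) \<and>
      mid_part g = (\<lambda>x. src g x + T (T (mid_part g)) x) \<and> (\<forall>x. summable (\<lambda>k. (T ^^ (2 * k)) (src g) x)))"
    by (elim exE)
  then have C: "0 \<le> C" "\<And>V g. outer_bv V g \<Longrightarrow> ufun (C * V) (mid_part g)" "\<And>V g. outer_bv V g \<Longrightarrow> ufun (C * V) (far_part g)"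
    by simp_all
  have "integrable lborel (ext_op g) \<and> (LINT x|lborel. \<bar>ext_op g x\<bar>) \<le> (2 * \<beta> + 2 * C + 2 * C) * V" if g: "outer_bv V g" for V g
  proof -
    note ii = ufunD(5)[OF C(2)[OF g]] and it = ufunD(5)[OF C(3)[OF g]] and ig = outer_bvD(5)[OF g]
    have ia: "integrable lborel (\<lambda>x. \<bar>far_part g x\<bar>)" using it by simp
    have iJ: "integrable lborel (J (far_part g))" by (rule J_integral(1)[OF it])
    have int: "integrable lborel (ext_op g)" unfolding ext_op_def[abs_def] using ii iJ ig by simp
    have Jt: "(LINT x|lborel. \<bar>J (far_part g) x\<bar>) = (LINT x|lborel. \<bar>far_part g x\<bar>)"
    proof -
      have "(\<lambda>x. \<bar>J (far_part g) x\<bar>) = J (\<lambda>x. \<bar>far_part g x\<bar>)" unfolding J_def using beta_pos by (auto simp: abs_mult)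
      then show ?thesis using J_integral(2)[OF ia] by simp
    qed
    have gb: "(LINT x|lborel. \<bar>g x\<bar>) \<le> 2 * \<beta> * V"
    proof -
      have "(LINT x|lborel. \<bar>g x\<bar>) \<le> (LINT x|lborel. V * indicator {-\<beta>..\<beta>} x)"
      proof (rule integral_mono)
        show "integrable lborel (\<lambda>x. V * indicator {-\<beta>..\<beta>} x)"
          using beta_pos by (intro integrable_mult_right integrable_real_indicator) auto
        fix x show "\<bar>g x\<bar> \<le> V * indicator {-\<beta>..\<beta>} x"
          using outer_bvD(3)[OF g, of x] outer_bvD(7)[OF g, of x] by (cases "x \<in> {-\<beta>..\<beta>}") auto
      qed (use ig in simp)
      then show ?thesis using beta_pos by (simp add: mult_ac)
    qed
    have "(LINT x|lborel. \<bar>ext_op g x\<bar>) \<le> (LINT x|lborel. \<bar>g x\<bar> + \<bar>mid_part g x\<bar> + \<bar>J (far_part g) x\<bar>)"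
      by (rule integral_mono) (use int ig ii iJ in \<open>auto simp: ext_op_def\<close>)
    also have "\<dots> = (LINT x|lborel. \<bar>g x\<bar>) + (LINT x|lborel. \<bar>mid_part g x\<bar>) + (LINT x|lborel. \<bar>J (far_part g) x\<bar>)"
      using ig ii iJ by simp
    also have "\<dots> \<le> 2 * \<beta> * V + 2 * (C * V) + 2 * (C * V)"
      unfolding Jt by (intro add_mono gb ufun_L1_le C g)
    finally show ?thesis using int by (simp add: algebra_simps)
  qed
  moreover have "0 \<le> 2 * \<beta> + 2 * C + 2 * C" using C beta_pos by simp
  ultimately show ?thesis by blast
qed

text \<open>The middle part is supported in [-1,1] and the far part in \<bar>x\<bar> \<ge> \<beta>.
  Both may add values at the common endpoints, hence the strict inequalities.\<close>

lemma ext_op_on_outer: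
  assumes g: "outer_bv V g" and x: "1 < \<bar>x\<bar>" "\<bar>x\<bar> < \<beta>"
  shows "ext_op g x = g x"
proof -
  obtain C where b: "ufun (C * V) (mid_part g)" "ufun (C * V) (far_part g)" using ext_op_structure g by blast
  have "mid_part g x = 0" by (rule ufunD(3)[OF b(1)]) (use x in auto)
  moreover have "J (far_part g) x = 0" by (rule J_zero[OF b(2) x(2)])
  ultimately show ?thesis by (simp add: ext_op_def)
qed

lemma src_linear:
  assumes "outer_bv V g" "outer_bv V' g'"
  shows "src (\<lambda>x. a * g x + b * g' x) = (\<lambda>x. a * src g x + b * src g' x)"
proof -
  have J: "J (\<lambda>x. a * g x + b * g' x) = (\<lambda>x. a * J g x + b * J g' x)"
    unfolding J_def by (auto simp: algebra_simps)
  have p1: "periodize (\<lambda>x. a * g x + b * g' x) = (\<lambda>x. a * periodize g x + b * periodize g' x)"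
    by (rule ext, rule periodize_linear[OF assms[THEN outer_bv_decay]])
  have p2: "periodize (\<lambda>x. a * J g x + b * J g' x) = (\<lambda>x. a * periodize (J g) x + b * periodize (J g') x)"
    by (rule ext, rule periodize_linear[OF assms[THEN outer_bv_J, THEN outer_bv_decay]])
  have "ufun (fold_const * (2 * \<beta> * V)) (periodize (J g))" "ufun (fold_const * (2 * \<beta> * V')) (periodize (J g'))"
    using outer_bv_periodize(1)[OF outer_bv_J[OF assms(1)], of 0] outer_bv_periodize(1)[OF outer_bv_J[OF assms(2)], of 0] by auto
  from T_linear[OF this, of a b]
  show ?thesis unfolding src_def[abs_def] J p1 p2 by (simp add: algebra_simps fun_eq_iff)
qed

lemma ext_op_linear:
  assumes "outer_bv V g" "outer_bv V' g'"
  shows "ext_op (\<lambda>x. a * g x + b * g' x) = (\<lambda>x. a * ext_op g x + b * ext_op g' x)"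
proof -
  obtain B B' where b: "ufun B (src g)" "ufun B' (src g')" using src_decay assms by blast
  have sm: "summable (\<lambda>k. (T ^^ (2 * k)) (src g) x)" if "outer_bv V g" for V g x
    using ext_op_structure that by blast
  have "(\<lambda>k. (T ^^ (2 * k)) (src (\<lambda>x. a * g x + b * g' x)) x) sums (a * mid_part g x + b * mid_part g' x)" for x
    unfolding src_linear[OF assms] T_pow_linear[OF b] mid_part_def
    by (intro sums_add sums_mult summable_sums sm[OF assms(1)] sm[OF assms(2)])
  then have i: "mid_part (\<lambda>x. a * g x + b * g' x) = (\<lambda>x. a * mid_part g x + b * mid_part g' x)"
    unfolding mid_part_def[of "\<lambda>x. a * g x + b * g' x"] by (auto simp: sums_iff)
  obtain C C' where bi: "ufun (C * V) (mid_part g)" "ufun (C' * V') (mid_part g')" using ext_op_structure assms by blast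
  have J: "J (\<lambda>x. a * h x + b * h' x) = (\<lambda>x. a * J h x + b * J h' x)" for h h'
    unfolding J_def by (auto simp: algebra_simps)
  have p2: "periodize (\<lambda>x. a * J g x + b * J g' x) = (\<lambda>x. a * periodize (J g) x + b * periodize (J g') x)"
    by (rule ext, rule periodize_linear[OF assms[THEN outer_bv_J, THEN outer_bv_decay]])
  have t: "far_part (\<lambda>x. a * g x + b * g' x) = (\<lambda>x. a * far_part g x + b * far_part g' x)"
    unfolding far_part_def[abs_def] i J p2 T_linear[OF bi] by (simp add: algebra_simps fun_eq_iff)
  show ?thesis
    unfolding ext_op_def[abs_def] i t J by (simp add: algebra_simps fun_eq_iff)
qed

lemma J_AE_zero:
  assumes i: "integrable lborel g" and z: "AE x in lborel. g x = 0"
  shows "AE x in lborel. J g x = 0"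
proof -
  have ia: "integrable lborel (\<lambda>x. \<bar>g x\<bar>)" using i by simp
  have eq: "J (\<lambda>x. \<bar>g x\<bar>) = (\<lambda>x. \<bar>J g x\<bar>)" unfolding J_def using beta_pos by (auto simp: abs_mult)
  have "(LINT x|lborel. \<bar>J g x\<bar>) = (LINT x|lborel. \<bar>g x\<bar>)" using J_integral(2)[OF ia] unfolding eq .
  also have "\<dots> = 0" by (rule integral_eq_zero_AE) (use z in auto)
  finally have "AE x in lborel. \<bar>J g x\<bar> = 0"
    by (subst (asm) integral_nonneg_eq_0_iff_AE) (use J_integral(1)[OF i] in auto)
  then show ?thesis by simp
qed

lemma T_AE_zero:
  assumes h: "ufun B h" and z: "AE x in lborel. h x = 0"
  shows "AE x in lborel. T h x = 0"
  unfolding T_def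
  by (rule periodize_AE_zero[OF J_measurable[OF ufunD(1)[OF h]] quad_decay_J[OF h]
        J_integral(1)[OF ufunD(5)[OF h]] _ J_AE_zero[OF ufunD(5)[OF h] z]])
     (use J_zero[OF h] beta_gt_1 in auto)

text \<open>With linearity, this makes the extension independent of the representative. Each of the
  countably many terms of the series vanishes almost everywhere.\<close>

lemma ext_op_AE_zero:
  assumes g: "outer_bv V g" and z: "AE x in lborel. g x = 0"
  shows "AE x in lborel. ext_op g x = 0"
proof -
  have per: "AE x in lborel. periodize g x = 0" if "outer_bv V g" "AE x in lborel. g x = 0" for V g
    by (rule periodize_AE_zero[OF outer_bvD(1)[OF that(1)] outer_bv_decay[OF that(1)] outer_bvD(5)[OF that(1)] outer_bvD(6)[OF that(1)] that(2)])
  have Jz: "AE x in lborel. J g x = 0" by (rule J_AE_zero[OF outer_bvD(5)[OF g] z])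
  have bp: "ufun (fold_const * (2 * \<beta> * V)) (periodize (J g))"
    using outer_bv_periodize(1)[OF outer_bv_J[OF g], of 0] by simp
  note pJ = per[OF outer_bv_J[OF g] Jz]
  have s: "AE x in lborel. src g x = 0"
    using T_AE_zero[OF bp pJ] per[OF g z] by eventually_elim (simp add: src_def)
  obtain B where B: "ufun B (src g)" using src_decay g by blast
  have "AE x in lborel. (T ^^ n) (src g) x = 0" for n
  proof (induction n)
    case (Suc n)
    then show ?case using T_AE_zero[OF ufun_pow[OF B]] by simp
  qed (use s in simp)
  then have "AE x in lborel. \<forall>k. (T ^^ (2 * k)) (src g) x = 0" by (simp add: AE_all_countable)
  then have i: "AE x in lborel. mid_part g x = 0" by eventually_elim (simp add: mid_part_def)
  obtain C where b: "ufun (C * V) (mid_part g)" "ufun (C * V) (far_part g)" using ext_op_structure g by blast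
  have t: "AE x in lborel. far_part g x = 0"
    using pJ T_AE_zero[OF b(1) i] by eventually_elim (simp add: far_part_def)
  show ?thesis
    using z i J_AE_zero[OF ufunD(5)[OF b(2)] t] by eventually_elim (simp add: ext_op_def)
qed

text \<open>Let \<open>\<psi> x = \<phi> (\<beta> / x)\<close>. \<open>J\<close> exchanges the
  pairings with \<open>\<phi>\<close> and \<open>\<psi>\<close>, and \<open>T\<close> moves
  \<open>\<phi>\<close> to \<open>\<psi>\<close>. The pairing with \<open>\<psi>\<close> cancels by
  the definition of \<open>far_part\<close>; the one with \<open>\<phi>\<close> needs the fixed
  point equation, and folded functions paired with the nonperiodic \<open>\<psi>\<close> cancel
  without being evaluated.\<close>

lemma ext_op_orthogonal:
  assumes g: "outer_bv V g" and [measurable]: "\<phi> \<in> borel_measurable borel"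
    and \<phi>: "\<And>x. \<bar>\<phi> x\<bar> \<le> M" and per: "\<And>x. \<phi> (x + 2) = \<phi> x"
  shows "(LINT x|lborel. ext_op g x * \<phi> x) = 0" "(LINT x|lborel. ext_op g x * \<phi> (\<beta> / x)) = 0"
proof -
  obtain C where b: "ufun (C * V) (mid_part g)" "ufun (C * V) (far_part g)"
    and eqn: "mid_part g = (\<lambda>x. src g x + T (T (mid_part g)) x)" using ext_op_structure g by blast
  have bq: "ufun (fold_const * (2 * \<beta> * V)) (periodize (J g))"
    using outer_bv_periodize(1)[OF outer_bv_J[OF g], of 0] by simp
  have bp: "ufun (fold_const * V) (periodize g)" using outer_bv_periodize(1)[OF g, of 0] by simp
  note ig = outer_bvD(5)[OF g] and ii = ufunD(5)[OF b(1)] and it = ufunD(5)[OF b(2)]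
    and iq = ufunD(5)[OF bq] and ip = ufunD(5)[OF bp]
    and iT = ufunD(5)[OF ufun_T[OF b(1)]] and iTT = ufunD(5)[OF ufun_T[OF ufun_T[OF b(1)]]] and iTq = ufunD(5)[OF ufun_T[OF bq]]
  note iJ = J_integral(1)[OF it]
  let ?\<psi> = "\<lambda>x. \<phi> (\<beta> / x)"
  have im: "integrable lborel (\<lambda>x. h x * \<phi> x)" "integrable lborel (\<lambda>x. h x * ?\<psi> x)" if "integrable lborel h" for h
    using integrable_mult_bounded[OF that, of \<phi> M] integrable_mult_bounded[OF that, of ?\<psi> M] \<phi> by auto
  have J_\<phi>: "(LINT x|lborel. J h x * \<phi> x) = (LINT x|lborel. h x * ?\<psi> x)" if "integrable lborel h" for h
  proof -
    have "(LINT x|lborel. J h x * \<phi> x) = (LINT x|lborel. J (\<lambda>x. h x * ?\<psi> x) x)"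
      by (rule Bochner_Integration.integral_cong) (use beta_pos in \<open>auto simp: J_def\<close>)
    also have "\<dots> = (LINT x|lborel. h x * ?\<psi> x)" by (rule J_integral(2)[OF im(2)[OF that]])
    finally show ?thesis .
  qed
  have J_\<psi>: "(LINT x|lborel. J h x * ?\<psi> x) = (LINT x|lborel. h x * \<phi> x)" if "integrable lborel h" for h
  proof -
    have "(LINT x|lborel. J h x * ?\<psi> x) = (LINT x|lborel. J (\<lambda>x. h x * \<phi> x) x)"
      by (rule Bochner_Integration.integral_cong) (auto simp: J_def)
    also have "\<dots> = (LINT x|lborel. h x * \<phi> x)" by (rule J_integral(2)[OF im(1)[OF that]])
    finally show ?thesis .
  qed
  have T\<phi>: "(LINT y|lborel. T h y * \<phi> y) = (LINT x|lborel. h x * ?\<psi> x)" if "ufun B h" for B h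
    by (rule T_integral[where \<phi>=\<phi>, OF that _ \<phi> per]) simp
  have far_part\<phi>: "(LINT x|lborel. far_part g x * \<phi> x) = - (LINT x|lborel. periodize (J g) x * \<phi> x) - (LINT x|lborel. T (mid_part g) x * \<phi> x)"
    unfolding far_part_def using im(1)[OF iq] im(1)[OF iT] by (simp add: algebra_simps)
  have far_part\<psi>: "(LINT x|lborel. far_part g x * ?\<psi> x) = - (LINT x|lborel. periodize (J g) x * ?\<psi> x) - (LINT x|lborel. T (mid_part g) x * ?\<psi> x)"
    unfolding far_part_def using im(2)[OF iq] im(2)[OF iT] by (simp add: algebra_simps)
  have isrc: "integrable lborel (src g)" unfolding src_def[abs_def] using iTq ip by simp
  have mid_part\<phi>: "(LINT x|lborel. mid_part g x * \<phi> x) = (LINT x|lborel. T (periodize (J g)) x * \<phi> x)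
      - (LINT x|lborel. periodize g x * \<phi> x) + (LINT x|lborel. T (T (mid_part g)) x * \<phi> x)"
    by (subst eqn) (use im(1)[OF iTq] im(1)[OF ip] im(1)[OF iTT] in \<open>simp add: src_def algebra_simps\<close>)
  have e: "(LINT x|lborel. ext_op g x * \<eta> x) = (LINT x|lborel. g x * \<eta> x) + (LINT x|lborel. mid_part g x * \<eta> x) + (LINT x|lborel. J (far_part g) x * \<eta> x)"
    if "integrable lborel (\<lambda>x. g x * \<eta> x)" "integrable lborel (\<lambda>x. mid_part g x * \<eta> x)" "integrable lborel (\<lambda>x. J (far_part g) x * \<eta> x)" for \<eta>
    unfolding ext_op_def using that by (simp add: algebra_simps)
  show "(LINT x|lborel. ext_op g x * \<phi> x) = 0"
    unfolding e[OF im(1)[OF ig] im(1)[OF ii] im(1)[OF iJ]] J_\<phi>[OF it] mid_part\<phi> far_part\<psi>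
      T\<phi>[OF bq] T\<phi>[OF ufun_T[OF b(1)]] periodize_integral'[where \<phi>=\<phi>, OF g assms(2) \<phi> per] by simp
  show "(LINT x|lborel. ext_op g x * ?\<psi> x) = 0"
    unfolding e[OF im(2)[OF ig] im(2)[OF ii] im(2)[OF iJ]] J_\<psi>[OF it] far_part\<phi>
      T\<phi>[OF b(1)] periodize_integral'[where \<phi>=\<phi>, OF outer_bv_J[OF g] assms(2) \<phi> per] J_\<phi>[OF ig] by simp
qed

end

section \<open>Functions of bounded variation\<close>

lemma variation_sums_0: "c \<in> I \<Longrightarrow> 0 \<in> variation_sums h I"
  unfolding variation_sums_def by (rule CollectI, rule exI[of _ 0], rule exI[of _ "\<lambda>_. c"]) simp

lemma variation_sums_mono: "I \<subseteq> I' \<Longrightarrow> variation_sums h I \<subseteq> variation_sums h I'"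
  unfolding variation_sums_def by blast

lemma variation_sums_extend:
  assumes s: "s \<in> variation_sums h {a..x}" and xy: "x \<le> y"
  shows "\<exists>s'\<in>variation_sums h {a..y}. s + norm (h y - h x) \<le> s'"
proof -
  obtain n t where t: "s = (\<Sum>i<n. norm (h (t (Suc i)) - h (t i)))" "\<And>i. i \<le> n \<Longrightarrow> t i \<in> {a..x}"
    "\<And>i. i < n \<Longrightarrow> t i \<le> t (Suc i)"
    using s unfolding variation_sums_def by blast
  \<comment> \<open>Appends \<open>x\<close> and \<open>y\<close> to the partition; the increment
    from \<open>t n\<close> to \<open>x\<close> is discarded.\<close>
  define u where "u = (\<lambda>i. if i \<le> n then t i else if i = Suc n then x else y)"
  have "(\<Sum>i<n + 2. norm (h (u (Suc i)) - h (u i))) = (\<Sum>i<n. norm (h (u (Suc i)) - h (u i))) + norm (h x - h (t n)) + norm (h y - h x)"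
    by (simp add: u_def)
  also have "(\<Sum>i<n. norm (h (u (Suc i)) - h (u i))) = s"
    unfolding t(1) by (rule sum.cong) (auto simp: u_def)
  finally have "s + norm (h y - h x) \<le> (\<Sum>i<n + 2. norm (h (u (Suc i)) - h (u i)))" by simp
  moreover have "(\<Sum>i<n + 2. norm (h (u (Suc i)) - h (u i))) \<in> variation_sums h {a..y}"
    unfolding variation_sums_def
  proof (rule CollectI, rule exI[of _ "n + 2"], rule exI[of _ u], intro conjI allI impI)
    fix i assume "i \<le> n + 2"
    show "u i \<in> {a..y}" using t(2)[of i] t(2)[of n] xy by (auto simp: u_def)
  next
    fix i assume "i < n + 2"
    then consider "i < n" | "i = n" | "i = Suc n" by linarith
    then show "u i \<le> u (Suc i)" using t(3)[of i] t(2)[of n] xy by cases (auto simp: u_def)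
  qed simp
  ultimately show ?thesis by blast
qed

text \<open>The variation over \<open>{a..x}\<close>, as a function of \<open>x\<close>, is the
  majorant. Formed with the complex norm, it serves real and imaginary parts alike.\<close>

lemma bounded_variation_majorant:
  assumes bv: "bounded_variation_on h {a..b}"
  shows "\<exists>F. (\<forall>x\<in>{a..b}. \<forall>y\<in>{a..b}. x \<le> y \<longrightarrow> norm (h y - h x) \<le> F y - F x) \<and>
    (a \<le> b \<longrightarrow> F b - F a \<le> total_variation h {a..b})"
proof (rule exI[of _ "\<lambda>x. total_variation h {a..x}"], intro conjI ballI impI)
  have bdd: "bdd_above (variation_sums h {a..x})" if "x \<le> b" for x
    using bv variation_sums_mono[of "{a..x}" "{a..b}" h] that
    unfolding bounded_variation_on_def by (meson atLeastatMost_subset_iff bdd_above_mono order_refl)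
  {
    fix x y assume xy: "x \<in> {a..b}" "y \<in> {a..b}" "x \<le> y"
    have "Sup (variation_sums h {a..x}) \<le> Sup (variation_sums h {a..y}) - norm (h y - h x)"
    proof (rule cSup_least)
      show "variation_sums h {a..x} \<noteq> {}" using variation_sums_0[of a "{a..x}" h] xy by auto
      fix s assume "s \<in> variation_sums h {a..x}"
      then obtain s' where "s' \<in> variation_sums h {a..y}" "s + norm (h y - h x) \<le> s'"
        using variation_sums_extend xy(3) by blast
      moreover from this(1) have "s' \<le> Sup (variation_sums h {a..y})" using xy by (intro cSup_upper bdd) auto
      ultimately show "s \<le> Sup (variation_sums h {a..y}) - norm (h y - h x)" by linarith
    qed
    then show "norm (h y - h x) \<le> total_variation h {a..y} - total_variation h {a..x}"
      unfolding total_variation_def by linarith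
  }
  assume ab: "a \<le> b"
  have "0 \<le> total_variation h {a..a}" unfolding total_variation_def
    using variation_sums_0[of a "{a..a}" h] ab by (intro cSup_upper bdd) auto
  then show "total_variation h {a..b} - total_variation h {a..a} \<le> total_variation h {a..b}" by simp
qed

lemma total_variation_nonneg:
  assumes "bounded_variation_on h {a..b}" "a \<le> b" shows "0 \<le> total_variation h {a..b}"
  unfolding total_variation_def using assms variation_sums_0[of a "{a..b}" h]
  by (intro cSup_upper) (auto simp: bounded_variation_on_def)

lemma bounded_variation_cong:
  assumes "\<And>x. x \<in> I \<Longrightarrow> h x = h' x"
  shows "bounded_variation_on h I = bounded_variation_on h' I" "total_variation h I = total_variation h' I"
proof -
  have "variation_sums h I \<subseteq> variation_sums h' I" if "\<And>x. x \<in> I \<Longrightarrow> h x = h' x" for h h'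
  proof
    fix s assume "s \<in> variation_sums h I"
    then obtain n t where t: "s = (\<Sum>i<n. norm (h (t (Suc i)) - h (t i)))" "\<forall>i\<le>n. t i \<in> I" "\<forall>i<n. t i \<le> t (Suc i)"
      unfolding variation_sums_def by blast
    have "s = (\<Sum>i<n. norm (h' (t (Suc i)) - h' (t i)))"
      unfolding t(1) using t(2) that by (intro sum.cong) auto
    then show "s \<in> variation_sums h' I" unfolding variation_sums_def using t by blast
  qed
  from this[of h h'] this[of h' h] assms have "variation_sums h I = variation_sums h' I" by (metis subset_antisym)
  then show "bounded_variation_on h I = bounded_variation_on h' I" "total_variation h I = total_variation h' I"
    unfolding bounded_variation_on_def total_variation_def by simp_all
qed

text \<open>Values of \<open>g\<close> differ by at most its variation, so \<open>g x\<close> can be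
  compared with the mean of \<bar>f\<bar> over the interval. This gives a bound at every point
  although \<open>g\<close> and \<open>f\<close> agree only almost everywhere.\<close>

lemma bounded_variation_sup_bound:
  assumes ab: "a < b" and bv: "bounded_variation_on g {a..b}" and eq: "AE x\<in>{a..b} in lebesgue. g x = f x"
    and f: "f absolutely_integrable_on {a..b}" and x: "x \<in> {a..b}"
  shows "norm (g x) \<le> total_variation g {a..b} + (LINT x:{a..b}|lebesgue. norm (f x)) / (b - a)"
proof -
  let ?V = "total_variation g {a..b}"
  from bounded_variation_majorant[OF bv] obtain F where
    "(\<forall>x\<in>{a..b}. \<forall>y\<in>{a..b}. x \<le> y \<longrightarrow> norm (g y - g x) \<le> F y - F x) \<and> (a \<le> b \<longrightarrow> F b - F a \<le> ?V)"
    by (elim exE)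
  then have F: "\<And>x y. x \<in> {a..b} \<Longrightarrow> y \<in> {a..b} \<Longrightarrow> x \<le> y \<Longrightarrow> norm (g y - g x) \<le> F y - F x"
    "F b - F a \<le> ?V"
    using ab by auto
  have F_mono: "F x \<le> F y" if "x \<in> {a..b}" "y \<in> {a..b}" "x \<le> y" for x y
    using F(1)[OF that] norm_ge_zero[of "g y - g x"] by linarith
  have osc: "norm (g x - g t) \<le> ?V" if "t \<in> {a..b}" for t
    using F(1)[of x t] F(1)[of t x] F_mono[of a x] F_mono[of a t] F_mono[of x b] F_mono[of t b] F(2) that x
    by (cases "x \<le> t") (auto simp: norm_minus_commute)
  have "(LINT t|lebesgue. (norm (g x) - ?V) * indicator {a..b} t) \<le> (LINT x:{a..b}|lebesgue. norm (f x))"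
    unfolding set_lebesgue_integral_def
  proof (rule integral_mono_AE)
    show "integrable lebesgue (\<lambda>t. (norm (g x) - ?V) * indicator {a..b} t)"
      by (intro integrable_mult_right integrable_real_indicator) (auto simp: emeasure_lborel_Icc_eq)
    show "integrable lebesgue (\<lambda>x. indicator {a..b} x *\<^sub>R norm (f x))"
      using set_integrable_norm[OF f] unfolding set_integrable_def .
    show "AE t in lebesgue. (norm (g x) - ?V) * indicator {a..b} t \<le> indicator {a..b} t *\<^sub>R norm (f t)"
      using eq
    proof eventually_elim
      case (elim t)
      show ?case
      proof (cases "t \<in> {a..b}")
        case True
        have "norm (g x) \<le> norm (g t) + norm (g x - g t)" by (metis norm_triangle_sub)
        then show ?thesis using osc[OF True] elim True by simp
      qed simp
    qed
  qed
  then have "(norm (g x) - ?V) * (b - a) \<le> (LINT x:{a..b}|lebesgue. norm (f x))" using ab by simp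
  then show ?thesis using ab by (simp add: field_simps)
qed

text \<open>Jordan decomposition: \<open>h = F - (F - h)\<close> is a difference of monotone
  functions. Representatives of bounded variation are therefore Borel, not merely Lebesgue
  measurable.\<close>

lemma maj_measurable:
  assumes "maj {a..b} h F"
  shows "(\<lambda>x. indicator {a..b} x * h x) \<in> borel_measurable borel"
proof -
  have m1: "mono_on {a..b} F" using maj_mono[OF assms] by (auto intro!: mono_onI)
  have m2: "mono_on {a..b} (\<lambda>x. F x - h x)"
  proof (rule mono_onI)
    fix x y assume "x \<in> {a..b}" "y \<in> {a..b}" "x \<le> y"
    from majD[OF assms this] show "F x - h x \<le> F y - h y" by linarith
  qed
  have "(\<lambda>x. indicator {a..b} x *\<^sub>R F x) \<in> borel_measurable borel"
    "(\<lambda>x. indicator {a..b} x *\<^sub>R (F x - h x)) \<in> borel_measurable borel"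
    using borel_measurable_mono_on_fnc[OF m1] borel_measurable_mono_on_fnc[OF m2]
    by (simp_all add: borel_measurable_restrict_space_iff)
  then have "(\<lambda>x. indicator {a..b} x *\<^sub>R F x - indicator {a..b} x *\<^sub>R (F x - h x)) \<in> borel_measurable borel"
    by (rule borel_measurable_diff)
  then show ?thesis by (simp add: algebra_simps)
qed

text \<open>Gaussian elimination by induction on the equations: the one for \<open>b\<close> is
  solved for a pivot unknown \<open>p\<close>, which is then eliminated from the others.\<close>

lemma linear_dependence:
  fixes c :: "'i \<Rightarrow> 'b \<Rightarrow> 'a::field"
  assumes "finite B" "finite I" "card B < card I"
  shows "\<exists>l. (\<exists>i\<in>I. l i \<noteq> 0) \<and> (\<forall>b\<in>B. (\<Sum>i\<in>I. l i * c i b) = 0)"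
  using assms
proof (induction B arbitrary: I c rule: finite_induct)
  case empty
  then have "I \<noteq> {}" by auto
  then show ?case by (intro exI[of _ "\<lambda>_. 1"]) auto
next
  case (insert b B)
  show ?case
  proof (cases "\<forall>i\<in>I. c i b = 0")
    case True
    have "card B < card I" using insert by simp
    then obtain l where "\<exists>i\<in>I. l i \<noteq> 0" "\<forall>b\<in>B. (\<Sum>i\<in>I. l i * c i b) = 0"
      using insert.IH[OF insert.prems(1)] by blast
    then show ?thesis using True by (intro exI[of _ l]) auto
  next
    case False
    then obtain p where p: "p \<in> I" "c p b \<noteq> 0" by blast
    let ?I = "I - {p}"
    let ?c = "\<lambda>i b'. c i b' - c i b / c p b * c p b'"
    have card: "card B < card ?I" using insert p by simp
    obtain l where l: "\<exists>i\<in>?I. l i \<noteq> 0" "\<forall>b'\<in>B. (\<Sum>i\<in>?I. l i * ?c i b') = 0"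
      using insert.IH[OF _ card, of ?c] insert.prems by auto
    define l' where "l' = (\<lambda>i. if i = p then - (\<Sum>i\<in>?I. l i * c i b / c p b) else l i)"
    have split: "(\<Sum>i\<in>I. l' i * c i b') = (\<Sum>i\<in>?I. l i * ?c i b')" for b'
    proof -
      have "(\<Sum>i\<in>I. l' i * c i b') = l' p * c p b' + (\<Sum>i\<in>?I. l' i * c i b')"
        using p insert.prems by (intro sum.remove) auto
      also have "(\<Sum>i\<in>?I. l' i * c i b') = (\<Sum>i\<in>?I. l i * c i b')"
        by (rule sum.cong) (auto simp: l'_def)
      also have "l' p * c p b' = - (\<Sum>i\<in>?I. l i * c i b / c p b * c p b')"
        by (simp add: l'_def sum_distrib_right)
      also have "\<dots> + (\<Sum>i\<in>?I. l i * c i b') = (\<Sum>i\<in>?I. l i * ?c i b')"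
        by (simp add: sum_subtractf[symmetric] algebra_simps)
      finally show ?thesis .
    qed
    have "(\<Sum>i\<in>I. l' i * c i b) = 0" unfolding split using p by simp
    moreover have "\<forall>b'\<in>B. (\<Sum>i\<in>I. l' i * c i b') = 0" unfolding split using l(2) .
    moreover have "\<exists>i\<in>I. l' i \<noteq> 0" using l(1) by (auto simp: l'_def)
    ultimately show ?thesis by auto
  qed
qed

context gauss_map begin

section \<open>Complex-valued functions\<close>

definition admissible :: "(real \<Rightarrow> complex) \<Rightarrow> bool"
  where "admissible g \<longleftrightarrow> (\<exists>V. outer_bv V (\<lambda>x. Re (g x))) \<and> (\<exists>V. outer_bv V (\<lambda>x. Im (g x)))"

definition complex_ext :: "(real \<Rightarrow> complex) \<Rightarrow> real \<Rightarrow> complex"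
  where "complex_ext g x = Complex (ext_op (\<lambda>x. Re (g x)) x) (ext_op (\<lambda>x. Im (g x)) x)"

text \<open>Real and imaginary parts of a complex combination are real combinations of the four
  parts involved, so real linearity of \<open>ext_op\<close> suffices.\<close>

lemma admissible_linear:
  assumes "admissible g" "admissible g'"
  shows "admissible (\<lambda>x. c * g x + d * g' x)"
    "complex_ext (\<lambda>x. c * g x + d * g' x) = (\<lambda>x. c * complex_ext g x + d * complex_ext g' x)"
proof -
  obtain V W V' W' where v: "outer_bv V (\<lambda>x. Re (g x))" "outer_bv W (\<lambda>x. Im (g x))"
    "outer_bv V' (\<lambda>x. Re (g' x))" "outer_bv W' (\<lambda>x. Im (g' x))"
    using assms unfolding admissible_def by blast
  let ?r = "\<lambda>a b x. a * Re (g x) + b * Im (g x)" and ?s = "\<lambda>a b x. a * Re (g' x) + b * Im (g' x)"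
  have x: "\<exists>V. outer_bv V (?r a b)" "\<exists>V. outer_bv V (?s a b)" for a b
    using outer_bv_linear[OF v(1,2)] outer_bv_linear[OF v(3,4)] by blast+
  have e: "ext_op (?r a b) = (\<lambda>x. a * ext_op (\<lambda>x. Re (g x)) x + b * ext_op (\<lambda>x. Im (g x)) x)"
    "ext_op (?s a b) = (\<lambda>x. a * ext_op (\<lambda>x. Re (g' x)) x + b * ext_op (\<lambda>x. Im (g' x)) x)" for a b
    by (rule ext_op_linear[OF v(1,2)], rule ext_op_linear[OF v(3,4)])
  have sum: "(\<exists>V. outer_bv V (\<lambda>x. ?r a b x + ?s a' b' x)) \<and>
      ext_op (\<lambda>x. ?r a b x + ?s a' b' x) = (\<lambda>x. ext_op (?r a b) x + ext_op (?s a' b') x)" for a b a' b'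
  proof -
    obtain V V' where vv: "outer_bv V (?r a b)" "outer_bv V' (?s a' b')" using x by blast
    from outer_bv_linear[OF vv, of 1 1] ext_op_linear[OF vv, of 1 1] show ?thesis by auto
  qed
  have re: "(\<lambda>x. Re (c * g x + d * g' x)) = (\<lambda>x. ?r (Re c) (- Im c) x + ?s (Re d) (- Im d) x)"
    and im: "(\<lambda>x. Im (c * g x + d * g' x)) = (\<lambda>x. ?r (Im c) (Re c) x + ?s (Im d) (Re d) x)"
    by (auto simp: algebra_simps)
  show "admissible (\<lambda>x. c * g x + d * g' x)" unfolding admissible_def re im using sum by blast
  show "complex_ext (\<lambda>x. c * g x + d * g' x) = (\<lambda>x. c * complex_ext g x + d * complex_ext g' x)"
    unfolding complex_ext_def[abs_def] re im conjunct2[OF sum] e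
    by (simp add: complex_eq_iff fun_eq_iff algebra_simps)
qed

lemma complex_ext_AE_cong:
  assumes a: "admissible g" "admissible g'" and eq: "AE x\<in>outer \<beta> in lebesgue. g x = g' x"
  shows "AE x in lebesgue. complex_ext g x = complex_ext g' x"
proof -
  let ?d = "\<lambda>x. 1 * g x + (-1) * g' x"
  note d = admissible_linear[OF a, of 1 "-1"]
  obtain V W where v: "outer_bv V (\<lambda>x. Re (?d x))" "outer_bv W (\<lambda>x. Im (?d x))"
    using d(1) unfolding admissible_def by blast
  have "AE x in lebesgue. ?d x = 0"
    using eq
  proof eventually_elim
    case (elim x)
    show ?case
    proof (cases "x \<in> outer \<beta>")
      case False
      then have "Re (?d x) = 0" "Im (?d x) = 0" using outer_bvD(2)[OF v(1)] outer_bvD(2)[OF v(2)] by auto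
      then show ?thesis by (simp add: complex_eq_iff)
    qed (use elim in simp)
  qed
  then have "AE x in lborel. ?d x = 0" by (simp add: AE_completion_iff)
  then have "AE x in lborel. Re (?d x) = 0" "AE x in lborel. Im (?d x) = 0" by auto
  from ext_op_AE_zero[OF v(1) this(1)] ext_op_AE_zero[OF v(2) this(2)]
  have "AE x in lborel. complex_ext ?d x = 0" by eventually_elim (simp add: complex_ext_def complex_eq_iff)
  then have "AE x in lborel. complex_ext g x = complex_ext g' x" unfolding d(2) by simp
  then show ?thesis by (rule AE_completion)
qed

lemma complex_ext_L1:
  "\<exists>C. 0 \<le> C \<and> (\<forall>V g. outer_bv V (\<lambda>x. Re (g x)) \<longrightarrow> outer_bv V (\<lambda>x. Im (g x)) \<longrightarrow>
    integrable lborel (complex_ext g) \<and> L1_norm (complex_ext g) \<le> C * V)"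
proof -
  from ext_op_bound obtain C where c: "0 \<le> C \<and> (\<forall>V g. outer_bv V g \<longrightarrow> integrable lborel (ext_op g) \<and> (LINT x|lborel. \<bar>ext_op g x\<bar>) \<le> C * V)"
    by (elim exE)
  have "integrable lborel (complex_ext g) \<and> L1_norm (complex_ext g) \<le> (2 * C) * V"
    if v: "outer_bv V (\<lambda>x. Re (g x))" "outer_bv V (\<lambda>x. Im (g x))" for V g
  proof -
    let ?u = "ext_op (\<lambda>x. Re (g x))" and ?v = "ext_op (\<lambda>x. Im (g x))"
    have b: "integrable lborel ?u" "(LINT x|lborel. \<bar>?u x\<bar>) \<le> C * V" "integrable lborel ?v" "(LINT x|lborel. \<bar>?v x\<bar>) \<le> C * V"
      using c v by blast+
    have eq: "complex_ext g = (\<lambda>x. complex_of_real (?u x) + \<i> * complex_of_real (?v x))"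
      by (simp add: complex_ext_def fun_eq_iff complex_eq_iff)
    have int: "integrable lborel (complex_ext g)" unfolding eq using b by simp
    have "L1_norm (complex_ext g) = (LINT x|lborel. norm (complex_ext g x))"
      unfolding L1_norm_def using int by (intro integral_completion) auto
    also have "\<dots> \<le> (LINT x|lborel. \<bar>?u x\<bar> + \<bar>?v x\<bar>)"
    proof (rule integral_mono)
      show "integrable lborel (\<lambda>x. norm (complex_ext g x))" by (rule integrable_norm[OF int])
      show "norm (complex_ext g x) \<le> \<bar>?u x\<bar> + \<bar>?v x\<bar>" for x
        using cmod_le[of "complex_ext g x"] by (simp add: complex_ext_def)
    qed (use b in simp)
    also have "\<dots> \<le> C * V + C * V" using b by simp
    finally show ?thesis using int by simp
  qed
  moreover have "0 \<le> 2 * C" using c by simp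
  ultimately show ?thesis by blast
qed

text \<open>Euler's formula splits the exponentials into cosines and sines, which are bounded by 1
  and have period 2, so \<open>ext_op_orthogonal\<close> applies to each part.\<close>

lemma complex_ext_orthogonal:
  assumes "admissible g"
  shows "complex_ext g \<in> M_perp \<beta>"
proof -
  obtain V W where v: "outer_bv V (\<lambda>x. Re (g x))" "outer_bv W (\<lambda>x. Im (g x))"
    using assms unfolding admissible_def by blast
  let ?u = "ext_op (\<lambda>x. Re (g x))" and ?v = "ext_op (\<lambda>x. Im (g x))"
  have iu: "integrable lborel ?u" and iv: "integrable lborel ?v" using ext_op_bound v by blast+
  have eq: "complex_ext g = (\<lambda>x. complex_of_real (?u x) + \<i> * complex_of_real (?v x))"
    by (simp add: complex_ext_def fun_eq_iff complex_eq_iff)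
  have int: "integrable lborel (complex_ext g)" unfolding eq using iu iv by simp
  \<comment> \<open>\<open>\<psi> x\<close> will be \<open>pi * x\<close> and
    \<open>pi * (\<beta> / x)\<close>.\<close>
  have key: "(LINT x|lebesgue. complex_ext g x * exp (\<i> * of_int n * of_real (\<psi> x))) = 0"
    if [measurable]: "\<psi> \<in> borel_measurable borel"
      and z: "\<And>w V. outer_bv V w \<Longrightarrow> (LINT x|lborel. ext_op w x * cos (real_of_int n * \<psi> x)) = 0"
         "\<And>w V. outer_bv V w \<Longrightarrow> (LINT x|lborel. ext_op w x * sin (real_of_int n * \<psi> x)) = 0" for \<psi> n
  proof -
    let ?c = "\<lambda>x. cos (real_of_int n * \<psi> x)" and ?s = "\<lambda>x. sin (real_of_int n * \<psi> x)"
    have [measurable]: "?u \<in> borel_measurable borel" "?v \<in> borel_measurable borel" "complex_ext g \<in> borel_measurable borel"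
      using iu iv int by auto
    have ii: "integrable lborel (\<lambda>x. w x * ?c x)" "integrable lborel (\<lambda>x. w x * ?s x)" if "integrable lborel w" for w
      by (rule integrable_mult_bounded[OF that, of _ 1]; simp)+
    have e: "complex_ext g x * exp (\<i> * of_int n * of_real (\<psi> x)) =
        complex_of_real (?u x * ?c x - ?v x * ?s x) + \<i> * complex_of_real (?u x * ?s x + ?v x * ?c x)" for x
    proof -
      have "exp (\<i> * of_int n * of_real (\<psi> x)) = exp (\<i> * complex_of_real (real_of_int n * \<psi> x))"
        by (simp add: mult.assoc)
      also have "\<dots> = complex_of_real (?c x) + \<i> * complex_of_real (?s x)"
        by (simp only: exp_Euler cos_of_real sin_of_real)
      finally have "exp (\<i> * of_int n * of_real (\<psi> x)) = complex_of_real (?c x) + \<i> * complex_of_real (?s x)" .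
      then show ?thesis unfolding eq by (simp add: complex_eq_iff algebra_simps)
    qed
    have "(LINT x|lebesgue. complex_ext g x * exp (\<i> * of_int n * of_real (\<psi> x))) =
        (LINT x|lborel. complex_ext g x * exp (\<i> * of_int n * of_real (\<psi> x)))"
      by (rule integral_completion) measurable
    also have "\<dots> = (LINT x|lborel. complex_of_real (?u x * ?c x - ?v x * ?s x)) + (LINT x|lborel. \<i> * complex_of_real (?u x * ?s x + ?v x * ?c x))"
      unfolding e by (intro Bochner_Integration.integral_add integrable_mult_right integrable_of_real
          Bochner_Integration.integrable_diff Bochner_Integration.integrable_add ii iu iv)
    also have "(LINT x|lborel. complex_of_real (?u x * ?c x - ?v x * ?s x)) = complex_of_real (LINT x|lborel. ?u x * ?c x - ?v x * ?s x)"
      by (rule integral_of_real) (intro Bochner_Integration.integrable_diff ii iu iv)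
    also have "(LINT x|lborel. ?u x * ?c x - ?v x * ?s x) = 0"
      using ii[OF iu] ii[OF iv] z(1)[OF v(1)] z(2)[OF v(2)] by simp
    also have "(LINT x|lborel. \<i> * complex_of_real (?u x * ?s x + ?v x * ?c x)) = \<i> * complex_of_real (LINT x|lborel. ?u x * ?s x + ?v x * ?c x)"
    proof -
      have i: "integrable lborel (\<lambda>x. ?u x * ?s x + ?v x * ?c x)"
        by (intro Bochner_Integration.integrable_add ii iu iv)
      show ?thesis
        by (simp only: Bochner_Integration.integral_mult_right_zero integral_of_real[OF i])
    qed
    also have "(LINT x|lborel. ?u x * ?s x + ?v x * ?c x) = 0"
      using ii[OF iu] ii[OF iv] z(2)[OF v(1)] z(1)[OF v(2)] by simp
    finally show ?thesis by simp
  qed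
  have per: "cos (real_of_int n * (pi * (x + 2))) = cos (real_of_int n * (pi * x))"
    "sin (real_of_int n * (pi * (x + 2))) = sin (real_of_int n * (pi * x))" for n x
  proof -
    have "real_of_int n * (pi * (x + 2)) = real_of_int n * (pi * x) + (2 * pi) * real_of_int n" by (simp add: algebra_simps)
    then show "cos (real_of_int n * (pi * (x + 2))) = cos (real_of_int n * (pi * x))"
      "sin (real_of_int n * (pi * (x + 2))) = sin (real_of_int n * (pi * x))"
      by (simp_all add: cos_add sin_add)
  qed
  show ?thesis
    unfolding M_perp_def L1_def
  proof (intro CollectI conjI allI)
    show "integrable lebesgue (complex_ext g)" using int by (simp add: integrable_completion)
    fix n :: int
    show "(LINT x|lebesgue. complex_ext g x * exp (\<i> * of_int n * of_real (pi * x))) = 0"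
      by (rule key) (auto intro!: ext_op_orthogonal(1)[where M=1] simp: per)
    have "(LINT x|lebesgue. complex_ext g x * exp (\<i> * of_int n * of_real (pi * (\<beta> / x)))) = 0"
    proof (rule key)
      fix w V assume w: "outer_bv V w"
      show "(LINT x|lborel. ext_op w x * cos (real_of_int n * (pi * (\<beta> / x)))) = 0"
        using ext_op_orthogonal(2)[OF w, of "\<lambda>x. cos (real_of_int n * (pi * x))" 1] per by simp
      show "(LINT x|lborel. ext_op w x * sin (real_of_int n * (pi * (\<beta> / x)))) = 0"
        using ext_op_orthogonal(2)[OF w, of "\<lambda>x. sin (real_of_int n * (pi * x))" 1] per by simp
    qed measurable
    then show "(LINT x|lebesgue. complex_ext g x * exp (\<i> * of_int n * of_real (pi * \<beta> / x))) = 0" by simp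
  qed
qed

lemma complex_ext_on_outer:
  assumes "admissible g" "1 < \<bar>x\<bar>" "\<bar>x\<bar> < \<beta>"
  shows "complex_ext g x = g x"
proof -
  obtain V W where v: "outer_bv V (\<lambda>x. Re (g x))" "outer_bv W (\<lambda>x. Im (g x))"
    using assms unfolding admissible_def by blast
  show ?thesis
    using ext_op_on_outer[OF v(1) assms(2,3)] ext_op_on_outer[OF v(2) assms(2,3)]
    by (simp add: complex_ext_def complex_eq_iff)
qed

section \<open>The operator on classes\<close>

text \<open>The choice need not be linear in \<open>f\<close>; the resulting operator is linear
  almost everywhere because \<open>complex_ext\<close> is, and because different choices give
  extensions that agree almost everywhere.\<close>

definition rep :: "(real \<Rightarrow> complex) \<Rightarrow> real \<Rightarrow> complex"
  where "rep f = (SOME g. admissible g \<and> (AE x\<in>outer \<beta> in lebesgue. g x = f x))"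

text \<open>Stated for an arbitrary pair of representatives because the norm takes infima over them.
  The divisor \<open>\<beta> - 1\<close> is the length of either interval.\<close>

lemma BV_representative:
  assumes f: "f \<in> BV_outer \<beta>" and g1: "g1 \<in> BV_representatives {-\<beta>..-1} f" and g2: "g2 \<in> BV_representatives {1..\<beta>} f"
  defines "V \<equiv> total_variation g1 {-\<beta>..-1} + total_variation g2 {1..\<beta>} +
    ((LINT x:{-\<beta>..-1}|lebesgue. norm (f x)) + (LINT x:{1..\<beta>}|lebesgue. norm (f x))) / (\<beta> - 1)"
  shows "\<exists>g. outer_bv V (\<lambda>x. Re (g x)) \<and> outer_bv V (\<lambda>x. Im (g x)) \<and> (AE x\<in>outer \<beta> in lebesgue. g x = f x)"
proof -
  let ?L = "{-\<beta>..-1::real}" and ?R = "{1..\<beta>}"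
  define g where "g = (\<lambda>x. if x \<in> ?L then g1 x else if x \<in> ?R then g2 x else 0)"
  have gL: "g x = g1 x" if "x \<in> ?L" for x using that by (simp add: g_def)
  have gR: "g x = g2 x" if "x \<in> ?R" for x using that by (auto simp: g_def)
  have bv1: "bounded_variation_on g ?L" and tv1: "total_variation g ?L = total_variation g1 ?L"
    using bounded_variation_cong[of ?L g g1] gL g1 unfolding BV_representatives_def by auto
  have bv2: "bounded_variation_on g ?R" and tv2: "total_variation g ?R = total_variation g2 ?R"
    using bounded_variation_cong[of ?R g g2] gR g2 unfolding BV_representatives_def by auto
  have ae1: "AE x\<in>?L in lebesgue. g x = f x"
  proof -
    have "AE x\<in>?L in lebesgue. g1 x = f x" using g1 unfolding BV_representatives_def by auto
    then show ?thesis by eventually_elim (use gL in auto)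
  qed
  have ae2: "AE x\<in>?R in lebesgue. g x = f x"
  proof -
    have "AE x\<in>?R in lebesgue. g2 x = f x" using g2 unfolding BV_representatives_def by auto
    then show ?thesis by eventually_elim (use gR in auto)
  qed
  have ae: "AE x\<in>outer \<beta> in lebesgue. g x = f x"
    using ae1 ae2 by eventually_elim (auto simp: outer_def)
  have ai: "f absolutely_integrable_on ?L" "f absolutely_integrable_on ?R"
    using f unfolding BV_outer_def BV_def by auto
  let ?i1 = "LINT x:?L|lebesgue. norm (f x)" and ?i2 = "LINT x:?R|lebesgue. norm (f x)"
  have b: "0 < \<beta> - 1" using beta_gt_1 by simp
  have i0: "0 \<le> ?i1" "0 \<le> ?i2" unfolding set_lebesgue_integral_def by (auto intro!: integral_nonneg_AE)
  have t0: "0 \<le> total_variation g ?L" "0 \<le> total_variation g ?R"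
    using total_variation_nonneg[OF bv1] total_variation_nonneg[OF bv2] beta_gt_1 by auto
  have q0: "0 \<le> ?i1 / (\<beta> - 1)" "0 \<le> ?i2 / (\<beta> - 1)" using i0 b by auto
  have V: "V = total_variation g ?L + total_variation g ?R + ?i1 / (\<beta> - 1) + ?i2 / (\<beta> - 1)"
    unfolding V_def tv1 tv2 by (simp add: add_divide_distrib)
  have V0: "0 \<le> V" "total_variation g ?L \<le> V" "total_variation g ?R \<le> V" unfolding V using t0 q0 by linarith+
  have bd: "norm (g x) \<le> V" for x
  proof -
    consider "x \<in> ?L" | "x \<in> ?R" | "x \<notin> ?L" "x \<notin> ?R" by blast
    then show ?thesis
    proof cases
      case 1
      have "norm (g x) \<le> total_variation g ?L + ?i1 / (- 1 - - \<beta>)"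
        by (rule bounded_variation_sup_bound[OF _ bv1 ae1 ai(1) 1]) (use beta_gt_1 in simp)
      moreover have "- 1 - - \<beta> = \<beta> - 1" by simp
      ultimately show ?thesis unfolding V using t0 q0 by simp
    next
      case 2
      have "norm (g x) \<le> total_variation g ?R + ?i2 / (\<beta> - 1)"
        by (rule bounded_variation_sup_bound[OF _ bv2 ae2 ai(2) 2]) (use beta_gt_1 in simp)
      then show ?thesis unfolding V using t0 q0 by simp
    next
      case 3
      then have "g x = 0" unfolding g_def by auto
      then show ?thesis using V0 by simp
    qed
  qed
  obtain F1 where F1: "\<forall>x\<in>?L. \<forall>y\<in>?L. x \<le> y \<longrightarrow> norm (g y - g x) \<le> F1 y - F1 x" "F1 (-1) - F1 (-\<beta>) \<le> total_variation g ?L"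
    using bounded_variation_majorant[OF bv1] beta_gt_1 by auto
  obtain F2 where F2: "\<forall>x\<in>?R. \<forall>y\<in>?R. x \<le> y \<longrightarrow> norm (g y - g x) \<le> F2 y - F2 x" "F2 \<beta> - F2 1 \<le> total_variation g ?R"
    using bounded_variation_majorant[OF bv2] beta_gt_1 by auto
  \<comment> \<open>\<open>p\<close> stands for \<open>Re\<close> and \<open>Im\<close>, which do
    not increase distances and so keep the majorants.\<close>
  have "outer_bv V (\<lambda>x. p (g x))" if p: "\<And>z w. \<bar>p z - p w\<bar> \<le> norm (z - w)" "p 0 = 0" for p :: "complex \<Rightarrow> real"
  proof -
    have m1: "maj ?L (\<lambda>x. p (g x)) F1" and m2: "maj ?R (\<lambda>x. p (g x)) F2"
      unfolding maj_def using F1(1) F2(1) p(1) order_trans by blast+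
    have "uminus ` ?L = ?R" by (simp)
    then have m1': "maj ?R (\<lambda>x. p (g (-x))) (\<lambda>x. - F1 (-x))" using maj_reflect[OF m1] by simp
    have eq: "(\<lambda>x. p (g x)) = (\<lambda>x. indicator ?L x * p (g x) + indicator ?R x * p (g x))"
      using p(2) by (auto simp: fun_eq_iff g_def indicator_def)
    have "(\<lambda>x. p (g x)) \<in> borel_measurable borel"
      by (subst eq) (intro borel_measurable_add maj_measurable[OF m1] maj_measurable[OF m2])
    moreover have "p (g x) = 0" if "x \<notin> outer \<beta>" for x
      using that p(2) unfolding outer_def g_def by auto
    moreover have "\<bar>p (g x)\<bar> \<le> V" for x using p(1)[of "g x" 0] p(2) bd[of x] by simp
    moreover have "\<exists>F. maj ?R (\<lambda>x. p (g x)) F \<and> F \<beta> - F 1 \<le> V" using m2 F2(2) V0 by (meson order_trans)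
    moreover have "\<exists>F. maj ?R (\<lambda>x. p (g (-x))) F \<and> F \<beta> - F 1 \<le> V"
      using m1' F1(2) V0 by (intro exI[of _ "\<lambda>x. - F1 (-x)"]) auto
    ultimately show ?thesis unfolding outer_bv_def by blast
  qed
  from this[of Re] this[of Im] ae show ?thesis
    by (metis abs_Im_le_cmod abs_Re_le_cmod minus_complex.sel zero_complex.sel)
qed

lemma repI:
  assumes "admissible g" "AE x\<in>outer \<beta> in lebesgue. g x = f x"
  shows "admissible (rep f)" "AE x\<in>outer \<beta> in lebesgue. rep f x = f x"
  using someI[of "\<lambda>g. admissible g \<and> (AE x\<in>outer \<beta> in lebesgue. g x = f x)", OF conjI[OF assms]]
  unfolding rep_def by auto

lemma rep:
  assumes "f \<in> BV_outer \<beta>"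
  shows "admissible (rep f)" "AE x\<in>outer \<beta> in lebesgue. rep f x = f x"
proof -
  obtain g1 g2 where "g1 \<in> BV_representatives {-\<beta>..-1} f" "g2 \<in> BV_representatives {1..\<beta>} f"
    using assms unfolding BV_outer_def BV_def by blast
  from BV_representative[OF assms this]
  obtain g where "admissible g" "AE x\<in>outer \<beta> in lebesgue. g x = f x" unfolding admissible_def by blast
  from repI[OF this] show "admissible (rep f)" "AE x\<in>outer \<beta> in lebesgue. rep f x = f x" .
qed

definition E :: "(real \<Rightarrow> complex) \<Rightarrow> real \<Rightarrow> complex"
  where "E f = complex_ext (rep f)"

lemma E_unique:
  assumes g: "admissible g" "AE x\<in>outer \<beta> in lebesgue. g x = f x"
  shows "AE x in lebesgue. E f x = complex_ext g x"
  unfolding E_def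
proof (rule complex_ext_AE_cong[OF repI(1)[OF g] g(1)])
  show "AE x\<in>outer \<beta> in lebesgue. rep f x = g x"
    using repI(2)[OF g] g(2) by eventually_elim auto
qed

lemma E_L1: "f \<in> BV_outer \<beta> \<Longrightarrow> E f \<in> L1"
  using complex_ext_orthogonal[OF rep(1)] unfolding E_def M_perp_def by blast

lemma E_linear:
  assumes f: "f \<in> BV_outer \<beta>" "f' \<in> BV_outer \<beta>"
  shows "AE x in lebesgue. E (\<lambda>x. c * f x + d * f' x) x = c * E f x + d * E f' x"
proof -
  note a = admissible_linear[OF rep(1)[OF f(1)] rep(1)[OF f(2)], of c d]
  have "AE x\<in>outer \<beta> in lebesgue. c * rep f x + d * rep f' x = c * f x + d * f' x"
    using rep(2)[OF f(1)] rep(2)[OF f(2)] by eventually_elim auto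
  from E_unique[OF a(1) this] show ?thesis unfolding a(2) E_def .
qed

text \<open>Every pair of representatives leads to the same extension up to null sets, so one L1
  norm is bounded in terms of all pairs simultaneously, and the infima on the right and on the left
  can be taken one after the other.\<close>

lemma E_bound: "\<exists>C. \<forall>f\<in>BV_outer \<beta>. L1_norm (E f) \<le> C * BV_outer_norm \<beta> f"
proof -
  from complex_ext_L1 obtain C0 where c: "0 \<le> C0 \<and> (\<forall>V g. outer_bv V (\<lambda>x. Re (g x)) \<longrightarrow> outer_bv V (\<lambda>x. Im (g x)) \<longrightarrow>
    integrable lborel (complex_ext g) \<and> L1_norm (complex_ext g) \<le> C0 * V)" by (elim exE)
  \<comment> \<open>Dominates both coefficients that occur in \<open>BV_representative\<close>: 1
    for the variations and \<open>1 / (\<beta> - 1)\<close> for the L1 norms.\<close>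
  define r where "r = 1 + 1 / (\<beta> - 1)"
  have b: "0 < 1 / (\<beta> - 1)" using beta_gt_1 by simp
  have r: "1 \<le> r" "1 / (\<beta> - 1) \<le> r" unfolding r_def using b by auto
  \<comment> \<open>Adding 1 makes \<open>C\<close> positive; after division by it the estimate is a
    lower bound for the variations, to which the infima apply.\<close>
  define C where "C = (C0 + 1) * r"
  have C: "0 < C" unfolding C_def using c r by simp
  have "L1_norm (E f) \<le> C * BV_outer_norm \<beta> f" if f: "f \<in> BV_outer \<beta>" for f
  proof -
    let ?L = "{-\<beta>..-1::real}" and ?R = "{1..\<beta>}"
    let ?i1 = "LINT x:?L|lebesgue. norm (f x)" and ?i2 = "LINT x:?R|lebesgue. norm (f x)"
    have ne: "BV_representatives ?L f \<noteq> {}" "BV_representatives ?R f \<noteq> {}"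
      using f unfolding BV_outer_def BV_def by auto
    have i0: "0 \<le> ?i1" "0 \<le> ?i2" unfolding set_lebesgue_integral_def by (auto intro!: integral_nonneg_AE)
    have bd: "L1_norm (E f) / C - ?i1 - ?i2 - total_variation g1 ?L \<le> total_variation g2 ?R"
      if g: "g1 \<in> BV_representatives ?L f" "g2 \<in> BV_representatives ?R f" for g1 g2
    proof -
      let ?V = "total_variation g1 ?L + total_variation g2 ?R + (?i1 + ?i2) / (\<beta> - 1)"
      obtain g where gg: "outer_bv ?V (\<lambda>x. Re (g x))" "outer_bv ?V (\<lambda>x. Im (g x))" "AE x\<in>outer \<beta> in lebesgue. g x = f x"
        using BV_representative[OF f g] by blast
      have adm: "admissible g" using gg unfolding admissible_def by blast
      have t0: "0 \<le> total_variation g1 ?L" "0 \<le> total_variation g2 ?R"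
        using g beta_gt_1 unfolding BV_representatives_def by (auto intro!: total_variation_nonneg)
      have "integrable lborel (complex_ext g)" and cb: "L1_norm (complex_ext g) \<le> C0 * ?V" using c gg(1,2) by blast+
      have ig: "integrable lebesgue (complex_ext g)" using complex_ext_orthogonal[OF adm] unfolding M_perp_def L1_def by simp
      have iE: "integrable lebesgue (E f)" using E_L1[OF f] unfolding L1_def by simp
      have "L1_norm (E f) = L1_norm (complex_ext g)"
        unfolding L1_norm_def using ig iE E_unique[OF adm gg(3)]
        by (intro integral_cong_AE) auto
      also have "\<dots> \<le> C0 * ?V" by (rule cb)
      also have "\<dots> \<le> (C0 + 1) * ?V" using outer_bvD(4)[OF gg(1)] by (intro mult_right_mono) auto
      also have "\<dots> \<le> (C0 + 1) * (r * (total_variation g1 ?L + total_variation g2 ?R + (?i1 + ?i2)))"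
      proof (rule mult_left_mono)
        have "total_variation g1 ?L + total_variation g2 ?R \<le> r * (total_variation g1 ?L + total_variation g2 ?R)"
          using mult_right_mono[OF r(1), of "total_variation g1 ?L + total_variation g2 ?R"] t0 by simp
        moreover have "(?i1 + ?i2) / (\<beta> - 1) \<le> r * (?i1 + ?i2)"
          using mult_right_mono[OF r(2), of "?i1 + ?i2"] i0 by simp
        ultimately show "?V \<le> r * (total_variation g1 ?L + total_variation g2 ?R + (?i1 + ?i2))"
          by (simp only: distrib_left)
      qed (use c in simp)
      also have "\<dots> = C * (total_variation g1 ?L + total_variation g2 ?R + (?i1 + ?i2))"
        unfolding C_def by (simp only: mult.assoc)
      finally have "L1_norm (E f) / C \<le> total_variation g1 ?L + total_variation g2 ?R + (?i1 + ?i2)"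
        using C by (simp add: divide_le_eq mult.commute)
      then show ?thesis by linarith
    qed
    have "L1_norm (E f) / C - ?i1 - ?i2 - total_variation g1 ?L \<le> (INF g\<in>BV_representatives ?R f. total_variation g ?R)"
      if "g1 \<in> BV_representatives ?L f" for g1
      by (rule cINF_greatest[OF ne(2) bd[OF that]])
    then have "L1_norm (E f) / C - ?i1 - ?i2 - (INF g\<in>BV_representatives ?R f. total_variation g ?R) \<le> total_variation g1 ?L"
      if "g1 \<in> BV_representatives ?L f" for g1 using that by fastforce
    then have "L1_norm (E f) / C - ?i1 - ?i2 - (INF g\<in>BV_representatives ?R f. total_variation g ?R)
        \<le> (INF g\<in>BV_representatives ?L f. total_variation g ?L)"
      by (rule cINF_greatest[OF ne(1)])
    then have "L1_norm (E f) / C \<le> BV_outer_norm \<beta> f" unfolding BV_outer_norm_def BV_norm_def by linarith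
    then show ?thesis using C by (simp add: divide_le_eq mult.commute)
  qed
  then show ?thesis by blast
qed

lemma E_extends:
  assumes f: "f \<in> BV_outer \<beta>"
  shows "AE x\<in>{-\<beta>..\<beta>} - {-1..1} in lebesgue. E f x = f x"
proof -
  have "AE x in lborel. x \<noteq> \<beta>" "AE x in lborel. x \<noteq> - \<beta>" by (auto intro: AE_lborel_singleton)
  from this[THEN AE_completion] rep(2)[OF f] show ?thesis
  proof eventually_elim
    case (elim x)
    show ?case
    proof
      assume x: "x \<in> {-\<beta>..\<beta>} - {-1..1}"
      then have "1 < \<bar>x\<bar>" "\<bar>x\<bar> < \<beta>" using elim by auto
      moreover from x have "x \<in> outer \<beta>" by (auto simp: outer_def)
      ultimately show "E f x = f x" using complex_ext_on_outer[OF rep(1)[OF f], of x] elim unfolding E_def by simp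
    qed
  qed
qed

section \<open>Infinite dimension of the range\<close>

definition step :: "real \<Rightarrow> real \<Rightarrow> complex"
  where "step s x = (if s \<le> x then 1 else 0)"

lemma step_BV: "bounded_variation_on (step s) I"
  unfolding bounded_variation_on_def
proof (rule bdd_aboveI[of _ 1])
  fix v assume "v \<in> variation_sums (step s) I"
  then obtain n t where t: "v = (\<Sum>i<n. norm (step s (t (Suc i)) - step s (t i)))" "\<forall>i<n. t i \<le> t (Suc i)"
    unfolding variation_sums_def by blast
  have "v = (\<Sum>i<n. Re (step s (t (Suc i))) - Re (step s (t i)))"
    unfolding t(1)
  proof (rule sum.cong)
    fix i assume "i \<in> {..<n}"
    then have "t i \<le> t (Suc i)" using t(2) by simp
    then show "norm (step s (t (Suc i)) - step s (t i)) = Re (step s (t (Suc i))) - Re (step s (t i))"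
      by (simp add: step_def)
  qed simp
  also have "\<dots> = Re (step s (t n)) - Re (step s (t 0))" by (rule sum_lessThan_telescope)
  also have "\<dots> \<le> 1" by (simp add: step_def)
  finally show "v \<le> 1" .
qed

lemma step_BV_outer: "step s \<in> BV_outer \<beta>"
proof -
  have [measurable]: "step s \<in> borel_measurable borel" unfolding step_def[abs_def] by measurable
  have ai: "step s absolutely_integrable_on {a..b}" for a b
    unfolding set_integrable_def
  proof (rule Bochner_Integration.integrable_bound[of _ "\<lambda>x. indicator {a..b} x :: real"])
    show "integrable lebesgue (\<lambda>x. indicator {a..b} x :: real)" by (intro integrable_real_indicator) (auto simp: emeasure_lborel_Icc_eq)
    show "(\<lambda>x. indicator {a..b} x *\<^sub>R step s x) \<in> borel_measurable lebesgue"
      by (rule measurable_completion) measurable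
  qed (auto simp: step_def indicator_def)
  have "step s absolutely_integrable_on outer \<beta>"
    unfolding outer_def by (rule set_integrable_Un[OF ai ai]) auto
  moreover have "step s \<in> BV {a..b}" for a b
    unfolding BV_def BV_representatives_def using ai step_BV by auto
  ultimately show ?thesis unfolding BV_outer_def by blast
qed

text \<open>By the extension property, a linear relation between images of step functions holds
  between the step functions themselves on (1,\<beta>). With one step more than
  \<open>card B\<close> a nontrivial relation exists; between the first jump with nonzero
  coefficient and the next one it says that this coefficient is zero.\<close>

lemma E_infinite_dimensional: "infinite_dimensional_ae (E ` BV_outer \<beta>)"
  unfolding infinite_dimensional_ae_def
proof
  assume "\<exists>B. finite B \<and> B \<subseteq> E ` BV_outer \<beta> \<and> (\<forall>f\<in>E ` BV_outer \<beta>. \<exists>c. AE x in lebesgue. f x = (\<Sum>b\<in>B. c b * b x))"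
  then obtain B where B: "finite B" "\<forall>f\<in>E ` BV_outer \<beta>. \<exists>c. AE x in lebesgue. f x = (\<Sum>b\<in>B. c b * b x)" by blast
  define N where "N = Suc (card B)"
  \<comment> \<open>Jumps at equally spaced points starting from 1; the point
    \<open>s N = \<beta>\<close> only closes the last interval.\<close>
  define s where "s = (\<lambda>i. 1 + (\<beta> - 1) * real i / real N)"
  have s_mono: "s i \<le> s j" if "i \<le> j" for i j
    unfolding s_def using that beta_gt_1 by (intro add_left_mono divide_right_mono mult_left_mono) auto
  have s_strict: "s i < s (Suc i)" for i
    unfolding s_def N_def using beta_gt_1 by (intro add_strict_left_mono divide_strict_right_mono mult_strict_left_mono) auto
  have s_range: "1 \<le> s i" "i \<le> N \<Longrightarrow> s i \<le> \<beta>" for i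
    using s_mono[of 0 i] s_mono[of i N] by (auto simp: s_def N_def)
  have "\<forall>i. \<exists>c. AE x in lebesgue. E (step (s i)) x = (\<Sum>b\<in>B. c b * b x)"
    using B(2) step_BV_outer by blast
  then obtain c where c: "\<And>i. AE x in lebesgue. E (step (s i)) x = (\<Sum>b\<in>B. c i b * b x)" by metis
  obtain l where l: "\<exists>i\<in>{..<N}. l i \<noteq> 0" "\<forall>b\<in>B. (\<Sum>i<N. l i * c i b) = 0"
    using linear_dependence[OF B(1), of "{..<N}" c] by (auto simp: N_def)
  define j where "j = (LEAST i. i < N \<and> l i \<noteq> 0)"
  have j: "j < N" "l j \<noteq> 0" using LeastI_ex[of "\<lambda>i. i < N \<and> l i \<noteq> 0"] l(1) unfolding j_def by auto
  have jmin: "l i = 0" if "i < j" for i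
    using not_less_Least[of i "\<lambda>i. i < N \<and> l i \<noteq> 0"] that j(1) unfolding j_def by auto
  have ae1: "AE x in lebesgue. \<forall>i. E (step (s i)) x = (\<Sum>b\<in>B. c i b * b x)" using c by (simp add: AE_all_countable)
  have ae2: "AE x in lebesgue. \<forall>i. x \<in> {-\<beta>..\<beta>} - {-1..1} \<longrightarrow> E (step (s i)) x = step (s i) x"
    using E_extends[OF step_BV_outer] by (simp only: AE_all_countable) blast
  have "AE x in lebesgue. x \<notin> {s j<..<s (Suc j)}"
    using ae1 ae2
  proof eventually_elim
    case (elim x)
    show ?case
    proof
      assume x: "x \<in> {s j<..<s (Suc j)}"
      then have xo: "x \<in> {-\<beta>..\<beta>} - {-1..1}" using s_range[of j] s_range(2)[of "Suc j"] j(1) beta_gt_1 by auto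
      \<comment> \<open>Exactly the jumps up to \<open>j\<close> have been passed at
        \<open>x\<close>, and by minimality of \<open>j\<close> all earlier coefficients
        vanish.\<close>
      have st: "step (s i) x = (if i \<le> j then 1 else 0)" for i
        using x s_mono[of i j] s_mono[of "Suc j" i] by (cases "i \<le> j") (auto simp: step_def)
      have "(\<Sum>i<N. l i * step (s i) x) = (\<Sum>i<N. if i = j then l j else 0)"
        by (rule sum.cong) (use jmin in \<open>auto simp: st\<close>)
      then have "l j = (\<Sum>i<N. l i * step (s i) x)" using j(1) by simp
      also have "\<dots> = (\<Sum>i<N. l i * (\<Sum>b\<in>B. c i b * b x))"
        using elim xo by (intro sum.cong) auto
      also have "\<dots> = (\<Sum>b\<in>B. (\<Sum>i<N. l i * c i b) * b x)"
        unfolding sum_distrib_left sum_distrib_right by (subst sum.swap) (simp add: mult.assoc)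
      also have "\<dots> = 0" using l(2) by simp
      finally show False using j(2) by simp
    qed
  qed
  then have "{s j<..<s (Suc j)} \<in> null_sets lebesgue"
    by (subst (asm) AE_iff_null_sets[symmetric]) auto
  then have "emeasure lborel {s j<..<s (Suc j)} = 0" by auto
  then show False using s_strict[of j] by simp
qed

lemma E_bounded_linear: "bounded_linear_BV_outer_L1 \<beta> E"
  unfolding bounded_linear_BV_outer_L1_def
proof (intro conjI ballI allI impI E_bound E_L1)
  fix f g assume f: "f \<in> BV_outer \<beta>" and g: "g \<in> BV_outer \<beta>"
  show "AE x in lebesgue. E (\<lambda>y. f y + g y) x = E f x + E g x"
    using E_linear[OF f g, of 1 1] by simp
  assume eq: "AE x\<in>outer \<beta> in lebesgue. f x = g x"
  have "AE x\<in>outer \<beta> in lebesgue. rep g x = f x"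
    using eq rep(2)[OF g] by eventually_elim auto
  from E_unique[OF rep(1)[OF g] this] show "AE x in lebesgue. E f x = E g x" unfolding E_def[of g] .
next
  fix c f assume f: "f \<in> BV_outer \<beta>"
  show "AE x in lebesgue. E (\<lambda>y. c * f y) x = c * E f x"
    using E_linear[OF f f, of c 0] by simp
qed

end

theorem theorem8p2:
  fixes \<beta> :: real
  assumes "1 < \<beta>"
  shows "\<exists>E :: (real \<Rightarrow> complex) \<Rightarrow> (real \<Rightarrow> complex).
    bounded_linear_BV_outer_L1 \<beta> E \<and>
    (\<forall>f\<in>BV_outer \<beta>. AE x\<in>{-\<beta>..\<beta>} - {-1..1} in lebesgue. E f x = f x) \<and>
    infinite_dimensional_ae (E ` BV_outer \<beta>) \<and>
    E ` BV_outer \<beta> \<subseteq> M_perp \<beta>"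
proof -
  interpret gauss_map \<beta> using assms by unfold_locales
  have "E ` BV_outer \<beta> \<subseteq> M_perp \<beta>"
    using complex_ext_orthogonal[OF rep(1)] unfolding E_def by blast
  then show ?thesis
    using E_bounded_linear E_extends E_infinite_dimensional by blast
qed

end
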